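(* Consider the simplified game of baccara banque with parameter $\theta\in(0,1/2]$ (see context), and let $v(\theta)$ be the value (to the Players) of the game in which the two Players form a coalition against Banker and are not constrained to act independently. Let $\theta_*\approx 0.496088$ be the root in $(0.49,0.5)$ of $6896169-1190915420\,\theta+3549548480\,\theta^2-2372477184\,\theta^3$. Then $v$ is continuous on $(0,1/2]$, increasing on $(0,\theta_*]$ and decreasing on $[\theta_*,1/2]$, and its maximum value is $v(\theta_* )\approx-0.008677388$ (rounded to the digits shown).
   Context: Simplified game of baccara banque. Let $X_1,X_2,Y$ be i.i.d. on $\{0,\ldots,9\}$ with $P(\cdot=i)=q(i)=(16+9\delta_{i,0})/13^2$ (two-card totals of Player 1, Player 2, Banker), and let $X_1',X_2',Y'$ be i.i.d. on $\{0,\ldots,9\}$, independent of these, with $P(\cdot=k)=q'(k)=(1+3\delta_{k,0})/13$ (third-card values). $M(i)$ is the remainder of $i$ modulo $10$. Player $i$'s pure strategies are $u_i\in\{0,1\}$ ($0$ = stand on two-card total 5, $1$ = draw on 5); Player $i$ draws iff $X_i\le 4+u_i$. Put $K_i=X_i'$ if $X_i\le 4+u_i$, $K_i=10$ if $5+u_i\le X_i\le 7$ (stand), $K_i=11$ if $X_i\in\{8,9\}$ (natural); put $F_i=M(X_i+X_i')$ if $X_i\le 4+u_i$ and $F_i=X_i$ otherwise. Banker's information sets are the 1144 triples $(k_1,k_2,j)\in I:=[\{0,\ldots,11\}^2\setminus\{(11,11)\}]\times\{0,\ldots,7\}$; a Banker pure strategy is a subset $T\subset I$, the set on which he draws. If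 $Y\ge 8$ or both $X_1,X_2\ge 8$, set $G_i=\mathrm{sgn}(X_i-Y)$. Otherwise let $B=M(Y+Y')$ if $(K_1,K_2,Y)\in T$ and $B=Y$ if not, and set $G_i=1$ if $X_i\ge 8$ and $G_i=\mathrm{sgn}(F_i-B)$ if $X_i\le 7$. The joint payoff to the Players is $a_{u_1,u_2,T}(\theta)=E[\theta G_1+(1-\theta)G_2]$; the payoff to Banker is $-a_{u_1,u_2,T}(\theta)$. The value is $v(\theta)=\max_{\boldsymbol p}\min_{T\subset I}\sum_{u_1,u_2\in\{0,1\}}p_{u_1u_2}\,a_{u_1,u_2,T}(\theta)$, the maximum being over all probability vectors $\boldsymbol p=(p_{00},p_{01},p_{10},p_{11})$. *)

theory Defs
  imports "HOL-Probability.Probability"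
begin

definition two_card_prob :: "nat \<Rightarrow> real" where
  "two_card_prob i = (if i \<le> 9 then (16 + 9 * of_bool (i = 0)) / 13\<^sup>2 else 0)"

definition third_card_prob :: "nat \<Rightarrow> real" where
  "third_card_prob k = (if k \<le> 9 then (1 + 3 * of_bool (k = 0)) / 13 else 0)"

definition two_card_pmf :: "nat pmf" where
  "two_card_pmf = embed_pmf two_card_prob"

definition third_card_pmf :: "nat pmf" where
  "third_card_pmf = embed_pmf third_card_prob"

lemma sum_atMost_nine:
  "(\<Sum>i\<le>(9::nat). g i) = g 0 + g 1 + g 2 + g 3 + g 4 + g 5 + g 6 + g 7 + g 8 + (g 9 :: real)"
  by (simp add: eval_nat_numeral)

lemma pmf_embed_upto_nine:
  fixes g :: "nat \<Rightarrow> real"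
  assumes nonneg: "\<And>i. 0 \<le> g i" and zero: "\<And>i. i > 9 \<Longrightarrow> g i = 0"
    and total: "(\<Sum>i\<le>9. g i) = 1"
  shows "pmf (embed_pmf g) i = g i"
proof (rule pmf_embed_pmf)
  have "(\<integral>\<^sup>+i. ennreal (g i) \<partial>count_space UNIV) = (\<Sum>i\<le>9. ennreal (g i))"
    by (rule nn_integral_count_space') (auto simp: zero)
  also have "\<dots> = ennreal (\<Sum>i\<le>9. g i)"
    by (rule sum_ennreal) (auto simp: nonneg)
  finally show "(\<integral>\<^sup>+i. ennreal (g i) \<partial>count_space UNIV) = 1"
    by (simp add: total)
qed (rule nonneg)

lemma pmf_two_card: "pmf two_card_pmf i = two_card_prob i"
  unfolding two_card_pmf_def
  by (rule pmf_embed_upto_nine) (auto simp: two_card_prob_def sum_atMost_nine)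

lemma pmf_third_card: "pmf third_card_pmf i = third_card_prob i"
  unfolding third_card_pmf_def
  by (rule pmf_embed_upto_nine) (auto simp: third_card_prob_def sum_atMost_nine)

text \<open>The joint law of \<open>(X\<^sub>1, X\<^sub>2, Y, X\<^sub>1', X\<^sub>2', Y')\<close>.\<close>

definition deal_pmf :: "(nat \<times> nat \<times> nat \<times> nat \<times> nat \<times> nat) pmf" where
  "deal_pmf =
     pair_pmf two_card_pmf (pair_pmf two_card_pmf (pair_pmf two_card_pmf
       (pair_pmf third_card_pmf (pair_pmf third_card_pmf third_card_pmf))))"

text \<open>The arguments \<open>u x x'\<close> are a Player's strategy (0 = stand on 5, 1 = draw on 5),
  two-card total and third-card value. \<open>player_signal\<close> is \<open>K\<close>, with 10 for a stand and
  11 for a natural; \<open>player_total\<close> is \<open>F\<close>.\<close>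

definition player_signal :: "nat \<Rightarrow> nat \<Rightarrow> nat \<Rightarrow> nat" where
  "player_signal u x x' = (if x \<le> 4 + u then x' else if x \<le> 7 then 10 else 11)"

definition player_total :: "nat \<Rightarrow> nat \<Rightarrow> nat \<Rightarrow> nat" where
  "player_total u x x' = (if x \<le> 4 + u then (x + x') mod 10 else x)"

definition info_sets :: "(nat \<times> nat \<times> nat) set" where
  "info_sets = {(k1, k2, j). k1 \<le> 11 \<and> k2 \<le> 11 \<and> (k1, k2) \<noteq> (11, 11) \<and> j \<le> 7}"

lemma info_sets_eq: "info_sets = (\<lambda>((k1, k2), j). (k1, k2, j)) ` ((({..11} \<times> {..11}) - {(11, 11)}) \<times> {..7})"
  by (force simp: info_sets_def)

lemma finite_info_sets: "finite info_sets"
  by (simp add: info_sets_eq)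

lemma card_info_sets: "card info_sets = 1144"
proof -
  have "card info_sets = card ((({..11::nat} \<times> {..11::nat}) - {(11, 11)}) \<times> {..7::nat})"
    unfolding info_sets_eq by (rule card_image) (auto simp: inj_on_def)
  also have "\<dots> = 1144"
    by (simp add: card_cartesian_product card_Diff_singleton)
  finally show ?thesis .
qed

definition player_gain :: "nat \<Rightarrow> nat \<Rightarrow> nat \<Rightarrow> real" where
  "player_gain x f b = (if x \<ge> 8 then 1 else sgn (real f - real b))"

definition gains ::
  "nat \<Rightarrow> nat \<Rightarrow> (nat \<times> nat \<times> nat) set \<Rightarrow> nat \<times> nat \<times> nat \<times> nat \<times> nat \<times> nat \<Rightarrow> real \<times> real" where
  "gains u1 u2 T = (\<lambda>(x1, x2, y, x1', x2', y').
     if y \<ge> 8 \<or> (x1 \<ge> 8 \<and> x2 \<ge> 8)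
     then (sgn (real x1 - real y), sgn (real x2 - real y))
     else
       (let b = (if (player_signal u1 x1 x1', player_signal u2 x2 x2', y) \<in> T
                 then (y + y') mod 10 else y)
        in (player_gain x1 (player_total u1 x1 x1') b,
            player_gain x2 (player_total u2 x2 x2') b)))"

definition payoff :: "nat \<Rightarrow> nat \<Rightarrow> (nat \<times> nat \<times> nat) set \<Rightarrow> real \<Rightarrow> real" where
  "payoff u1 u2 T \<theta> =
     measure_pmf.expectation deal_pmf
       (\<lambda>d. \<theta> * fst (gains u1 u2 T d) + (1 - \<theta>) * snd (gains u1 u2 T d))"

definition prob_vectors :: "(real \<times> real \<times> real \<times> real) set" where
  "prob_vectors = {(p00, p01, p10, p11).
     0 \<le> p00 \<and> 0 \<le> p01 \<and> 0 \<le> p10 \<and> 0 \<le> p11 \<and> p00 + p01 + p10 + p11 = 1}"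

definition coalition_payoff ::
  "real \<times> real \<times> real \<times> real \<Rightarrow> (nat \<times> nat \<times> nat) set \<Rightarrow> real \<Rightarrow> real" where
  "coalition_payoff = (\<lambda>(p00, p01, p10, p11) T \<theta>.
     p00 * payoff 0 0 T \<theta> + p01 * payoff 0 1 T \<theta> + p10 * payoff 1 0 T \<theta> + p11 * payoff 1 1 T \<theta>)"

definition guaranteed_payoff :: "real \<times> real \<times> real \<times> real \<Rightarrow> real \<Rightarrow> real" where
  "guaranteed_payoff p \<theta> = Min ((\<lambda>T. coalition_payoff p T \<theta>) ` Pow info_sets)"

text \<open>\<open>GREATEST\<close> only denotes a maximum when there is one; \<open>game_value_is_max\<close> shows
  that the maximum is always attained.\<close>

definition game_value :: "real \<Rightarrow> real" where
  "game_value \<theta> = (GREATEST w. \<exists>p\<in>prob_vectors. w = guaranteed_payoff p \<theta>)"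

lemma compact_prob_vectors: "compact prob_vectors"
proof -
  have eq: "prob_vectors = {p. 0 \<le> fst p} \<inter> {p. 0 \<le> fst (snd p)} \<inter> {p. 0 \<le> fst (snd (snd p))} \<inter>
      {p. 0 \<le> snd (snd (snd p))} \<inter>
      {p. fst p + fst (snd p) + fst (snd (snd p)) + snd (snd (snd p)) = 1}"
    by (auto simp: prob_vectors_def)
  have "closed prob_vectors"
    unfolding eq
    by (intro closed_Int closed_Collect_le closed_Collect_eq continuous_intros)
  moreover have "prob_vectors \<subseteq> {0..1} \<times> {0..1} \<times> {0..1} \<times> {0..1}"
    by (auto simp: prob_vectors_def)
  moreover have "compact ({0..1::real} \<times> {0..1::real} \<times> {0..1::real} \<times> {0..1::real})"
    by (intro compact_Times compact_Icc)
  ultimately show ?thesis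
    by (metis compact_Int_closed inf.absorb_iff2)
qed

lemma continuous_on_Min_image:
  fixes g :: "'a \<Rightarrow> 'b::topological_space \<Rightarrow> real"
  assumes "finite S" "S \<noteq> {}" "\<And>s. s \<in> S \<Longrightarrow> continuous_on A (g s)"
  shows "continuous_on A (\<lambda>x. Min ((\<lambda>s. g s x) ` S))"
  using assms
proof (induction rule: finite_ne_induct)
  case (insert s S)
  then show ?case by (auto intro!: continuous_on_min)
qed simp

lemma continuous_on_guaranteed_payoff: "continuous_on A (\<lambda>p. guaranteed_payoff p \<theta>)"
  unfolding guaranteed_payoff_def
  by (rule continuous_on_Min_image)
    (auto simp: finite_info_sets coalition_payoff_def split_beta intro!: continuous_intros)

lemma game_value_is_max:
  "\<exists>p\<in>prob_vectors. game_value \<theta> = guaranteed_payoff p \<theta>"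
  "p \<in> prob_vectors \<Longrightarrow> guaranteed_payoff p \<theta> \<le> game_value \<theta>"
proof -
  have "(1, 0, 0, 0) \<in> prob_vectors"
    by (simp add: prob_vectors_def)
  then have "prob_vectors \<noteq> {}"
    by blast
  then obtain p0 where p0: "p0 \<in> prob_vectors"
      "\<And>p. p \<in> prob_vectors \<Longrightarrow> guaranteed_payoff p \<theta> \<le> guaranteed_payoff p0 \<theta>"
    using continuous_attains_sup[OF compact_prob_vectors _ continuous_on_guaranteed_payoff] by blast
  then have "game_value \<theta> = guaranteed_payoff p0 \<theta>"
    unfolding game_value_def by (intro Greatest_equality) auto
  with p0 show "\<exists>p\<in>prob_vectors. game_value \<theta> = guaranteed_payoff p \<theta>"
    "p \<in> prob_vectors \<Longrightarrow> guaranteed_payoff p \<theta> \<le> game_value \<theta>"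
    by auto
qed

definition critical_poly :: "real \<Rightarrow> real" where
  "critical_poly \<theta> = 6896169 - 1190915420 * \<theta> + 3549548480 * \<theta>^2 - 2372477184 * \<theta>^3"

definition theta_star :: real where
  "theta_star = (THE \<theta>. 0.49 < \<theta> \<and> \<theta> < 0.5 \<and> critical_poly \<theta> = 0)"

end

theory Submission
  imports Defs
begin

text \<open>
  Let \<open>h\<^sub>p(\<theta>)\<close> be the Players' payoff when they use the mixture \<open>p\<close> and Banker replies optimally.
  Banker decides at each information set separately, so
  \<open>h\<^sub>p(\<theta>) = A(p, \<theta>) + (\<Sum>i. min 0 (E\<^sub>i(p, \<theta>)))\<close>, where \<open>E\<^sub>i\<close> is what the Players gain if
  Banker draws rather than stands at \<open>i\<close>. The functions \<open>A\<close> and \<open>E\<^sub>i\<close> are bilinear in \<open>p\<close> and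
  \<open>(\<theta>, 1 - \<theta>)\<close>, with integer coefficients over \<open>13^9\<close> (\<open>guaranteed_payoff_eq_bank_value\<close>).
  Hence \<open>h\<^sub>p\<close> is concave in \<open>\<theta>\<close>, the value is \<open>v(\<theta>) = max\<^sub>p h\<^sub>p(\<theta>)\<close>, and \<open>v\<close> is Lipschitz.
  For \<open>2/5 \<le> \<theta> \<le> 1/2\<close> the sign of \<open>E\<^sub>i\<close> depends on \<open>p\<close> and \<open>\<theta>\<close> at 77 information sets only
  (\<open>guaranteed_payoff_eq_core\<close>).

  Growth up to \<open>2/5\<close>: every \<open>h\<^sub>p\<close> increases just to the right of \<open>2/5\<close>, even if the undecided
  information sets take the worse of their two slopes (\<open>vertex_rising_at_two_fifths\<close>). By concavity
  every \<open>h\<^sub>p\<close> increases on all of \<open>(0, 2/5]\<close>, and therefore so does their maximum.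

  Growth from \<open>2/5\<close> to \<open>\<theta>\<^sub>*\<close>: a continuous function increases if to the right of every point there
  are arbitrarily close points with a larger value (\<open>strict_mono_on_locally\<close>). At \<open>\<theta>\<close> it is enough to know one
  optimal mixture \<open>p\<close> and to see that \<open>h\<^sub>p\<close> increases to the right of \<open>\<theta>\<close>, because
  \<open>v(\<tau>) \<ge> h\<^sub>p(\<tau>) > h\<^sub>p(\<theta>) = v(\<theta>)\<close>. Optimal mixtures are vertices of a linear program whose
  coefficients are affine in \<open>\<theta>\<close>, so they are polynomials in \<open>\<theta>\<close> up to normalization, on ten
  overlapping windows. Optimality is linear programming duality (\<open>certified_optimal\<close>): Banker mixes
  drawing and standing at the few information sets where the mixture makes him indifferent, and against this
  the Players' four pure strategy pairs all earn at most the value, with equality for those in use.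
  The positivity of the slope of \<open>h\<^sub>p\<close> follows from its values at the control points of the curve
  of mixtures (\<open>risingD\<close>).
  Optimality and growth thus become inequalities and identities between integer polynomials,
  checked by rewriting.

  Decrease from \<open>\<theta>\<^sub>*\<close> to \<open>1/2\<close>: on the last window the indifference at \<open>(2, 5, 5)\<close> occurs exactly
  at the root of the cubic (\<open>edge_at_edge_2_5_5\<close>). Beyond it Banker stands there, the data are symmetric
  in the two Players, and \<open>v\<close> is a decreasing fractional linear function of \<open>\<theta>(1 - \<theta>)\<close>
  (\<open>game_value_last\<close>), which also gives the maximum numerically.
\<close>

section \<open>Payoffs as sums over Banker's information sets\<close>

text \<open>All probabilities are multiples of a power of \<open>1/13\<close>; the weights below are their integer
  numerators, \<open>total_weight\<close> over \<open>13^2\<close> and \<open>card_weight\<close> over \<open>13\<close>, so that sums can be evaluated exactly.\<close>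

definition hand_weight :: "nat \<times> nat \<Rightarrow> int" where
  "hand_weight = (\<lambda>(x, x'). (if x = 0 then 25 else 16) * (if x' = 0 then 4 else 1))"

definition hands :: "(nat \<times> nat) set" where
  "hands = {..9} \<times> {..9}"

definition card_weight :: "nat \<Rightarrow> int" where
  "card_weight c = (if c = 0 then 4 else 1)"

definition total_weight :: "nat \<Rightarrow> int" where
  "total_weight x = (if x = 0 then 25 else 16)"

text \<open>A Player's natural counts as a win here against any Banker total. This is right as long as Banker has no natural.\<close>

definition gain :: "nat \<Rightarrow> nat \<Rightarrow> nat \<Rightarrow> int" where
  "gain x f b = (if x \<ge> 8 then 1 else sgn (int f - int b))"

text \<open>The numerators of \<open>P(K = k)\<close> and, below, of the expected gain of a Player against a fixed
  Banker total on the event \<open>K = k\<close>. Given the signals, the joint payoff involves the two Players' hands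
  only through these numbers.\<close>

definition signal_weight :: "nat \<Rightarrow> nat \<Rightarrow> int" where
  "signal_weight u k = (\<Sum>z\<in>hands. if player_signal u (fst z) (snd z) = k then hand_weight z else 0)"

definition signal_gain :: "nat \<Rightarrow> nat \<Rightarrow> nat \<Rightarrow> int" where
  "signal_gain u k b = (\<Sum>z\<in>hands. if player_signal u (fst z) (snd z) = k
     then hand_weight z * gain (fst z) (player_total u (fst z) (snd z)) b else 0)"

text \<open>The contribution of Banker's naturals. It involves neither \<open>\<theta>\<close> nor the strategies, since the weights
  \<open>\<theta>\<close> and \<open>1 - \<theta>\<close> meet the same expected gain.\<close>

definition natural_gain :: int where
  "natural_gain = (\<Sum>y\<in>{8..9}. \<Sum>z\<in>hands. 13 * 13^3 * total_weight y * hand_weight z * sgn (int (fst z) - int y))"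

definition drawn_gain :: "nat \<Rightarrow> nat \<Rightarrow> nat \<Rightarrow> int" where
  "drawn_gain u k j = (\<Sum>c\<le>9. card_weight c * signal_gain u k ((j + c) mod 10))"

lemma player_gain_eq: "player_gain x f b = of_int (gain x f b)"
  by (auto simp: player_gain_def gain_def sgn_if)

lemma sum_hand_weight: "(\<Sum>z\<in>hands. hand_weight z) = 13^3"
proof -
  have "(\<Sum>z\<in>hands. hand_weight z) = (\<Sum>x\<in>{0..9}. \<Sum>x'\<in>{0..9}. hand_weight (x, x'))"
    by (simp add: hands_def sum.cartesian_product atLeast0AtMost)
  also have "\<dots> = 13^3"
    by (simp add: hand_weight_def eval_nat_numeral)
  finally show ?thesis .
qed

lemma set_pmf_two_card: "set_pmf two_card_pmf \<subseteq> {..9}"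
  by (auto simp: set_pmf_iff pmf_two_card two_card_prob_def split: if_splits)

lemma set_pmf_third_card: "set_pmf third_card_pmf \<subseteq> {..9}"
  by (auto simp: set_pmf_iff pmf_third_card third_card_prob_def split: if_splits)

definition deal_gain :: "nat \<Rightarrow> nat \<Rightarrow> (nat \<times> nat \<times> nat) set \<Rightarrow> real \<Rightarrow> nat \<Rightarrow> nat \<Rightarrow> nat \<times> nat \<Rightarrow> nat \<times> nat \<Rightarrow> real" where
  "deal_gain u1 u2 T \<theta> y c z1 z2 =
     (let g = gains u1 u2 T (fst z1, fst z2, y, snd z1, snd z2, c) in \<theta> * fst g + (1 - \<theta>) * snd g)"

lemma payoff_eq_sum:
  "13^9 * payoff u1 u2 T \<theta> =
     (\<Sum>y\<le>9. \<Sum>c\<le>9. \<Sum>z1\<in>hands. \<Sum>z2\<in>hands.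
        of_int (total_weight y * card_weight c * hand_weight z1 * hand_weight z2) * deal_gain u1 u2 T \<theta> y c z1 z2)"
proof -
  define D :: "(nat \<times> nat \<times> nat \<times> nat \<times> nat \<times> nat) set" where
    "D = {..9} \<times> {..9} \<times> {..9} \<times> {..9} \<times> {..9} \<times> {..9}"
  define h where "h = (\<lambda>d. \<theta> * fst (gains u1 u2 T d) + (1 - \<theta>) * snd (gains u1 u2 T d))"
  have fin: "finite D" by (simp add: D_def)
  have "set_pmf deal_pmf \<subseteq> D"
    using set_pmf_two_card set_pmf_third_card by (force simp: deal_pmf_def D_def)
  then have "payoff u1 u2 T \<theta> = (\<Sum>d\<in>D. h d * pmf deal_pmf d)"
    unfolding payoff_def h_def
    by (subst integral_measure_pmf_real[OF fin]) auto
  then have "13^9 * payoff u1 u2 T \<theta> = (\<Sum>d\<in>D. h d * (13^9 * pmf deal_pmf d))"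
    by (simp add: sum_distrib_left sum_distrib_right mult_ac)
  also have "\<dots> = (\<Sum>(x1, x2, y, x1', x2', c)\<in>D.
      of_int (total_weight y * card_weight c * hand_weight (x1, x1') * hand_weight (x2, x2')) *
      deal_gain u1 u2 T \<theta> y c (x1, x1') (x2, x2'))"
  proof (rule sum.cong[OF refl], clarify)
    fix x1 x2 y x1' x2' c assume d: "(x1, x2, y, x1', x2', c) \<in> D"
    have two: "x \<le> 9 \<Longrightarrow> pmf two_card_pmf x = of_int (total_weight x) / 13^2" for x
      by (auto simp: pmf_two_card two_card_prob_def total_weight_def)
    have third: "x \<le> 9 \<Longrightarrow> pmf third_card_pmf x = of_int (card_weight x) / 13" for x
      by (auto simp: pmf_third_card third_card_prob_def card_weight_def)
    have hw: "hand_weight (a, b) = total_weight a * card_weight b" for a b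
      by (simp add: hand_weight_def total_weight_def card_weight_def)
    show "h (x1, x2, y, x1', x2', c) * (13^9 * pmf deal_pmf (x1, x2, y, x1', x2', c)) =
      of_int (total_weight y * card_weight c * hand_weight (x1, x1') * hand_weight (x2, x2')) *
      deal_gain u1 u2 T \<theta> y c (x1, x1') (x2, x2')"
      using d by (simp add: D_def deal_pmf_def pmf_pair two third hw h_def deal_gain_def Let_def)
  qed
  also have "\<dots> = (\<Sum>x1\<le>9. \<Sum>x2\<le>9. \<Sum>y\<le>9. \<Sum>x1'\<le>9. \<Sum>x2'\<le>9. \<Sum>c\<le>9. 
      of_int (total_weight y * card_weight c * hand_weight (x1, x1') * hand_weight (x2, x2')) *
      deal_gain u1 u2 T \<theta> y c (x1, x1') (x2, x2'))"
    by (simp only: D_def sum.cartesian_product[symmetric] split_conv)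
  also have "\<dots> = (\<Sum>y\<le>9. \<Sum>c\<le>9. \<Sum>x1\<le>9. \<Sum>x1'\<le>9. \<Sum>x2\<le>9. \<Sum>x2'\<le>9.
      of_int (total_weight y * card_weight c * hand_weight (x1, x1') * hand_weight (x2, x2')) *
      deal_gain u1 u2 T \<theta> y c (x1, x1') (x2, x2'))"
  proof -
    let ?f = "\<lambda>x1 x2 y x1' x2' c. of_int (total_weight y * card_weight c * hand_weight (x1, x1') * hand_weight (x2, x2')) *
      deal_gain u1 u2 T \<theta> y c (x1, x1') (x2, x2')"
    let ?S = "{..9::nat} \<times> {..9::nat} \<times> {..9::nat} \<times> {..9::nat} \<times> {..9::nat} \<times> {..9::nat}"
    have "(\<Sum>(x1, x2, y, x1', x2', c)\<in>?S. ?f x1 x2 y x1' x2' c) = (\<Sum>(y, c, x1, x1', x2, x2')\<in>?S. ?f x1 x2 y x1' x2' c)"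
      by (rule sum.reindex_bij_witness[where i = "\<lambda>(y, c, x1, x1', x2, x2'). (x1, x2, y, x1', x2', c)"
          and j = "\<lambda>(x1, x2, y, x1', x2', c). (y, c, x1, x1', x2, x2')"]) auto
    then show ?thesis
      by (simp only: sum.cartesian_product[symmetric] split_conv)
  qed
  also have "\<dots> = (\<Sum>y\<le>9. \<Sum>c\<le>9. \<Sum>z1\<in>hands. \<Sum>z2\<in>hands.
        of_int (total_weight y * card_weight c * hand_weight z1 * hand_weight z2) * deal_gain u1 u2 T \<theta> y c z1 z2)"
    unfolding hands_def sum.cartesian_product'  by simp
  finally show ?thesis .
qed


lemma sum_by_value:
  fixes F :: "'k \<Rightarrow> 'z \<Rightarrow> real"
  assumes "finite K" "\<And>z. z \<in> Z \<Longrightarrow> s z \<in> K"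
  shows "(\<Sum>z\<in>Z. F (s z) z) = (\<Sum>k\<in>K. \<Sum>z\<in>Z. if s z = k then F k z else 0)"
proof -
  have "(\<Sum>k\<in>K. \<Sum>z\<in>Z. if s z = k then F k z else 0) = (\<Sum>z\<in>Z. \<Sum>k\<in>K. if s z = k then F k z else 0)"
    by (rule sum.swap)
  also have "\<dots> = (\<Sum>z\<in>Z. F (s z) z)"
    using assms by (intro sum.cong) (auto simp: sum.delta')
  finally show ?thesis ..
qed

lemma sum_sum_mix:
  fixes a b c d :: "'z \<Rightarrow> real"
  shows "(\<Sum>x\<in>Z. \<Sum>y\<in>Z. s * (a x * b y) + t * (c x * d y)) =
    s * ((\<Sum>x\<in>Z. a x) * (\<Sum>y\<in>Z. b y)) + t * ((\<Sum>x\<in>Z. c x) * (\<Sum>y\<in>Z. d y))"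
  by (simp only: sum.distrib sum_product) (simp only: sum_distrib_left)

definition stage_gain :: "nat \<Rightarrow> nat \<Rightarrow> real \<Rightarrow> nat \<Rightarrow> nat \<Rightarrow> nat \<Rightarrow> real" where
  "stage_gain u1 u2 \<theta> k1 k2 b =
     \<theta> * of_int (signal_gain u1 k1 b * signal_weight u2 k2) +
     (1 - \<theta>) * of_int (signal_weight u1 k1 * signal_gain u2 k2 b)"

text \<open>The hands are independent and Banker's total is fixed once both signals are known, so the double sum
  splits into products, one factor for each Player.\<close>

lemma sum_hands_stage_gain:
  fixes b :: "nat \<Rightarrow> nat \<Rightarrow> nat"
  assumes u: "u1 \<le> 1" "u2 \<le> 1"
  defines "s1 \<equiv> \<lambda>z. player_signal u1 (fst z) (snd z)" and "s2 \<equiv> \<lambda>z. player_signal u2 (fst z) (snd z)"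
  shows "(\<Sum>z1\<in>hands. \<Sum>z2\<in>hands. of_int (hand_weight z1 * hand_weight z2) *
      (\<theta> * of_int (gain (fst z1) (player_total u1 (fst z1) (snd z1)) (b (s1 z1) (s2 z2))) +
       (1 - \<theta>) * of_int (gain (fst z2) (player_total u2 (fst z2) (snd z2)) (b (s1 z1) (s2 z2))))) =
    (\<Sum>k1\<le>11. \<Sum>k2\<le>11. stage_gain u1 u2 \<theta> k1 k2 (b k1 k2))"
proof -
  let ?g1 = "\<lambda>z b. gain (fst z) (player_total u1 (fst z) (snd z)) b"
  let ?g2 = "\<lambda>z b. gain (fst z) (player_total u2 (fst z) (snd z)) b"
  define F :: "nat \<Rightarrow> nat \<Rightarrow> nat \<times> nat \<Rightarrow> nat \<times> nat \<Rightarrow> real" where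
    "F k1 k2 z1 z2 = of_int (hand_weight z1 * hand_weight z2) *
      (\<theta> * of_int (?g1 z1 (b k1 k2)) + (1 - \<theta>) * of_int (?g2 z2 (b k1 k2)))" for k1 k2 z1 z2
  have le: "s1 z \<in> {..11}" "s2 z \<in> {..11}" if "z \<in> hands" for z
    using that by (auto simp: s1_def s2_def player_signal_def hands_def)
  have "(\<Sum>z1\<in>hands. \<Sum>z2\<in>hands. F (s1 z1) (s2 z2) z1 z2) =
      (\<Sum>k1\<le>11. \<Sum>z1\<in>hands. if s1 z1 = k1 then \<Sum>z2\<in>hands. F k1 (s2 z2) z1 z2 else 0)"
    by (rule sum_by_value[where F = "\<lambda>k1 z1. \<Sum>z2\<in>hands. F k1 (s2 z2) z1 z2"]) (use le in auto)
  also have "\<dots> = (\<Sum>k1\<le>11. \<Sum>z1\<in>hands. \<Sum>k2\<le>11. if s1 z1 = k1 then \<Sum>z2\<in>hands. if s2 z2 = k2 then F k1 k2 z1 z2 else 0 else 0)"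
    by (intro sum.cong refl) (auto intro!: sum_by_value le)
  also have "\<dots> = (\<Sum>k1\<le>11. \<Sum>k2\<le>11. \<Sum>z1\<in>hands. if s1 z1 = k1 then \<Sum>z2\<in>hands. if s2 z2 = k2 then F k1 k2 z1 z2 else 0 else 0)"
    by (intro sum.cong refl) (rule sum.swap)
  also have "\<dots> = (\<Sum>k1\<le>11. \<Sum>k2\<le>11. stage_gain u1 u2 \<theta> k1 k2 (b k1 k2))"
  proof (intro sum.cong refl)
    fix k1 k2
    let ?w1 = "\<lambda>z. real_of_int (if s1 z = k1 then hand_weight z else 0)"
    let ?w2 = "\<lambda>z. real_of_int (if s2 z = k2 then hand_weight z else 0)"
    let ?a1 = "\<lambda>z. real_of_int (if s1 z = k1 then hand_weight z * ?g1 z (b k1 k2) else 0)"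
    let ?a2 = "\<lambda>z. real_of_int (if s2 z = k2 then hand_weight z * ?g2 z (b k1 k2) else 0)"
    have "(\<Sum>z1\<in>hands. if s1 z1 = k1 then \<Sum>z2\<in>hands. if s2 z2 = k2 then F k1 k2 z1 z2 else 0 else 0) =
        (\<Sum>z1\<in>hands. \<Sum>z2\<in>hands. \<theta> * (?a1 z1 * ?w2 z2) + (1 - \<theta>) * (?w1 z1 * ?a2 z2))"
      by (intro sum.cong refl) (auto simp: F_def algebra_simps intro!: sum.cong)
    also have "\<dots> = \<theta> * ((\<Sum>z\<in>hands. ?a1 z) * (\<Sum>z\<in>hands. ?w2 z)) + (1 - \<theta>) * ((\<Sum>z\<in>hands. ?w1 z) * (\<Sum>z\<in>hands. ?a2 z))"
      by (rule sum_sum_mix)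
    also have "\<dots> = stage_gain u1 u2 \<theta> k1 k2 (b k1 k2)"
      by (simp add: stage_gain_def signal_gain_def signal_weight_def s1_def s2_def)
    finally show "(\<Sum>z1\<in>hands. if s1 z1 = k1 then \<Sum>z2\<in>hands. if s2 z2 = k2 then F k1 k2 z1 z2 else 0 else 0) =
      stage_gain u1 u2 \<theta> k1 k2 (b k1 k2)" .
  qed
  finally show ?thesis
    by (simp add: F_def)
qed

text \<open>Deals with two Player naturals need no separate treatment: each natural then beats Banker,
  whatever total he would have reached.\<close>

lemma deal_gain_le_7:
  assumes "y \<le> 7" "u1 \<le> 1" "u2 \<le> 1"
  shows "deal_gain u1 u2 T \<theta> y c z1 z2 =
    (let b = (if (player_signal u1 (fst z1) (snd z1), player_signal u2 (fst z2) (snd z2), y) \<in> T then (y + c) mod 10 else y)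
     in \<theta> * of_int (gain (fst z1) (player_total u1 (fst z1) (snd z1)) b) +
        (1 - \<theta>) * of_int (gain (fst z2) (player_total u2 (fst z2) (snd z2)) b))"
  using assms by (auto simp: deal_gain_def gains_def Let_def player_gain_eq gain_def)

lemma sum_deal_gain_ge_8:
  assumes "y \<ge> 8"
  shows "(\<Sum>z1\<in>hands. \<Sum>z2\<in>hands. of_int (hand_weight z1 * hand_weight z2) * deal_gain u1 u2 T \<theta> y c z1 z2) =
    of_int (13^3 * (\<Sum>z\<in>hands. hand_weight z * sgn (int (fst z) - int y)))"
proof -
  let ?s = "\<lambda>z. sgn (int (fst z) - int y)"
  have sgn_real: "sgn (real a - real y) = of_int (sgn (int a - int y))" for a
    by (auto simp: sgn_if)
  have "(\<Sum>z1\<in>hands. \<Sum>z2\<in>hands. of_int (hand_weight z1 * hand_weight z2) * deal_gain u1 u2 T \<theta> y c z1 z2) =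
      (\<Sum>z1\<in>hands. \<Sum>z2\<in>hands. \<theta> * (of_int (hand_weight z1 * ?s z1) * of_int (hand_weight z2)) +
        (1 - \<theta>) * (of_int (hand_weight z1) * of_int (hand_weight z2 * ?s z2)))"
    using assms by (intro sum.cong refl) (simp add: deal_gain_def gains_def Let_def sgn_real algebra_simps)
  also have "\<dots> = \<theta> * (of_int (\<Sum>z\<in>hands. hand_weight z * ?s z) * of_int (\<Sum>z\<in>hands. hand_weight z)) +
      (1 - \<theta>) * (of_int (\<Sum>z\<in>hands. hand_weight z) * of_int (\<Sum>z\<in>hands. hand_weight z * ?s z))"
    by (simp only: sum_sum_mix of_int_sum)
  also have "\<dots> = of_int (13^3 * (\<Sum>z\<in>hands. hand_weight z * ?s z))"
    by (simp only: sum_hand_weight of_int_mult) (simp add: algebra_simps)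
  finally show ?thesis .
qed

lemma sum_card_weight: "(\<Sum>c\<le>9. card_weight c) = 13"
  by (simp add: card_weight_def eval_nat_numeral)

definition stand_payoff :: "nat \<Rightarrow> nat \<Rightarrow> real \<Rightarrow> nat \<times> nat \<times> nat \<Rightarrow> real" where
  "stand_payoff u1 u2 \<theta> = (\<lambda>(k1, k2, j). 13 * of_int (total_weight j) * stage_gain u1 u2 \<theta> k1 k2 j)"

definition draw_payoff :: "nat \<Rightarrow> nat \<Rightarrow> real \<Rightarrow> nat \<times> nat \<times> nat \<Rightarrow> real" where
  "draw_payoff u1 u2 \<theta> = (\<lambda>(k1, k2, j). of_int (total_weight j) *
     (\<Sum>c\<le>9. of_int (card_weight c) * stage_gain u1 u2 \<theta> k1 k2 ((j + c) mod 10)))"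

text \<open>The sum includes the signal pair \<open>(11, 11)\<close>, which is not an information set. There both payoffs agree,
  so it does no harm and the index set becomes a product.\<close>

lemma payoff_eq_info:
  assumes "u1 \<le> 1" "u2 \<le> 1"
  shows "13^9 * payoff u1 u2 T \<theta> = of_int natural_gain +
    (\<Sum>i\<in>{..11} \<times> {..11} \<times> {..7}. if i \<in> T then draw_payoff u1 u2 \<theta> i else stand_payoff u1 u2 \<theta> i)"
proof -
  define G where "G y = (\<Sum>c\<le>9. \<Sum>z1\<in>hands. \<Sum>z2\<in>hands.
        of_int (total_weight y * card_weight c * hand_weight z1 * hand_weight z2) * deal_gain u1 u2 T \<theta> y c z1 z2)" for y
  have G_eq: "G y = of_int (total_weight y) * (\<Sum>c\<le>9. of_int (card_weight c) *
      (\<Sum>z1\<in>hands. \<Sum>z2\<in>hands. of_int (hand_weight z1 * hand_weight z2) * deal_gain u1 u2 T \<theta> y c z1 z2))" for y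
    by (simp add: G_def sum_distrib_left mult_ac)
  have nine: "{..9::nat} = {..7} \<union> {8..9}" "{..7::nat} \<inter> {8..9} = {}"
    by auto
  have low: "G y = (\<Sum>k1\<le>11. \<Sum>k2\<le>11. if (k1, k2, y) \<in> T then draw_payoff u1 u2 \<theta> (k1, k2, y) else stand_payoff u1 u2 \<theta> (k1, k2, y))"
    if "y \<le> 7" for y
  proof -
    have "(\<Sum>z1\<in>hands. \<Sum>z2\<in>hands. of_int (hand_weight z1 * hand_weight z2) * deal_gain u1 u2 T \<theta> y c z1 z2) =
        (\<Sum>k1\<le>11. \<Sum>k2\<le>11. stage_gain u1 u2 \<theta> k1 k2 (if (k1, k2, y) \<in> T then (y + c) mod 10 else y))" for c
      using sum_hands_stage_gain[OF assms, where \<theta> = \<theta> and b = "\<lambda>k1 k2. if (k1, k2, y) \<in> T then (y + c) mod 10 else y"]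
      by (simp only: deal_gain_le_7[OF that assms] Let_def)
    then have "G y = of_int (total_weight y) * (\<Sum>c\<le>9. \<Sum>k1\<le>11. \<Sum>k2\<le>11. of_int (card_weight c) *
        stage_gain u1 u2 \<theta> k1 k2 (if (k1, k2, y) \<in> T then (y + c) mod 10 else y))"
      by (simp add: G_eq sum_distrib_left)
    also have "\<dots> = of_int (total_weight y) * (\<Sum>k1\<le>11. \<Sum>k2\<le>11. \<Sum>c\<le>9. of_int (card_weight c) *
        stage_gain u1 u2 \<theta> k1 k2 (if (k1, k2, y) \<in> T then (y + c) mod 10 else y))"
      by (subst sum.swap, rule arg_cong[where f = "(*) _"], rule sum.cong[OF refl], rule sum.swap)
    also have "\<dots> = (\<Sum>k1\<le>11. \<Sum>k2\<le>11. of_int (total_weight y) * (\<Sum>c\<le>9. of_int (card_weight c) *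
        stage_gain u1 u2 \<theta> k1 k2 (if (k1, k2, y) \<in> T then (y + c) mod 10 else y)))"
      by (simp add: sum_distrib_left)
    also have "\<dots> = (\<Sum>k1\<le>11. \<Sum>k2\<le>11. if (k1, k2, y) \<in> T then draw_payoff u1 u2 \<theta> (k1, k2, y) else stand_payoff u1 u2 \<theta> (k1, k2, y))"
    proof -
      have "(\<Sum>c\<le>9. real_of_int (card_weight c) * x) = 13 * x" for x
        using sum_card_weight by (metis of_int_numeral of_int_sum sum_distrib_right)
      then show ?thesis
        by (intro sum.cong refl) (auto simp: draw_payoff_def stand_payoff_def)
    qed
    finally show ?thesis .
  qed
  have high: "(\<Sum>y\<in>{8..9}. G y) = of_int natural_gain"
  proof -
    have "G y = of_int (\<Sum>z\<in>hands. 13 * 13^3 * total_weight y * hand_weight z * sgn (int (fst z) - int y))"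
      if "y \<in> {8..9}" for y
    proof -
      have "G y = of_int (total_weight y) * (\<Sum>c\<le>9. of_int (card_weight c) * of_int (13^3 * (\<Sum>z\<in>hands. hand_weight z * sgn (int (fst z) - int y))))"
        using that by (simp only: G_eq sum_deal_gain_ge_8 atLeastAtMost_iff)
      also have "\<dots> = of_int (total_weight y * ((\<Sum>c\<le>9. card_weight c) * (13^3 * (\<Sum>z\<in>hands. hand_weight z * sgn (int (fst z) - int y)))))"
        by (simp add: sum_distrib_right)
      also have "\<dots> = of_int (\<Sum>z\<in>hands. 13 * 13^3 * total_weight y * hand_weight z * sgn (int (fst z) - int y))"
        by (simp only: sum_card_weight) (simp add: sum_distrib_left sum_distrib_right mult_ac)
      finally show ?thesis .
    qed
    then show ?thesis
      by (simp add: natural_gain_def)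
  qed
  have "13^9 * payoff u1 u2 T \<theta> = (\<Sum>y\<le>9. G y)"
    by (simp only: payoff_eq_sum G_def)
  also have "\<dots> = (\<Sum>y\<le>7. G y) + (\<Sum>y\<in>{8..9}. G y)"
    by (subst nine(1)) (rule sum.union_disjoint, use nine(2) in auto)
  also have "(\<Sum>y\<le>7. G y) = (\<Sum>y\<le>7. \<Sum>k1\<le>11. \<Sum>k2\<le>11. if (k1, k2, y) \<in> T then draw_payoff u1 u2 \<theta> (k1, k2, y) else stand_payoff u1 u2 \<theta> (k1, k2, y))"
    by (rule sum.cong) (auto simp: low)
  also have "\<dots> = (\<Sum>k1\<le>11. \<Sum>k2\<le>11. \<Sum>y\<le>7. if (k1, k2, y) \<in> T then draw_payoff u1 u2 \<theta> (k1, k2, y) else stand_payoff u1 u2 \<theta> (k1, k2, y))"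
    by (subst sum.swap, rule sum.cong[OF refl], rule sum.swap)
  also have "\<dots> = (\<Sum>i\<in>{..11} \<times> {..11} \<times> {..7}. if i \<in> T then draw_payoff u1 u2 \<theta> i else stand_payoff u1 u2 \<theta> i)"
    by (simp add: sum.cartesian_product' )
  finally show ?thesis
    by (simp add: high)
qed

section \<open>Edges\<close>

text \<open>Mixtures are lists of four weights, in the order of \<open>strategies\<close>. The coefficient type is kept general,
  because vectors of numbers and of real weights both occur.\<close>

fun dot :: "int list \<Rightarrow> 'a::comm_ring_1 list \<Rightarrow> 'a" where
  "dot (a # as) (x # xs) = of_int a * x + dot as xs"
| "dot _ _ = 0"

text \<open>A bilinear form in the mixture and \<open>(\<theta>, 1 - \<theta>)\<close>, given by its values at the four pure strategy pairs:
  the first list multiplies \<open>\<theta>\<close>, the second \<open>1 - \<theta>\<close>.\<close>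

type_synonym edge = "int list \<times> int list"

definition edge_at :: "edge \<Rightarrow> real list \<Rightarrow> real \<Rightarrow> real" where
  "edge_at e p \<theta> = \<theta> * dot (fst e) p + (1 - \<theta>) * dot (snd e) p"

definition draw_edge :: "nat \<Rightarrow> nat \<Rightarrow> nat \<Rightarrow> int" where
  "draw_edge u k j = drawn_gain u k j - 13 * signal_gain u k j"

definition strategies :: "(nat \<times> nat) list" where
  "strategies = [(0, 0), (0, 1), (1, 0), (1, 1)]"

text \<open>What the Players gain, in units of \<open>13^-9\<close>, if Banker draws rather than stands at an information set.\<close>

definition info_edge :: "nat \<times> nat \<times> nat \<Rightarrow> edge" where
  "info_edge = (\<lambda>(k1, k2, j).
     (map (\<lambda>(u1, u2). total_weight j * draw_edge u1 k1 j * signal_weight u2 k2) strategies,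
      map (\<lambda>(u1, u2). total_weight j * signal_weight u1 k1 * draw_edge u2 k2 j) strategies))"

definition stand_gain :: "nat \<Rightarrow> int" where
  "stand_gain u = natural_gain + 13^4 * (\<Sum>k\<le>11. \<Sum>j\<le>7. total_weight j * signal_gain u k j)"

text \<open>The payoff if Banker never draws. By independence the part of Player 1 does not depend on the strategy
  of Player 2, and conversely.\<close>

definition stand_edge :: edge where
  "stand_edge = (map (\<lambda>(u1, u2). stand_gain u1) strategies, map (\<lambda>(u1, u2). stand_gain u2) strategies)"

definition bank_value :: "edge \<Rightarrow> edge list \<Rightarrow> real list \<Rightarrow> real \<Rightarrow> real" where
  "bank_value b es p \<theta> = edge_at b p \<theta> + (\<Sum>e\<leftarrow>es. min 0 (edge_at e p \<theta>))"

definition all_edges :: "edge list" where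
  "all_edges = [info_edge (k1, k2, j). k1 \<leftarrow> [0..<12], k2 \<leftarrow> [0..<12], j \<leftarrow> [0..<8]]"

lemma stage_gain_drawn:
  "(\<Sum>c\<le>9. of_int (card_weight c) * stage_gain u1 u2 \<theta> k1 k2 ((j + c) mod 10)) =
    \<theta> * of_int (drawn_gain u1 k1 j * signal_weight u2 k2) + (1 - \<theta>) * of_int (signal_weight u1 k1 * drawn_gain u2 k2 j)"
  unfolding stage_gain_def drawn_gain_def of_int_mult of_int_sum sum_distrib_left sum_distrib_right sum.distrib[symmetric]
  by (rule sum.cong) (simp_all add: algebra_simps)

lemma draw_minus_stand:
  "draw_payoff u1 u2 \<theta> (k1, k2, j) - stand_payoff u1 u2 \<theta> (k1, k2, j) =
    \<theta> * of_int (total_weight j * draw_edge u1 k1 j * signal_weight u2 k2) +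
    (1 - \<theta>) * of_int (total_weight j * signal_weight u1 k1 * draw_edge u2 k2 j)"
  unfolding draw_payoff_def stand_payoff_def split_conv stage_gain_drawn
  by (simp add: stage_gain_def draw_edge_def algebra_simps)

lemma sum_signal_weight:
  assumes "u \<le> 1" shows "(\<Sum>k\<le>11. signal_weight u k) = 13^3"
proof -
  have "(\<Sum>k\<le>11. signal_weight u k) = (\<Sum>z\<in>hands. \<Sum>k\<le>11. if player_signal u (fst z) (snd z) = k then hand_weight z else 0)"
    unfolding signal_weight_def by (rule sum.swap)
  also have "\<dots> = (\<Sum>z\<in>hands. hand_weight z)"
    by (intro sum.cong refl) (auto simp: sum.delta' player_signal_def hands_def)
  finally show ?thesis
    by (simp add: sum_hand_weight)
qed

lemma sum_stand_payoff:
  assumes "u1 \<le> 1" "u2 \<le> 1"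
  shows "of_int natural_gain + (\<Sum>i\<in>{..11} \<times> {..11} \<times> {..7}. stand_payoff u1 u2 \<theta> i) =
    \<theta> * of_int (stand_gain u1) + (1 - \<theta>) * of_int (stand_gain u2)"
proof -
  let ?s = "\<lambda>u. \<Sum>k\<le>11. \<Sum>j\<le>7. total_weight j * signal_gain u k j"
  have "(\<Sum>i\<in>{..11} \<times> {..11} \<times> {..7}. stand_payoff u1 u2 \<theta> i) =
    (\<Sum>k1\<le>11. \<Sum>k2\<le>11. \<Sum>j\<le>7. 13 * \<theta> * (of_int (total_weight j * signal_gain u1 k1 j) * of_int (signal_weight u2 k2)) +
      13 * (1 - \<theta>) * (of_int (signal_weight u1 k1) * of_int (total_weight j * signal_gain u2 k2 j)))"
    by (simp add: sum.cartesian_product' stand_payoff_def stage_gain_def algebra_simps)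
  also have "\<dots> = (\<Sum>k1\<le>11. \<Sum>k2\<le>11. 13 * \<theta> * (of_int (\<Sum>j\<le>7. total_weight j * signal_gain u1 k1 j) * of_int (signal_weight u2 k2)) +
      13 * (1 - \<theta>) * (of_int (signal_weight u1 k1) * of_int (\<Sum>j\<le>7. total_weight j * signal_gain u2 k2 j)))"
    by (simp add: sum.distrib sum_distrib_left sum_distrib_right)
  also have "\<dots> = 13 * \<theta> * (of_int (?s u1) * of_int (\<Sum>k\<le>11. signal_weight u2 k)) +
      13 * (1 - \<theta>) * (of_int (\<Sum>k\<le>11. signal_weight u1 k) * of_int (?s u2))"
    by (simp only: sum_sum_mix of_int_sum)
  also have "\<dots> = \<theta> * of_int (13^4 * ?s u1) + (1 - \<theta>) * of_int (13^4 * ?s u2)"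
    unfolding sum_signal_weight[OF assms(1)] sum_signal_weight[OF assms(2)] by simp
  finally show ?thesis
    by (simp add: stand_gain_def algebra_simps)
qed

lemma payoff_eq_edges:
  assumes "u1 \<le> 1" "u2 \<le> 1" "T \<subseteq> info_sets"
  shows "13^9 * payoff u1 u2 T \<theta> = \<theta> * of_int (stand_gain u1) + (1 - \<theta>) * of_int (stand_gain u2) +
    (\<Sum>(k1, k2, j)\<in>T. \<theta> * of_int (total_weight j * draw_edge u1 k1 j * signal_weight u2 k2) +
      (1 - \<theta>) * of_int (total_weight j * signal_weight u1 k1 * draw_edge u2 k2 j))"
proof -
  let ?I = "{..11::nat} \<times> {..11::nat} \<times> {..7::nat}"
  let ?D = "draw_payoff u1 u2 \<theta>" and ?S = "stand_payoff u1 u2 \<theta>"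
  have sub: "T \<subseteq> ?I" "T \<inter> ?I = T"
    using assms(3) by (auto simp: info_sets_def)
  have "(\<Sum>i\<in>?I. if i \<in> T then ?D i else ?S i) = (\<Sum>i\<in>?I. ?S i + (if i \<in> T then ?D i - ?S i else 0))"
    by (rule sum.cong) auto
  also have "\<dots> = (\<Sum>i\<in>?I. ?S i) + (\<Sum>i\<in>T. ?D i - ?S i)"
    by (simp only: sum.distrib) (simp add: sum.inter_restrict[symmetric] Int_commute sub)
  also have "(\<Sum>i\<in>T. ?D i - ?S i) = (\<Sum>(k1, k2, j)\<in>T. \<theta> * of_int (total_weight j * draw_edge u1 k1 j * signal_weight u2 k2) +
      (1 - \<theta>) * of_int (total_weight j * signal_weight u1 k1 * draw_edge u2 k2 j))"
    by (rule sum.cong) (auto simp only: draw_minus_stand split: prod.splits)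
  finally show ?thesis
    using payoff_eq_info[OF assms(1,2), of T \<theta>] sum_stand_payoff[OF assms(1,2), of \<theta>] by simp
qed

lemma coalition_payoff_eq_edges:
  assumes "T \<subseteq> info_sets"
  shows "13^9 * coalition_payoff (p00, p01, p10, p11) T \<theta> =
    edge_at stand_edge [p00, p01, p10, p11] \<theta> + (\<Sum>i\<in>T. edge_at (info_edge i) [p00, p01, p10, p11] \<theta>)"
proof -
  define e where "e u1 u2 = (\<lambda>(k1, k2, j). \<theta> * of_int (total_weight j * draw_edge u1 k1 j * signal_weight u2 k2) +
      (1 - \<theta>) * of_int (total_weight j * signal_weight u1 k1 * draw_edge u2 k2 j))" for u1 u2
  have info: "edge_at (info_edge i) [p00, p01, p10, p11] \<theta> = p00 * e 0 0 i + p01 * e 0 1 i + p10 * e 1 0 i + p11 * e 1 1 i" for i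
    by (cases i) (simp add: edge_at_def info_edge_def strategies_def e_def algebra_simps)
  have "13^9 * payoff u1 u2 T \<theta> = \<theta> * of_int (stand_gain u1) + (1 - \<theta>) * of_int (stand_gain u2) + (\<Sum>i\<in>T. e u1 u2 i)"
    if "u1 \<le> 1" "u2 \<le> 1" for u1 u2
    using payoff_eq_edges[OF that assms] by (simp only: e_def)
  then have pay: "13^9 * payoff 0 0 T \<theta> = \<theta> * of_int (stand_gain 0) + (1 - \<theta>) * of_int (stand_gain 0) + (\<Sum>i\<in>T. e 0 0 i)"
    "13^9 * payoff 0 1 T \<theta> = \<theta> * of_int (stand_gain 0) + (1 - \<theta>) * of_int (stand_gain 1) + (\<Sum>i\<in>T. e 0 1 i)"
    "13^9 * payoff 1 0 T \<theta> = \<theta> * of_int (stand_gain 1) + (1 - \<theta>) * of_int (stand_gain 0) + (\<Sum>i\<in>T. e 1 0 i)"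
    "13^9 * payoff 1 1 T \<theta> = \<theta> * of_int (stand_gain 1) + (1 - \<theta>) * of_int (stand_gain 1) + (\<Sum>i\<in>T. e 1 1 i)"
    by blast+
  have "13^9 * coalition_payoff (p00, p01, p10, p11) T \<theta> =
     p00 * (13^9 * payoff 0 0 T \<theta>) + p01 * (13^9 * payoff 0 1 T \<theta>) + p10 * (13^9 * payoff 1 0 T \<theta>) + p11 * (13^9 * payoff 1 1 T \<theta>)"
    by (simp add: coalition_payoff_def algebra_simps)
  also have "\<dots> = edge_at stand_edge [p00, p01, p10, p11] \<theta> +
      (p00 * (\<Sum>i\<in>T. e 0 0 i) + p01 * (\<Sum>i\<in>T. e 0 1 i) + p10 * (\<Sum>i\<in>T. e 1 0 i) + p11 * (\<Sum>i\<in>T. e 1 1 i))"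
    unfolding pay by (simp add: edge_at_def stand_edge_def strategies_def algebra_simps)
  also have "p00 * (\<Sum>i\<in>T. e 0 0 i) + p01 * (\<Sum>i\<in>T. e 0 1 i) + p10 * (\<Sum>i\<in>T. e 1 0 i) + p11 * (\<Sum>i\<in>T. e 1 1 i) =
      (\<Sum>i\<in>T. edge_at (info_edge i) [p00, p01, p10, p11] \<theta>)"
    unfolding info by (simp only: sum.distrib sum_distrib_left)
  finally show ?thesis .
qed

text \<open>A sum over a chosen subset is minimized by choosing exactly the negative terms: Banker optimizes
  information set by information set.\<close>

lemma Min_sum_subsets:
  fixes f :: "'i \<Rightarrow> real"
  assumes "finite I"
  shows "Min ((\<lambda>T. c + (\<Sum>i\<in>T. f i)) ` Pow I) = c + (\<Sum>i\<in>I. min 0 (f i))"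
proof (rule Min_eqI)
  show "finite ((\<lambda>T. c + (\<Sum>i\<in>T. f i)) ` Pow I)"
    using assms by simp
next
  fix y assume "y \<in> (\<lambda>T. c + (\<Sum>i\<in>T. f i)) ` Pow I"
  then obtain T where T: "T \<subseteq> I" "y = c + (\<Sum>i\<in>T. f i)" by auto
  have "(\<Sum>i\<in>I. min 0 (f i)) \<le> (\<Sum>i\<in>I. if i \<in> T then f i else 0)"
    by (rule sum_mono) auto
  also have "\<dots> = (\<Sum>i\<in>T. f i)"
    using T(1) assms by (simp add: sum.inter_restrict[symmetric] Int_absorb1)
  finally show "c + (\<Sum>i\<in>I. min 0 (f i)) \<le> y" using T by simp
next
  have "(\<Sum>i\<in>I. min 0 (f i)) = (\<Sum>i\<in>{i\<in>I. f i < 0}. f i)"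
    using assms by (auto simp: sum.inter_filter intro!: sum.cong)
  then show "c + (\<Sum>i\<in>I. min 0 (f i)) \<in> (\<lambda>T. c + (\<Sum>i\<in>T. f i)) ` Pow I"
    by (intro image_eqI[where x = "{i\<in>I. f i < 0}"]) auto
qed

lemma guaranteed_payoff_eq_Min:
  "13^9 * guaranteed_payoff (p00, p01, p10, p11) \<theta> =
    edge_at stand_edge [p00, p01, p10, p11] \<theta> +
    (\<Sum>i\<in>info_sets. min 0 (edge_at (info_edge i) [p00, p01, p10, p11] \<theta>))"
proof -
  let ?p = "[p00, p01, p10, p11]"
  have "13^9 * guaranteed_payoff (p00, p01, p10, p11) \<theta> =
      Min ((\<lambda>T. 13^9 * coalition_payoff (p00, p01, p10, p11) T \<theta>) ` Pow info_sets)"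
    unfolding guaranteed_payoff_def
    by (subst mono_Min_commute[where f = "\<lambda>x::real. 13^9 * x"])
      (auto simp: mono_def finite_info_sets image_image)
  also have "(\<lambda>T. 13^9 * coalition_payoff (p00, p01, p10, p11) T \<theta>) ` Pow info_sets =
      (\<lambda>T. edge_at stand_edge ?p \<theta> + (\<Sum>i\<in>T. edge_at (info_edge i) ?p \<theta>)) ` Pow info_sets"
    by (rule image_cong) (auto simp only: coalition_payoff_eq_edges Pow_iff)
  finally show ?thesis
    by (simp only: Min_sum_subsets[OF finite_info_sets])
qed


section \<open>Evaluation of the coefficients\<close>

lemma sum_hands: "(\<Sum>z\<in>hands. f (fst z) (snd z)) = (\<Sum>x\<le>9. \<Sum>x'\<le>9. f x x')"
  unfolding hands_def sum.cartesian_product by (simp add: split_beta)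

lemma signal_gain_card:
  assumes "k \<le> 9" "u \<le> 1"
  shows "signal_gain u k b = card_weight k * (\<Sum>x\<le>4+u. total_weight x * sgn (int ((x + k) mod 10) - int b))"
proof -
  have "signal_gain u k b = (\<Sum>x\<le>9. \<Sum>x'\<le>9. if player_signal u x x' = k then hand_weight (x, x') * gain x (player_total u x x') b else 0)"
    using sum_hands[of "\<lambda>x x'. if player_signal u x x' = k then hand_weight (x, x') * gain x (player_total u x x') b else 0"]
    by (simp add: signal_gain_def cong: if_cong)
  also have "\<dots> = (\<Sum>x\<le>9. \<Sum>x'\<le>9. if x' = k then (if x \<le> 4 + u then card_weight k * (total_weight x * sgn (int ((x + k) mod 10) - int b)) else 0) else 0)"
    using assms by (intro sum.cong refl) (auto simp: player_signal_def player_total_def gain_def hand_weight_def total_weight_def card_weight_def)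
  also have "\<dots> = (\<Sum>x\<le>9. if x \<le> 4 + u then card_weight k * (total_weight x * sgn (int ((x + k) mod 10) - int b)) else 0)"
    using assms by simp
  also have "\<dots> = (\<Sum>x\<le>4+u. card_weight k * (total_weight x * sgn (int ((x + k) mod 10) - int b)))"
    by (rule sum.mono_neutral_cong_right) (use assms in auto)
  finally show ?thesis by (simp add: sum_distrib_left)
qed

lemma signal_weight_card:
  assumes "k \<le> 9" "u \<le> 1"
  shows "signal_weight u k = card_weight k * (\<Sum>x\<le>4+u. total_weight x)"
proof -
  have "signal_weight u k = (\<Sum>x\<le>9. \<Sum>x'\<le>9. if player_signal u x x' = k then hand_weight (x, x') else 0)"
    using sum_hands[of "\<lambda>x x'. if player_signal u x x' = k then hand_weight (x, x') else 0"]
    by (simp add: signal_weight_def cong: if_cong)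
  also have "\<dots> = (\<Sum>x\<le>9. \<Sum>x'\<le>9. if x' = k then (if x \<le> 4 + u then card_weight k * total_weight x else 0) else 0)"
    using assms by (intro sum.cong refl) (auto simp: player_signal_def hand_weight_def total_weight_def card_weight_def)
  also have "\<dots> = (\<Sum>x\<le>9. if x \<le> 4 + u then card_weight k * total_weight x else 0)"
    using assms by simp
  also have "\<dots> = (\<Sum>x\<le>4+u. card_weight k * total_weight x)"
    by (rule sum.mono_neutral_cong_right) (use assms in auto)
  finally show ?thesis by (simp add: sum_distrib_left)
qed

lemma sum_hand_weight_card: "(\<Sum>x'\<le>9. hand_weight (x, x') * m) = 13 * total_weight x * m"
  by (simp add: hand_weight_def total_weight_def eval_nat_numeral)

lemma signal_gain_stand:
  assumes "u \<le> 1"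
  shows "signal_gain u 10 b = 13 * (\<Sum>x\<in>{5+u..7}. total_weight x * sgn (int x - int b))"
proof -
  have "signal_gain u 10 b = (\<Sum>x\<le>9. \<Sum>x'\<le>9. if player_signal u x x' = 10 then hand_weight (x, x') * gain x (player_total u x x') b else 0)"
    using sum_hands[of "\<lambda>x x'. if player_signal u x x' = 10 then hand_weight (x, x') * gain x (player_total u x x') b else 0"]
    by (simp add: signal_gain_def cong: if_cong)
  also have "\<dots> = (\<Sum>x\<le>9. \<Sum>x'\<le>9. hand_weight (x, x') * (if x \<in> {5+u..7} then sgn (int x - int b) else 0))"
    using assms by (intro sum.cong refl) (auto simp: player_signal_def player_total_def gain_def)
  also have "\<dots> = (\<Sum>x\<le>9. if x \<in> {5+u..7} then 13 * (total_weight x * sgn (int x - int b)) else 0)"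
    unfolding sum_hand_weight_card by (intro sum.cong) auto
  also have "\<dots> = (\<Sum>x\<in>{5+u..7}. 13 * (total_weight x * sgn (int x - int b)))"
    by (rule sum.mono_neutral_cong_right) auto
  finally show ?thesis by (simp add: sum_distrib_left)
qed


lemma signal_weight_stand:
  assumes "u \<le> 1"
  shows "signal_weight u 10 = 13 * (\<Sum>x\<in>{5+u..7}. total_weight x)"
proof -
  have "signal_weight u 10 = (\<Sum>x\<le>9. \<Sum>x'\<le>9. if player_signal u x x' = 10 then hand_weight (x, x') else 0)"
    using sum_hands[of "\<lambda>x x'. if player_signal u x x' = 10 then hand_weight (x, x') else 0"]
    by (simp add: signal_weight_def cong: if_cong)
  also have "\<dots> = (\<Sum>x\<le>9. \<Sum>x'\<le>9. hand_weight (x, x') * (if x \<in> {5+u..7} then 1 else 0))"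
    using assms by (intro sum.cong refl) (auto simp: player_signal_def)
  also have "\<dots> = (\<Sum>x\<in>{5+u..7}. 13 * total_weight x)"
    unfolding sum_hand_weight_card by (rule sum.mono_neutral_cong_right) auto
  finally show ?thesis by (simp add: sum_distrib_left)
qed

lemma signal_natural:
  assumes "u \<le> 1"
  shows "signal_weight u 11 = 416" "signal_gain u 11 b = 416"
proof -
  have "signal_weight u 11 = (\<Sum>x\<le>9. \<Sum>x'\<le>9. if player_signal u x x' = 11 then hand_weight (x, x') else 0)"
    using sum_hands[of "\<lambda>x x'. if player_signal u x x' = 11 then hand_weight (x, x') else 0"]
    by (simp add: signal_weight_def cong: if_cong)
  also have "\<dots> = (\<Sum>x\<le>9. \<Sum>x'\<le>9. hand_weight (x, x') * (if x \<ge> 8 then 1 else 0))"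
    using assms by (intro sum.cong refl) (auto simp: player_signal_def)
  also have "\<dots> = (\<Sum>x\<in>{8..9}. 13 * total_weight x)"
    unfolding sum_hand_weight_card by (rule sum.mono_neutral_cong_right) auto
  also have "\<dots> = 416"
    by (simp add: total_weight_def eval_nat_numeral)
  finally show "signal_weight u 11 = 416" .
  moreover have "signal_gain u 11 b = signal_weight u 11"
    unfolding signal_gain_def signal_weight_def
    using assms by (intro sum.cong refl) (auto simp: player_signal_def gain_def hands_def)
  ultimately show "signal_gain u 11 b = 416" by simp
qed

text \<open>Closed forms of the coefficients, as sums over lists, which rewriting can evaluate.\<close>

definition gain_code :: "nat \<Rightarrow> nat \<Rightarrow> nat \<Rightarrow> int" where
  "gain_code u k b =
    (if k \<le> 9 then card_weight k * (\<Sum>x\<leftarrow>[0..<5+u]. total_weight x * sgn (int ((x + k) mod 10) - int b))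
     else if k = 10 then 13 * (\<Sum>x\<leftarrow>[5+u..<8]. total_weight x * sgn (int x - int b))
     else 416)"

definition weight_code :: "nat \<Rightarrow> nat \<Rightarrow> int" where
  "weight_code u k =
    (if k \<le> 9 then card_weight k * (\<Sum>x\<leftarrow>[0..<5+u]. total_weight x)
     else if k = 10 then 13 * (\<Sum>x\<leftarrow>[5+u..<8]. total_weight x)
     else 416)"

definition draw_code :: "nat \<Rightarrow> nat \<Rightarrow> nat \<Rightarrow> int" where
  "draw_code u k j = (\<Sum>c\<leftarrow>[0..<10]. card_weight c * gain_code u k ((j + c) mod 10)) - 13 * gain_code u k j"

lemma gain_code: "u \<le> 1 \<Longrightarrow> k \<le> 11 \<Longrightarrow> signal_gain u k b = gain_code u k b"
  and weight_code: "u \<le> 1 \<Longrightarrow> k \<le> 11 \<Longrightarrow> signal_weight u k = weight_code u k"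
proof -
  assume u: "u \<le> 1" and k: "k \<le> 11"
  have 1: "{..4+u} = {0..<5+u}" "{5+u..7} = {5+u..<8}"
    by auto
  consider "k \<le> 9" | "k = 10" | "k = 11"
    using k by linarith
  then have "signal_gain u k b = gain_code u k b \<and> signal_weight u k = weight_code u k"
    using u
    by cases (auto simp: gain_code_def weight_code_def signal_gain_card signal_gain_stand signal_natural
        signal_weight_card signal_weight_stand 1 interv_sum_list_conv_sum_set_nat)
  then show "signal_gain u k b = gain_code u k b" "signal_weight u k = weight_code u k"
    by blast+
qed

lemma draw_code:
  assumes "u \<le> 1" "k \<le> 11"
  shows "draw_edge u k j = draw_code u k j"
proof -
  have "{..9::nat} = {0..<10}" by auto
  then show ?thesis
    by (simp add: draw_edge_def drawn_gain_def draw_code_def gain_code[OF assms] interv_sum_list_conv_sum_set_nat)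
qed

definition signal_table :: "(int \<times> int \<times> (int \<times> int) list) list" where
  "signal_table = map (\<lambda>k. (weight_code 0 k, weight_code 1 k, map (\<lambda>j. (draw_code 0 k j, draw_code 1 k j)) [0..<8])) [0..<12]"

lemma signal_table_eq: "signal_table = [(356, 420, [(-4484, -5060), (-2844, -3420), (-1564, -2140), (-284, -860), (996, 420), (1636, 1700), (1636, 2340), (1636, 2340)]),
    (89, 105, [(-1193, -1305), (-943, -1055), (-533, -645), (-213, -325), (107, -5), (427, 315), (587, 635), (587, 795)]),
    (89, 105, [(-1015, -1095), (-1015, -1095), (-765, -845), (-355, -435), (-35, -115), (285, 205), (605, 525), (765, 845)]),
    (89, 105, [(-837, -885), (-837, -885), (-837, -885), (-587, -635), (-177, -225), (143, 95), (463, 415), (783, 735)]),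
    (89, 105, [(-659, -675), (-659, -675), (-659, -675), (-659, -675), (-409, -425), (1, -15), (321, 305), (641, 625)]),
    (89, 105, [(-481, -625), (-481, -465), (-481, -465), (-481, -465), (-481, -465), (-231, -215), (179, 195), (499, 515)]),
    (89, 105, [(-463, -735), (-303, -415), (-303, -255), (-303, -255), (-303, -255), (-303, -255), (-53, -5), (357, 405)]),
    (89, 105, [(-605, -845), (-285, -525), (-125, -205), (-125, -45), (-125, -45), (-125, -45), (-125, -45), (125, 205)]),
    (89, 105, [(-747, -955), (-427, -635), (-107, -315), (53, 5), (53, 165), (53, 165), (53, 165), (53, 165)]),
    (89, 105, [(-889, -1065), (-569, -745), (-249, -425), (71, -105), (231, 215), (231, 375), (231, 375), (231, 375)]),
    (624, 416, [(-4368, -2496), (-4368, -2496), (-4368, -2496), (-4368, -2496), (-4368, -2496), (-2288, -2496), (1872, -416), (6032, 3744)]),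
    (416, 416, [(0, 0), (0, 0), (0, 0), (0, 0), (0, 0), (0, 0), (0, 0), (0, 0)])]"
  by code_simp

lemma stand_gain_eq: "stand_gain 0 = 2076755993" "stand_gain 1 = 1970280585"
proof -
  have "(\<Sum>z\<in>hands. 13 * 13^3 * total_weight y * hand_weight z * sgn (int (fst z) - int y)) =
      (\<Sum>x\<le>9. \<Sum>x'\<le>9. 13 * 13^3 * total_weight y * hand_weight (x, x') * sgn (int x - int y))" for y
    using sum_hands[of "\<lambda>x x'. 13 * 13^3 * total_weight y * hand_weight (x, x') * sgn (int x - int y)"] by simp
  moreover have "{8..9::nat} = {8, 9}" by auto
  ultimately have "natural_gain = -1627748512"
    unfolding natural_gain_def by (simp add: eval_nat_numeral hand_weight_def total_weight_def)
  have "(\<Sum>k\<le>11. \<Sum>j\<le>7. total_weight j * signal_gain u k j) = (\<Sum>k\<leftarrow>[0..<12]. \<Sum>j\<leftarrow>[0..<8]. total_weight j * gain_code u k j)" if "u \<le> 1" for u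
  proof -
    have "{..11::nat} = {0..<12}" "{..7::nat} = {0..<8}" by auto
    then show ?thesis
      using that by (simp add: gain_code interv_sum_list_conv_sum_set_nat)
  qed
  moreover have "(\<Sum>k\<leftarrow>[0..<12]. \<Sum>j\<leftarrow>[0..<8]. total_weight j * gain_code 0 k j) = 129705" by code_simp
  moreover have "(\<Sum>k\<leftarrow>[0..<12]. \<Sum>j\<leftarrow>[0..<8]. total_weight j * gain_code 1 k j) = 125977" by code_simp
  ultimately show "stand_gain 0 = 2076755993" "stand_gain 1 = 1970280585"
    using \<open>natural_gain = -1627748512\<close>
    by (simp_all add: stand_gain_def)
qed

definition total_list :: "int list" where
  "total_list = [25, 16, 16, 16, 16, 16, 16, 16]"

type_synonym signal_row = "int \<times> int \<times> (int \<times> int) list"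

section \<open>The information sets that remain open\<close>

definition pair_edges :: "signal_row \<Rightarrow> signal_row \<Rightarrow> edge list" where
  "pair_edges = (\<lambda>(w0, w1, ds) (v0, v1, es).
     map (\<lambda>(t, (a0, a1), (b0, b1)).
       ([t * a0 * v0, t * a0 * v1, t * a1 * v0, t * a1 * v1], [t * w0 * b0, t * w0 * b1, t * w1 * b0, t * w1 * b1]))
     (zip total_list (zip ds es)))"

lemma all_edges_eq:
  "all_edges = concat (map (\<lambda>r1. concat (map (pair_edges r1) signal_table)) signal_table)"
proof -
  have totals: "total_list = map total_weight [0..<8]"
    by (simp add: total_list_def total_weight_def upt_rec)
  have "concat (map (\<lambda>r1. concat (map (pair_edges r1) signal_table)) signal_table) =
      [info_edge (k1, k2, j). k1 \<leftarrow> [0..<12], k2 \<leftarrow> [0..<12], j \<leftarrow> [0..<8]]"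
    unfolding pair_edges_def signal_table_def totals zip_map_map zip_same_conv_map map_map o_def split_conv
    by (intro arg_cong[where f = concat] map_cong refl)
       (auto simp: info_edge_def strategies_def draw_code weight_code)
  then show ?thesis by (simp add: all_edges_def)
qed

lemma guaranteed_payoff_eq_bank_value:
  "13^9 * guaranteed_payoff (p00, p01, p10, p11) \<theta> = bank_value stand_edge all_edges [p00, p01, p10, p11] \<theta>"
proof -
  define f where "f i = min 0 (edge_at (info_edge i) [p00, p01, p10, p11] \<theta>)" for i
  let ?I = "{..11::nat} \<times> {..11::nat} \<times> {..7::nat}"
  have ivl: "{0..<12::nat} = {..11}" "{0..<8::nat} = {..7}" by auto
  have concat_sum: "sum_list (map g (concat xss)) = (\<Sum>xs\<leftarrow>xss. sum_list (map g xs))" for g :: "edge \<Rightarrow> real" and xss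
    by (induction xss) auto
  have "(\<Sum>e\<leftarrow>all_edges. min 0 (edge_at e [p00, p01, p10, p11] \<theta>)) =
      (\<Sum>k1\<leftarrow>[0..<12]. \<Sum>k2\<leftarrow>[0..<12]. \<Sum>j\<leftarrow>[0..<8]. f (k1, k2, j))"
    by (simp only: all_edges_def concat_sum map_map o_def f_def)
  also have "\<dots> = (\<Sum>i\<in>?I. f i)"
    unfolding interv_sum_list_conv_sum_set_nat set_upt ivl by (simp add: sum.cartesian_product')
  also have "\<dots> = (\<Sum>i\<in>info_sets. f i)"
  proof (rule sum.mono_neutral_right)
    show "\<forall>i\<in>?I - info_sets. f i = 0"
    proof
      fix i assume "i \<in> ?I - info_sets"
      then obtain j where "i = (11, 11, j)" by (auto simp: info_sets_def)
      moreover have "draw_edge u 11 j = 0" if "u \<le> 1" for u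
        unfolding draw_edge_def drawn_gain_def signal_natural(2)[OF that] sum_distrib_right[symmetric] sum_card_weight by simp
      ultimately show "f i = 0"
        by (simp add: f_def edge_at_def info_edge_def strategies_def)
    qed
  qed (auto simp: info_sets_def)
  finally show ?thesis
    unfolding guaranteed_payoff_eq_Min bank_value_def f_def by (rule arg_cong[where f = "(+) _", OF sym])
qed

definition add_edge :: "edge \<Rightarrow> edge \<Rightarrow> edge" where
  "add_edge e f = (map2 (+) (fst e) (fst f), map2 (+) (snd e) (snd f))"

text \<open>Given criteria under which Banker certainly stands or certainly draws, settling adds the edges where he
  draws to the base payoff, forgets those where he stands and keeps the others. The same function is used on
  the whole range \<open>[2/5, 1/2]\<close> and on the windows.\<close>

fun settle_edge :: "(edge \<Rightarrow> bool) \<Rightarrow> (edge \<Rightarrow> bool) \<Rightarrow> edge \<Rightarrow> edge \<times> edge list \<Rightarrow> edge \<times> edge list" where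
  "settle_edge stand draw e (b, es) =
    (if stand e then (b, es) else if draw e then (add_edge b e, es) else (b, e # es))"

fun settle :: "(edge \<Rightarrow> bool) \<Rightarrow> (edge \<Rightarrow> bool) \<Rightarrow> edge list \<Rightarrow> edge \<times> edge list \<Rightarrow> edge \<times> edge list" where
  "settle stand draw [] s = s"
| "settle stand draw (e # es) s = settle_edge stand draw e (settle stand draw es s)"

lemma settle_append: "settle stand draw (xs @ ys) s = settle stand draw xs (settle stand draw ys s)"
  by (induction xs) auto

lemma dot_map2_add:
  "length as = length bs \<Longrightarrow> dot (map2 (+) as bs) p = dot as p + dot bs p"
proof (induction as bs arbitrary: p rule: list_induct2)
  case (Cons a as b bs)
  then show ?case by (cases p) (auto simp: algebra_simps)
qed simp

definition proper :: "edge \<Rightarrow> bool" where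
  "proper e \<longleftrightarrow> length (fst e) = 4 \<and> length (snd e) = 4"

lemma proper_add_edge: "proper b \<Longrightarrow> proper e \<Longrightarrow> proper (add_edge b e)"
  by (simp add: proper_def add_edge_def)

lemma edge_at_add_edge:
  "proper b \<Longrightarrow> proper e \<Longrightarrow> edge_at (add_edge b e) p \<theta> = edge_at b p \<theta> + edge_at e p \<theta>"
  by (simp add: proper_def edge_at_def add_edge_def dot_map2_add algebra_simps)

lemma settle_proper:
  assumes "settle stand draw es (b, []) = (g, xs)" "proper b" "list_all proper es"
  shows "proper g \<and> list_all proper xs"
  using assms
proof (induction es arbitrary: g xs)
  case (Cons e es)
  obtain g' xs' where *: "settle stand draw es (b, []) = (g', xs')" by fastforce
  then have "proper g' \<and> list_all proper xs'" using Cons by simp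
  then show ?case using Cons.prems * by (auto split: if_splits intro: proper_add_edge)
qed simp

text \<open>Fixing some of Banker's decisions can only help the Players. This needs no relation between the
  criteria and the mixture, which is what makes the upper bounds on the value valid for all mixtures.\<close>

lemma bank_value_settle_le:
  assumes "settle stand draw es (b, []) = (g, xs)" "proper b" "list_all proper es"
  shows "bank_value b es p \<theta> \<le> bank_value g xs p \<theta>"
  using assms
proof (induction es arbitrary: g xs)
  case (Cons e es)
  obtain g' xs' where *: "settle stand draw es (b, []) = (g', xs')" by fastforce
  then have "bank_value b es p \<theta> \<le> bank_value g' xs' p \<theta>" using Cons by simp
  moreover have "proper g'" using settle_proper[OF *] Cons.prems by simp
  ultimately show ?case using Cons.prems *
    by (auto simp: bank_value_def edge_at_add_edge split: if_splits)
qed simp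

lemma bank_value_settle:
  assumes "settle stand draw es (b, []) = (g, xs)" "proper b" "list_all proper es"
    and "\<And>e. proper e \<Longrightarrow> stand e \<Longrightarrow> 0 \<le> edge_at e p \<theta>" "\<And>e. proper e \<Longrightarrow> draw e \<Longrightarrow> edge_at e p \<theta> \<le> 0"
  shows "bank_value b es p \<theta> = bank_value g xs p \<theta>"
  using assms(1-3)
proof (induction es arbitrary: g xs)
  case (Cons e es)
  obtain g' xs' where *: "settle stand draw es (b, []) = (g', xs')" by fastforce
  then have "bank_value b es p \<theta> = bank_value g' xs' p \<theta>" using Cons by simp
  moreover have "proper g'" "proper e" using settle_proper[OF *] Cons.prems by auto
  ultimately show ?case using Cons.prems * assms(4,5)[of e]
    by (auto simp: bank_value_def edge_at_add_edge split: if_splits)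
qed simp

text \<open>The interval from \<open>s/n\<close> to \<open>t/n\<close> is represented by \<open>(s, t, n)\<close>.\<close>

type_synonym window = "int \<times> int \<times> int"

definition always_stand :: "window \<Rightarrow> edge \<Rightarrow> bool" where
  "always_stand = (\<lambda>(s, t, n) e. list_all2 (\<lambda>a b. 0 \<le> s * a + (n - s) * b \<and> 0 \<le> t * a + (n - t) * b) (fst e) (snd e))"

definition always_draw :: "window \<Rightarrow> edge \<Rightarrow> bool" where
  "always_draw = (\<lambda>(s, t, n) e. list_all2 (\<lambda>a b. s * a + (n - s) * b \<le> 0 \<and> t * a + (n - t) * b \<le> 0) (fst e) (snd e))"

definition window_ok :: "window \<Rightarrow> bool" where
  "window_ok = (\<lambda>(s, t, n). 0 \<le> s \<and> s < t \<and> 0 < n)"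

definition closed_window :: "window \<Rightarrow> real set" where
  "closed_window = (\<lambda>(s, t, n). {of_int s / of_int n .. of_int t / of_int n})"

text \<open>A bilinear form on the product of a simplex and an interval has its sign determined at the vertices.\<close>

lemma interpolate_nonneg:
  fixes a b \<theta> :: real
  assumes "0 \<le> (1 - s) * b + s * a" "0 \<le> (1 - t) * b + t * a" "s \<le> \<theta>" "\<theta> \<le> t" "s < t"
  shows "0 \<le> \<theta> * a + (1 - \<theta>) * b"
proof -
  have "(t - s) * (\<theta> * a + (1 - \<theta>) * b) = (t - \<theta>) * ((1 - s) * b + s * a) + (\<theta> - s) * ((1 - t) * b + t * a)"
    by (simp add: algebra_simps)
  also have "\<dots> \<ge> 0"
    using assms by simp
  finally show ?thesis
    using assms(5) by (simp add: zero_le_mult_iff)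
qed

lemma always_stand_nonneg:
  assumes "always_stand w e" "window_ok w" "list_all ((\<le>) 0) p" "\<theta> \<in> closed_window w"
  shows "0 \<le> edge_at e p \<theta>"
proof -
  obtain s t n where w: "w = (s, t, n)" by (cases w)
  have n: "0 < real_of_int n" "real_of_int s / of_int n < of_int t / of_int n"
    using assms(2) by (auto simp: w window_ok_def divide_strict_right_mono)
  have "0 \<le> \<theta> * dot as p + (1 - \<theta>) * dot bs p"
    if "list_all2 (\<lambda>a b. 0 \<le> s * a + (n - s) * b \<and> 0 \<le> t * a + (n - t) * b) as bs" for as bs
    using that assms(3)
  proof (induction as bs arbitrary: p rule: list_all2_induct)
    case (Cons a as b bs)
    have end_point: "0 \<le> (1 - of_int r / of_int n) * real_of_int b + of_int r / of_int n * real_of_int a"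
      if "0 \<le> r * a + (n - r) * b" for r
    proof -
      have "0 \<le> real_of_int (r * a + (n - r) * b) / of_int n"
        using that n(1) by (simp only: of_int_0_le_iff zero_le_divide_iff) simp
      also have "\<dots> = (1 - of_int r / of_int n) * real_of_int b + of_int r / of_int n * real_of_int a"
        using n(1) by (simp add: field_simps)
      finally show ?thesis .
    qed
    have "0 \<le> \<theta> * real_of_int a + (1 - \<theta>) * real_of_int b"
      using Cons.hyps(1) assms(4) n(2)
      by (intro interpolate_nonneg[OF end_point[of s] end_point[of t]]) (auto simp: w closed_window_def)
    then have *: "0 \<le> (\<theta> * real_of_int a + (1 - \<theta>) * real_of_int b) * x" if "0 \<le> x" for x
      using that by simp
    note IH = Cons.IH and prems = Cons.prems
    show ?case
    proof (cases p)
      case (Cons x q)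
      then show ?thesis
        using *[of x] IH[of q] prems by (simp add: algebra_simps)
    qed simp
  qed simp
  then show ?thesis
    using assms(1) by (simp add: w always_stand_def edge_at_def)
qed

definition neg_edge :: "edge \<Rightarrow> edge" where
  "neg_edge e = (map uminus (fst e), map uminus (snd e))"

lemma dot_uminus: "dot (map uminus as) p = - dot as p"
  by (induction as p rule: dot.induct) (auto simp: algebra_simps)

lemma edge_at_neg_edge: "edge_at (neg_edge e) p \<theta> = - edge_at e p \<theta>"
  by (simp add: edge_at_def neg_edge_def dot_uminus)

lemma always_draw_nonpos:
  assumes "always_draw w e" "window_ok w" "list_all ((\<le>) 0) p" "\<theta> \<in> closed_window w"
  shows "edge_at e p \<theta> \<le> 0"
proof -
  have "always_stand w (neg_edge e)"
    using assms(1) by (auto simp: always_stand_def always_draw_def neg_edge_def list_all2_map1 list_all2_map2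
        algebra_simps split: prod.splits elim!: list_all2_mono)
  then show ?thesis
    using always_stand_nonneg[of w "neg_edge e"] assms(2-) by (simp add: edge_at_neg_edge)
qed

definition upper_window :: window where "upper_window = (4, 5, 10)"

text \<open>The edges are generated and settled row by row: rewriting traverses the whole term at each step, so a
  list of all 1152 edges would make the evaluation quadratic.\<close>

fun settle_row :: "signal_row \<Rightarrow> signal_row list \<Rightarrow> edge \<times> edge list \<Rightarrow> edge \<times> edge list" where
  "settle_row r [] s = s"
| "settle_row r (r' # rs) s = settle (always_stand upper_window) (always_draw upper_window) (pair_edges r r') (settle_row r rs s)"

fun settle_table :: "signal_row list \<Rightarrow> signal_row list \<Rightarrow> edge \<times> edge list \<Rightarrow> edge \<times> edge list" where
  "settle_table [] rs s = s"
| "settle_table (r # rs') rs s = settle_row r rs (settle_table rs' rs s)"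

lemma settle_row_eq: "settle_row r rs s = settle (always_stand upper_window) (always_draw upper_window) (concat (map (pair_edges r) rs)) s"
  by (induction rs) (auto simp: settle_append)

lemma settle_table_eq:
  "settle_table rs' rs s = settle (always_stand upper_window) (always_draw upper_window) (concat (map (\<lambda>r. concat (map (pair_edges r) rs)) rs')) s"
  by (induction rs') (auto simp: settle_append settle_row_eq)

text \<open>The result of settling on \<open>[2/5, 1/2]\<close>; the open edges are listed in the lexicographic order of their
  information sets.\<close>

definition base_edge :: edge where
  "base_edge = ([-90312208, -89556240, -66504352, -63847840], [-108507792, -85840160, -108379536, -83688480])"

definition open_edges :: "edge list" where
  "open_edges = [([1418304, 1673280, 598080, 705600], [-199360, -655040, -235200, -772800]),
    ([1418304, 1673280, 598080, 705600], [-1008192, -1281600, -1189440, -1512000]),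
    ([1418304, 1673280, 598080, 705600], [-1725888, -1452480, -2036160, -1713600]),
    ([2329664, 2748480, 2420800, 2856000], [-1725888, -1452480, -2036160, -1713600]),
    ([1418304, 1673280, 598080, 705600], [-712000, -256320, -840000, -302400]),
    ([-404416, -477120, -1224640, -1444800], [301888, 28480, 356160, 33600]),
    ([-404416, -477120, -1224640, -1444800], [404416, -598080, 477120, -705600]),
    ([16333824, 10889216, 16972800, 11315200], [-13032448, -14217216, -15375360, -16773120]),
    ([152368, 179760, -7120, -8400], [152368, -7120, 179760, -8400]),
    ([152368, 179760, -7120, -8400], [-49840, -163760, -58800, -193200]),
    ([608048, 717360, 448560, 529200], [-328944, -306160, -388080, -361200]),
    ([608048, 717360, 448560, 529200], [-431472, -363120, -509040, -428400]),
    ([152368, 179760, -7120, -8400], [-178000, -64080, -210000, -75600]),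
    ([4263168, 2842112, 3144960, 2096640], [-3258112, -3554304, -3843840, -4193280]),
    ([712192, 712192, -33280, -33280], [0, 0, 0, 0]),
    ([-199360, -235200, -655040, -772800], [1418304, 598080, 1673280, 705600]),
    ([-49840, -58800, -163760, -193200], [152368, -7120, 179760, -8400]),
    ([405840, 478800, 291920, 344400], [-328944, -306160, -388080, -361200]),
    ([405840, 478800, 291920, 344400], [-431472, -363120, -509040, -428400]),
    ([405840, 478800, 291920, 344400], [-178000, -64080, -210000, -75600]),
    ([-49840, -58800, -163760, -193200], [75472, 234960, 89040, 277200]),
    ([-1008192, -1189440, -1281600, -1512000], [1418304, 598080, 1673280, 705600]),
    ([203632, 240240, 135280, 159600], [-178000, -64080, -210000, -75600]),
    ([-252048, -297360, -320400, -378000], [75472, 234960, 89040, 277200]),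
    ([-252048, -297360, -320400, -378000], [328944, 306160, 388080, 361200]),
    ([-2329664, -2748480, -2420800, -2856000], [1418304, 598080, 1673280, 705600]),
    ([1424, 1680, -21360, -25200], [1424, -21360, 1680, -25200]),
    ([6656, 6656, -99840, -99840], [0, 0, 0, 0]),
    ([-328944, -388080, -306160, -361200], [405840, 291920, 478800, 344400]),
    ([-328944, -388080, -306160, -361200], [203632, 135280, 240240, 159600]),
    ([254896, 300720, 277680, 327600], [-178000, -64080, -210000, -75600]),
    ([-328944, -388080, -306160, -361200], [75472, 234960, 89040, 277200]),
    ([-1725888, -2036160, -1452480, -1713600], [1418304, 598080, 1673280, 705600]),
    ([-431472, -509040, -363120, -428400], [608048, 448560, 717360, 529200]),
    ([-431472, -509040, -363120, -428400], [405840, 291920, 478800, 344400]),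
    ([-431472, -509040, -363120, -428400], [328944, 306160, 388080, 361200]),
    ([-431472, -509040, -363120, -428400], [328944, 534000, 388080, 630000]),
    ([-529152, -352768, -49920, -33280], [2665728, -592384, 3144960, -698880]),
    ([-712000, -840000, -256320, -302400], [1418304, 598080, 1673280, 705600]),
    ([-178000, -210000, -64080, -75600], [152368, -7120, 179760, -8400]),
    ([-178000, -210000, -64080, -75600], [203632, 135280, 240240, 159600]),
    ([-178000, -210000, -64080, -75600], [75472, 7120, 89040, 8400]),
    ([-178000, -210000, -64080, -75600], [75472, 234960, 89040, 277200]),
    ([-178000, -210000, -64080, -75600], [75472, 234960, 89040, 277200]),
    ([-178000, -210000, -64080, -75600], [75472, 234960, 89040, 277200]),
    ([-178000, -210000, -64080, -75600], [101104, -149520, 119280, -176400]),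
    ([-1248000, -832000, -449280, -299520], [2665728, -592384, 3144960, -698880]),
    ([75472, 89040, 234960, 277200], [-49840, -163760, -58800, -193200]),
    ([75472, 89040, 234960, 277200], [-75472, -7120, -89040, -8400]),
    ([75472, 89040, 7120, 8400], [-178000, -64080, -210000, -75600]),
    ([75472, 89040, 234960, 277200], [-178000, -64080, -210000, -75600]),
    ([75472, 89040, 234960, 277200], [-178000, -64080, -210000, -75600]),
    ([75472, 89040, 234960, 277200], [-178000, -64080, -210000, -75600]),
    ([75472, 89040, 7120, 8400], [101104, -149520, 119280, -176400]),
    ([529152, 352768, 1647360, 1098240], [2665728, -592384, 3144960, -698880]),
    ([328944, 388080, 306160, 361200], [-252048, -320400, -297360, -378000]),
    ([328944, 388080, 534000, 630000], [-328944, -306160, -388080, -361200]),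
    ([328944, 388080, 306160, 361200], [-431472, -363120, -509040, -428400]),
    ([328944, 388080, 534000, 630000], [-431472, -363120, -509040, -428400]),
    ([101104, 119280, -149520, -176400], [-178000, -64080, -210000, -75600]),
    ([328944, 388080, 306160, 361200], [-178000, -64080, -210000, -75600]),
    ([101104, 119280, -149520, -176400], [75472, 7120, 89040, 8400]),
    ([101104, 119280, -149520, -176400], [101104, -149520, 119280, -176400]),
    ([472576, 472576, -698880, -698880], [0, 0, 0, 0]),
    ([-13032448, -15375360, -14217216, -16773120], [16333824, 16972800, 10889216, 11315200]),
    ([-3258112, -3843840, -3554304, -4193280], [4263168, 3144960, 2842112, 2096640]),
    ([-3258112, -3843840, -3554304, -4193280], [2845440, 2046720, 1896960, 1364480]),
    ([2665728, 3144960, -592384, -698880], [-529152, -49920, -352768, -33280]),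
    ([2665728, 3144960, -592384, -698880], [-1248000, -449280, -832000, -299520]),
    ([2665728, 3144960, -592384, -698880], [529152, 1647360, 352768, 1098240]),
    ([-3258112, -3843840, -3554304, -4193280], [2306304, 3744000, 1537536, 2496000]),
    ([18690048, 12460032, -4153344, -2768896], [18690048, -4153344, 12460032, -2768896]),
    ([12460032, 12460032, -2768896, -2768896], [0, 0, 0, 0]),
    ([0, 0, 0, 0], [712192, -33280, 712192, -33280]),
    ([0, 0, 0, 0], [6656, -99840, 6656, -99840]),
    ([0, 0, 0, 0], [472576, -698880, 472576, -698880]),
    ([0, 0, 0, 0], [12460032, -2768896, 12460032, -2768896])]"

lemma stand_edge_eq: "stand_edge = ([2076755993, 2076755993, 1970280585, 1970280585], [2076755993, 1970280585, 2076755993, 1970280585])"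
  by (simp add: stand_edge_def strategies_def stand_gain_eq del: One_nat_def)

lemma settle_all_edges:
  "settle (always_stand upper_window) (always_draw upper_window) all_edges (stand_edge, []) = (base_edge, open_edges)"
  unfolding all_edges_eq settle_table_eq[symmetric] signal_table_eq stand_edge_eq by code_simp

abbreviation core :: "real list \<Rightarrow> real \<Rightarrow> real" where
  "core \<equiv> bank_value base_edge open_edges"

lemma proper_base_edge: "proper base_edge" and proper_open_edges: "list_all proper open_edges"
  by (simp_all add: proper_def base_edge_def open_edges_def)

lemma guaranteed_payoff_eq_core:
  assumes "0 \<le> p00" "0 \<le> p01" "0 \<le> p10" "0 \<le> p11" "2/5 \<le> \<theta>" "\<theta> \<le> 1/2"
  shows "13^9 * guaranteed_payoff (p00, p01, p10, p11) \<theta> = core [p00, p01, p10, p11] \<theta>"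
proof -
  have "list_all proper all_edges"
    by (auto simp: all_edges_def list_all_iff proper_def info_edge_def strategies_def)
  moreover have "proper stand_edge"
    by (simp add: proper_def stand_edge_eq)
  ultimately show ?thesis
    unfolding guaranteed_payoff_eq_bank_value
    by (intro bank_value_settle[OF settle_all_edges])
       (use assms in \<open>auto intro!: always_stand_nonneg[of upper_window] always_draw_nonpos[of upper_window]
         simp: upper_window_def window_ok_def closed_window_def\<close>)
qed

section \<open>Integer polynomials on a window\<close>

fun padd :: "int list \<Rightarrow> int list \<Rightarrow> int list" where
  "padd [] q = q"
| "padd p [] = p"
| "padd (a # p) (b # q) = (a + b) # padd p q"

definition pscale :: "int \<Rightarrow> int list \<Rightarrow> int list" where
  "pscale c p = map ((*) c) p"

fun pmul :: "int list \<Rightarrow> int list \<Rightarrow> int list" where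
  "pmul [] q = []"
| "pmul (a # p) q = padd (pscale a q) (0 # pmul p q)"

fun peval :: "int list \<Rightarrow> real \<Rightarrow> real" where
  "peval [] x = 0"
| "peval (a # p) x = of_int a + x * peval p x"

lemma peval_padd: "peval (padd p q) x = peval p x + peval q x"
  by (induction p q rule: padd.induct) (auto simp: algebra_simps)

lemma peval_pscale: "peval (pscale c p) x = of_int c * peval p x"
  by (induction p) (auto simp: pscale_def algebra_simps)

lemma peval_pmul: "peval (pmul p q) x = peval p x * peval q x"
  by (induction p) (auto simp: peval_padd peval_pscale algebra_simps)

lemma peval_zero: "list_all ((=) 0) p \<Longrightarrow> peval p x = 0"
  by (induction p) auto

lemma peval_nonneg: "list_all ((\<le>) 0) p \<Longrightarrow> 0 \<le> x \<Longrightarrow> 0 \<le> peval p x"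
  by (induction p) auto

lemma peval_pos: "list_all ((<) 0) p \<Longrightarrow> p \<noteq> [] \<Longrightarrow> 0 \<le> x \<Longrightarrow> 0 < peval p x"
proof (induction p)
  case (Cons a p)
  then have "0 \<le> peval p x"
    by (intro peval_nonneg) (auto simp: list_all_iff intro: less_imp_le)
  then show ?case using Cons by (auto intro: add_pos_nonneg)
qed simp

text \<open>The substitution \<open>\<theta> = (a + b z) / (d (1 + z))\<close> maps \<open>z \<ge> 0\<close> onto the window \<open>[a/d, b/d)\<close>. After
  clearing denominators the coefficients are, up to positive factors, the Bernstein coefficients, so that
  nonnegative coefficients prove nonnegativity on the window.\<close>

fun ppower :: "int list \<Rightarrow> nat \<Rightarrow> int list" where
  "ppower p 0 = [1]"
| "ppower p (Suc n) = pmul p (ppower p n)"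

fun pull :: "window \<Rightarrow> int list \<Rightarrow> int list" where
  "pull w [] = []"
| "pull (a, b, d) (c # q) =
    (if q = [] then [c] else padd (pscale c (ppower [d, d] (length q))) (pmul [a, b] (pull (a, b, d) q)))"

definition in_window :: "window \<Rightarrow> real \<Rightarrow> bool" where
  "in_window = (\<lambda>(a, b, d) \<theta>. of_int a / of_int d \<le> \<theta> \<and> \<theta> < of_int b / of_int d)"

definition param :: "window \<Rightarrow> real \<Rightarrow> real" where
  "param = (\<lambda>(a, b, d) \<theta>. (of_int d * \<theta> - of_int a) / (of_int b - of_int d * \<theta>))"

lemma peval_ppower: "peval (ppower p n) x = peval p x ^ n"
  by (induction n) (auto simp: peval_pmul)

lemma peval_pull_aux:
  fixes z \<theta> :: real
  assumes "of_int a + of_int b * z = of_int d * (1 + z) * \<theta>"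
  shows "peval (pull (a, b, d) q) z = (of_int d * (1 + z)) ^ (length q - 1) * peval q \<theta>"
proof (induction q)
  case (Cons c q)
  show ?case
  proof (cases q)
    case (Cons c' q')
    have D: "peval [d, d] z = of_int d * (1 + z)"
      by (simp add: algebra_simps)
    have A: "peval [a, b] z = of_int d * (1 + z) * \<theta>"
      using assms by (simp add: algebra_simps)
    have "pull (a, b, d) (c # q) = padd (pscale c (ppower [d, d] (length q))) (pmul [a, b] (pull (a, b, d) q))"
      using Cons by (metis list.distinct(1) pull.simps(2))
    then have "peval (pull (a, b, d) (c # q)) z =
        of_int c * (of_int d * (1 + z)) ^ length q + of_int d * (1 + z) * \<theta> * ((of_int d * (1 + z)) ^ (length q - 1) * peval q \<theta>)"
      by (simp only: peval_padd peval_pscale peval_ppower peval_pmul D A Cons.IH)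
    also have "\<dots> = (of_int d * (1 + z)) ^ length q * peval (c # q) \<theta>"
      using Cons by (simp add: algebra_simps)
    finally show ?thesis by simp
  qed simp
qed simp

lemma peval_pull:
  assumes "window_ok w" "in_window w \<theta>"
  obtains D where "0 < D" "\<And>q. peval (pull w q) (param w \<theta>) = D ^ (length q - 1) * peval q \<theta>"
proof -
  obtain a b d where w: "w = (a, b, d)" by (cases w)
  let ?z = "param w \<theta>"
  have d: "0 < real_of_int d" and lo: "of_int a \<le> of_int d * \<theta>" and hi: "of_int d * \<theta> < of_int b"
    using assms by (auto simp: w window_ok_def in_window_def field_simps)
  have z: "0 \<le> ?z" and "of_int a + of_int b * ?z = of_int d * (1 + ?z) * \<theta>"
    using lo hi by (auto simp: w param_def field_simps)
  then have "peval (pull w q) ?z = (of_int d * (1 + ?z)) ^ (length q - 1) * peval q \<theta>" for q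
    unfolding w by (intro peval_pull_aux)
  then show thesis
    using that[of "of_int d * (1 + ?z)"] d z by simp
qed

lemma param_nonneg: "window_ok w \<Longrightarrow> in_window w \<theta> \<Longrightarrow> 0 \<le> param w \<theta>"
  by (cases w) (auto simp: param_def window_ok_def in_window_def field_simps)

definition nonneg_on :: "window \<Rightarrow> int list \<Rightarrow> bool" where
  "nonneg_on w q = list_all ((\<le>) 0) (pull w q)"

definition pos_on :: "window \<Rightarrow> int list \<Rightarrow> bool" where
  "pos_on w q = (q \<noteq> [] \<and> list_all ((<) 0) (pull w q))"

lemma scaled_nonneg: "x = c * y \<Longrightarrow> 0 < c \<Longrightarrow> 0 \<le> x \<Longrightarrow> 0 \<le> (y :: real)"
  by (simp add: zero_le_mult_iff)

lemma nonneg_onD: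
  assumes "nonneg_on w q" "window_ok w" "in_window w \<theta>"
  shows "0 \<le> peval q \<theta>"
proof -
  obtain D where D: "0 < D" "peval (pull w q) (param w \<theta>) = D ^ (length q - 1) * peval q \<theta>"
    using peval_pull[OF assms(2,3)] by metis
  have "0 \<le> peval (pull w q) (param w \<theta>)"
    using assms by (auto simp: nonneg_on_def intro: peval_nonneg param_nonneg)
  then show ?thesis
    using scaled_nonneg[OF D(2)] D(1) by simp
qed

lemma pull_not_Nil: "q \<noteq> [] \<Longrightarrow> pull w q \<noteq> []"
proof -
  have "padd p r = [] \<longleftrightarrow> p = [] \<and> r = []" for p r
    by (induction p r rule: padd.induct) auto
  then have "q \<noteq> [] \<Longrightarrow> pull (a, b, d) q \<noteq> []" for a b d
    by (cases q; cases "tl q") auto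
  then show "q \<noteq> [] \<Longrightarrow> pull w q \<noteq> []" by (cases w) auto
qed

lemma pos_onD:
  assumes "pos_on w q" "window_ok w" "in_window w \<theta>"
  shows "0 < peval q \<theta>"
proof -
  obtain D where "0 < D" and "peval (pull w q) (param w \<theta>) = D ^ (length q - 1) * peval q \<theta>"
    using peval_pull[OF assms(2,3)] by metis
  moreover have "0 < peval (pull w q) (param w \<theta>)"
    using assms by (auto simp: pos_on_def pull_not_Nil intro!: peval_pos param_nonneg)
  ultimately show ?thesis
    by (simp add: zero_less_mult_iff)
qed

text \<open>Near the end of a window the sign of some polynomials is that of a switching polynomial, whose root is
  irrational in general. Such a polynomial is a multiple of the switching polynomial, possibly times a power of
  \<open>\<theta>\<close>, and it inherits the assumed sign.\<close>

fun strip :: "int list \<Rightarrow> int list" where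
  "strip (c # q) = (if c = 0 then strip q else c # q)"
| "strip [] = []"

definition proportional :: "int list \<Rightarrow> int list \<Rightarrow> bool" where
  "proportional q g = (q \<noteq> [] \<and> g \<noteq> [] \<and> hd q * hd g > 0 \<and>
     list_all ((=) 0) (padd (pscale (hd q) g) (pscale (- hd g) q)))"

definition guarded_nonneg :: "int list list \<Rightarrow> window \<Rightarrow> int list \<Rightarrow> bool" where
  "guarded_nonneg gs w q = (nonneg_on w q \<or> list_ex (proportional (strip q)) gs)"

lemma peval_strip: "0 \<le> \<theta> \<Longrightarrow> 0 \<le> peval (strip q) \<theta> \<Longrightarrow> 0 \<le> peval q \<theta>"
  by (induction q) (auto split: if_splits)

lemma proportional_nonneg:
  assumes "proportional q g" "0 \<le> peval g x"
  shows "0 \<le> peval q x"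
proof -
  have "real_of_int (hd q) * peval g x = real_of_int (hd g) * peval q x"
    using assms(1) peval_zero[of "padd (pscale (hd q) g) (pscale (- hd g) q)" x]
    by (simp add: proportional_def peval_padd peval_pscale)
  moreover have "0 < real_of_int (hd q) \<and> 0 < real_of_int (hd g) \<or> real_of_int (hd q) < 0 \<and> real_of_int (hd g) < 0"
    using assms(1) by (simp add: proportional_def zero_less_mult_iff)
  ultimately show ?thesis
    using assms(2) by (smt (verit) mult_nonneg_nonneg mult_nonpos_nonneg mult_pos_neg mult_neg_neg)
qed

lemma guarded_nonnegD:
  assumes "guarded_nonneg gs w q" "window_ok w" "in_window w \<theta>" "list_all (\<lambda>g. 0 \<le> peval g \<theta>) gs"
  shows "0 \<le> peval q \<theta>"
proof -
  obtain a b d where w: "w = (a, b, d)" by (cases w)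
  have "0 \<le> real_of_int a / of_int d" "real_of_int a / of_int d \<le> \<theta>"
    using assms(2,3) by (auto simp: w window_ok_def in_window_def)
  then have "0 \<le> \<theta>" by linarith
  then show ?thesis
    using assms by (auto simp: guarded_nonneg_def list_ex_iff list_all_iff
        intro: nonneg_onD peval_strip proportional_nonneg)
qed


section \<open>Mixtures that move with the parameter\<close>

fun pcomb :: "int list \<Rightarrow> int list list \<Rightarrow> int list" where
  "pcomb (k # ks) (p # ps) = padd (pscale k p) (pcomb ks ps)"
| "pcomb _ _ = []"

definition mixed :: "int list list \<Rightarrow> real \<Rightarrow> real list" where
  "mixed P \<theta> = map (\<lambda>q. peval q \<theta>) P"

lemma peval_pcomb: "peval (pcomb ks P) \<theta> = dot ks (mixed P \<theta>)"
  by (induction ks P rule: pcomb.induct) (auto simp: mixed_def peval_padd peval_pscale)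

definition coeffs_at :: "int \<Rightarrow> int \<Rightarrow> edge \<Rightarrow> int list" where
  "coeffs_at n d e = map2 (\<lambda>x y. n * x + (d - n) * y) (fst e) (snd e)"

lemma dot_map2_linear:
  "length as = length bs \<Longrightarrow> dot (map2 (\<lambda>x y. s * x + t * y) as bs) p = of_int s * dot as p + of_int t * dot bs p"
proof (induction as bs arbitrary: p rule: list_induct2)
  case (Cons a as b bs)
  then show ?case by (cases p) (auto simp: algebra_simps)
qed simp

lemma dot_coeffs_at:
  assumes "proper e" "0 < d"
  shows "dot (coeffs_at n d e) p = of_int d * edge_at e p (of_int n / of_int d)"
proof -
  have "dot (coeffs_at n d e) p = of_int n * dot (fst e) p + of_int (d - n) * dot (snd e) p"
    unfolding coeffs_at_def by (rule dot_map2_linear) (use assms in \<open>simp add: proper_def\<close>)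
  moreover have "real_of_int d \<noteq> 0" using assms by simp
  ultimately show ?thesis
    unfolding edge_at_def by (simp add: distrib_left right_diff_distrib left_diff_distrib)
qed

text \<open>For a mixture taken at any point of the window, the edge must be positive at all parameters of the window,
  not only at the one of the mixture: the growth argument keeps the mixture and moves the parameter.
  It is enough to test the two ends of the window. \<open>Q\<close> holds the mixture in the coordinate \<open>z\<close>. The strict
  inequality keeps edges that vanish identically, at which Banker is indifferent, among the open ones.\<close>

definition window_stand :: "window \<Rightarrow> int list list \<Rightarrow> edge \<Rightarrow> bool" where
  "window_stand = (\<lambda>(a, b, d) Q e.
     list_all ((<) 0) (pcomb (coeffs_at a d e) Q) \<and> list_all ((<) 0) (pcomb (coeffs_at b d e) Q))"

definition window_draw :: "window \<Rightarrow> int list list \<Rightarrow> edge \<Rightarrow> bool" where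
  "window_draw w Q e = window_stand w Q (neg_edge e)"

definition control_points :: "window \<Rightarrow> int list list \<Rightarrow> int list list" where
  "control_points w P = map (pull w) P"

definition uniform_length :: "int list list \<Rightarrow> bool" where
  "uniform_length P = (length P = 4 \<and> list_all (\<lambda>q. length q = length (hd P)) P)"

lemma dot_scale: "dot as (map ((*) c) p) = c * dot as p"
  by (induction as p rule: dot.induct) (auto simp: algebra_simps)

lemma peval_control_points:
  assumes "window_ok w" "uniform_length P" "in_window w \<theta>"
  obtains D where "0 < D" "\<And>ks. peval (pcomb ks (control_points w P)) (param w \<theta>) = D * dot ks (mixed P \<theta>)"
proof -
  obtain D where D: "0 < D" "\<And>q. peval (pull w q) (param w \<theta>) = D ^ (length q - 1) * peval q \<theta>"
    using peval_pull[OF assms(1,3)] by metis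
  have "mixed (control_points w P) (param w \<theta>) = map ((*) (D ^ (length (hd P) - 1))) (mixed P \<theta>)"
    using assms(2) by (auto simp: mixed_def control_points_def D(2) uniform_length_def list_all_iff)
  then show thesis
    using that[of "D ^ (length (hd P) - 1)"] D(1) by (simp add: peval_pcomb dot_scale)
qed

lemma window_stand_nonneg:
  assumes "window_stand w (control_points w P) e" "window_ok w" "uniform_length P" "proper e" "in_window w \<theta>" "in_window w \<tau>"
  shows "0 \<le> edge_at e (mixed P \<theta>) \<tau>"
proof -
  obtain a b d where w: "w = (a, b, d)" by (cases w)
  have d: "0 < d" "real_of_int a / of_int d < of_int b / of_int d"
    using assms(2) by (auto simp: w window_ok_def divide_strict_right_mono)
  obtain D where D: "0 < D" "\<And>ks. peval (pcomb ks (control_points w P)) (param w \<theta>) = D * dot ks (mixed P \<theta>)"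
    using peval_control_points[OF assms(2,3,5)] by metis
  have "0 \<le> dot ks (mixed P \<theta>)" if "list_all ((<) 0) (pcomb ks (control_points w P))" for ks
  proof (rule scaled_nonneg[OF D(2) D(1)])
    show "0 \<le> peval (pcomb ks (control_points w P)) (param w \<theta>)"
      by (rule peval_nonneg[OF _ param_nonneg[OF assms(2,5)]]) (use that in \<open>auto simp: list_all_iff intro: less_imp_le\<close>)
  qed
  then have "0 \<le> dot (coeffs_at a d e) (mixed P \<theta>)" "0 \<le> dot (coeffs_at b d e) (mixed P \<theta>)"
    using assms(1) by (auto simp: w window_stand_def)
  then have "0 \<le> edge_at e (mixed P \<theta>) (of_int a / of_int d)" "0 \<le> edge_at e (mixed P \<theta>) (of_int b / of_int d)"
    using d(1) by (simp_all add: dot_coeffs_at assms(4) zero_le_mult_iff)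
  then show ?thesis
    unfolding edge_at_def
    using interpolate_nonneg[of "of_int a / of_int d" _ _ "of_int b / of_int d" \<tau>] assms(6) d(2)
    by (auto simp: w in_window_def add.commute)
qed

lemma proper_neg_edge: "proper e \<Longrightarrow> proper (neg_edge e)"
  by (simp add: proper_def neg_edge_def)

lemma window_draw_nonpos:
  assumes "window_draw w (control_points w P) e" "window_ok w" "uniform_length P" "proper e" "in_window w \<theta>" "in_window w \<tau>"
  shows "edge_at e (mixed P \<theta>) \<tau> \<le> 0"
  using window_stand_nonneg[of w P "neg_edge e" \<theta> \<tau>] assms
  by (simp add: window_draw_def proper_neg_edge edge_at_neg_edge)

definition settled :: "window \<Rightarrow> int list list \<Rightarrow> edge \<times> edge list" where
  "settled w P = settle (window_stand w (control_points w P)) (window_draw w (control_points w P)) open_edges (base_edge, [])"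

lemma core_eq_settled:
  assumes "settled w P = (g, X)" "window_ok w" "uniform_length P" "in_window w \<theta>" "in_window w \<tau>"
  shows "core (mixed P \<theta>) \<tau> = bank_value g X (mixed P \<theta>) \<tau>"
  by (rule bank_value_settle[OF assms(1)[unfolded settled_def] proper_base_edge proper_open_edges])
     (auto intro: window_stand_nonneg window_draw_nonpos assms)

lemma core_le_settled: "settled w P = (g, X) \<Longrightarrow> core p \<tau> \<le> bank_value g X p \<tau>"
  by (rule bank_value_settle_le[OF _ proper_base_edge proper_open_edges]) (simp add: settled_def)

lemma settled_proper: "settled w P = (g, X) \<Longrightarrow> proper g \<and> list_all proper X"
  by (rule settle_proper[OF _ proper_base_edge proper_open_edges]) (simp add: settled_def)

definition slope :: "edge \<Rightarrow> int list" where
  "slope e = map2 (-) (fst e) (snd e)"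

lemma dot_slope: "proper e \<Longrightarrow> dot (slope e) p = dot (fst e) p - dot (snd e) p"
  using dot_map2_linear[of "fst e" "snd e" 1 "-1" p] by (simp add: slope_def proper_def)

lemma edge_at_diff: "proper e \<Longrightarrow> edge_at e p \<tau> = edge_at e p \<theta> + (\<tau> - \<theta>) * dot (slope e) p"
  by (simp add: edge_at_def dot_slope algebra_simps)

text \<open>A lower bound for the slope in \<open>\<theta>\<close>, whichever way the open edges are decided.\<close>

definition worst_slope :: "edge \<Rightarrow> edge list \<Rightarrow> real list \<Rightarrow> real" where
  "worst_slope g X p = dot (slope g) p + (\<Sum>e\<leftarrow>X. min 0 (dot (slope e) p))"

lemma min_zero_add: "x \<le> min 0 b \<Longrightarrow> min 0 a + x \<le> min 0 (a + b)" for a b x :: real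
  by (auto simp: min_def split: if_splits)

text \<open>For real \<open>a\<close> and \<open>b\<close>, \<open>min 0 (a + b) - min 0 a \<ge> min 0 b\<close>; so each open edge costs at most the
  negative part of its slope.\<close>

lemma bank_value_slope:
  assumes "proper g" "list_all proper X" "\<theta> \<le> \<tau>"
  shows "bank_value g X p \<theta> + (\<tau> - \<theta>) * worst_slope g X p \<le> bank_value g X p \<tau>"
proof -
  have "(\<Sum>e\<leftarrow>X. min 0 (edge_at e p \<theta>)) + (\<tau> - \<theta>) * (\<Sum>e\<leftarrow>X. min 0 (dot (slope e) p)) \<le> (\<Sum>e\<leftarrow>X. min 0 (edge_at e p \<tau>))"
    using assms(2)
  proof (induction X)
    case (Cons e X)
    have "(\<tau> - \<theta>) * min 0 (dot (slope e) p) \<le> min 0 ((\<tau> - \<theta>) * dot (slope e) p)"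
      using assms(3) by (auto simp: min_def mult_le_0_iff)
    then have "min 0 (edge_at e p \<theta>) + (\<tau> - \<theta>) * min 0 (dot (slope e) p) \<le> min 0 (edge_at e p \<theta> + (\<tau> - \<theta>) * dot (slope e) p)"
      by (rule min_zero_add)
    also have "edge_at e p \<theta> + (\<tau> - \<theta>) * dot (slope e) p = edge_at e p \<tau>"
      using edge_at_diff[of e p \<tau> \<theta>] Cons.prems by simp
    finally have "min 0 (edge_at e p \<theta>) + (\<tau> - \<theta>) * min 0 (dot (slope e) p) \<le> min 0 (edge_at e p \<tau>)" .
    moreover have "(\<Sum>e\<leftarrow>X. min 0 (edge_at e p \<theta>)) + (\<tau> - \<theta>) * (\<Sum>e\<leftarrow>X. min 0 (dot (slope e) p)) \<le> (\<Sum>e\<leftarrow>X. min 0 (edge_at e p \<tau>))"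
      using Cons by simp
    ultimately show ?case by (simp add: distrib_left del: min.bounded_iff)
  qed simp
  then show ?thesis
    using edge_at_diff[OF assms(1), of p \<tau> \<theta>] by (simp add: bank_value_def worst_slope_def algebra_simps)
qed

text \<open>The negative part is taken coefficientwise, which only decreases the value for \<open>z \<ge> 0\<close>.\<close>

fun slope_poly :: "int list list \<Rightarrow> edge \<Rightarrow> edge list \<Rightarrow> int list" where
  "slope_poly Q g [] = pcomb (slope g) Q"
| "slope_poly Q g (e # X) = padd (map (min 0) (pcomb (slope e) Q)) (slope_poly Q g X)"

definition rising :: "window \<Rightarrow> int list list \<Rightarrow> edge \<Rightarrow> edge list \<Rightarrow> bool" where
  "rising w P g X = (case slope_poly (control_points w P) g X of [] \<Rightarrow> False | c # cs \<Rightarrow> 0 < c \<and> list_all ((<) 0) cs)"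

lemma peval_map_min: "0 \<le> z \<Longrightarrow> peval (map (min 0) q) z \<le> min 0 (peval q z)"
proof (induction q)
  case (Cons a q)
  then have "z * peval (map (min 0) q) z \<le> z * min 0 (peval q z)"
    by (simp add: mult_left_mono)
  moreover have "z * min 0 (peval q z) \<le> min 0 (z * peval q z)"
    using Cons.prems by (auto simp: min_def mult_le_0_iff)
  ultimately have "z * peval (map (min 0) q) z \<le> min 0 (z * peval q z)" by linarith
  then show ?case using min_zero_add[of "z * peval (map (min 0) q) z" "z * peval q z" "of_int a"] by (simp add: of_int_min del: min.bounded_iff)
qed simp

lemma risingD:
  assumes "rising w P g X" "uniform_length P" "proper g" "list_all proper X" "window_ok w" "in_window w \<theta>"
  shows "0 < worst_slope g X (mixed P \<theta>)"
proof -
  let ?z = "param w \<theta>" and ?Q = "control_points w P"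
  obtain D where D: "0 < D" "\<And>ks. peval (pcomb ks ?Q) ?z = D * dot ks (mixed P \<theta>)"
    using peval_control_points[OF assms(5,2,6)] by metis
  have z: "0 \<le> ?z" by (rule param_nonneg) fact+
  have "peval (slope_poly ?Q g X) ?z \<le> D * worst_slope g X (mixed P \<theta>)"
  proof (induction X)
    case Nil
    then show ?case by (simp add: D(2) worst_slope_def)
  next
    case (Cons e X)
    have "peval (map (min 0) (pcomb (slope e) ?Q)) ?z \<le> min 0 (D * dot (slope e) (mixed P \<theta>))"
      using peval_map_min[OF z, of "pcomb (slope e) ?Q"] by (simp add: D(2))
    also have "\<dots> = D * min 0 (dot (slope e) (mixed P \<theta>))"
      using D(1) by (auto simp: min_def mult_le_0_iff zero_le_mult_iff)
    finally show ?case using Cons by (simp add: worst_slope_def peval_padd algebra_simps)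
  qed
  moreover have "0 < peval (slope_poly ?Q g X) ?z"
    using assms(1) z by (intro peval_pos) (auto simp: rising_def split: list.splits)
  ultimately have "0 < D * worst_slope g X (mixed P \<theta>)" by linarith
  then show ?thesis
    using D(1) by (simp add: zero_less_mult_iff)
qed

section \<open>Certificates of optimality\<close>

text \<open>How an open edge behaves at the proposed mixture on a window. At a \<open>Tie\<close> the edge vanishes and Banker
  draws with a probability between 0 and 1; its numerator is the first polynomial, to which one further polynomial
  is added for each \<open>Flip\<close> that is decided in favour of drawing. At a \<open>Flip\<close> the sign may change within the
  window and both decisions are covered. At \<open>Stand\<close> and \<open>Draw\<close> the sign is known, perhaps
  because of a switching polynomial.\<close>

datatype role = Tie "int list list" | Flip | Stand | Draw

definition edge_polys :: "edge \<Rightarrow> int list list" where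
  "edge_polys e = map2 (\<lambda>x y. [y, x - y]) (fst e) (snd e)"

fun pdot :: "int list list \<Rightarrow> real \<Rightarrow> real list \<Rightarrow> real" where
  "pdot (q # qs) \<theta> (x # xs) = peval q \<theta> * x + pdot qs \<theta> xs"
| "pdot _ \<theta> _ = 0"

lemma pdot_edge_polys: "proper e \<Longrightarrow> pdot (edge_polys e) \<theta> p = edge_at e p \<theta>"
proof -
  have "pdot (map2 (\<lambda>x y. [y, x - y]) as bs) \<theta> p = \<theta> * dot as p + (1 - \<theta>) * dot bs p"
    if "length as = length bs" for as bs
    using that
  proof (induction as bs arbitrary: p rule: list_induct2)
    case (Cons a as b bs)
    then show ?case by (cases p) (auto simp: algebra_simps)
  qed simp
  then show "proper e \<Longrightarrow> pdot (edge_polys e) \<theta> p = edge_at e p \<theta>"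
    by (simp add: edge_polys_def edge_at_def proper_def)
qed

definition add_columns :: "int list list \<Rightarrow> int list \<Rightarrow> edge \<Rightarrow> int list list" where
  "add_columns cs m e = map2 (\<lambda>c q. padd c (pmul m q)) cs (edge_polys e)"

lemma length_edge_polys: "proper e \<Longrightarrow> length (edge_polys e) = 4"
  by (simp add: edge_polys_def proper_def)

lemma pdot_map2_padd:
  "length cs = length qs \<Longrightarrow> pdot (map2 (\<lambda>c q. padd c (pmul m q)) cs qs) \<theta> p = pdot cs \<theta> p + peval m \<theta> * pdot qs \<theta> p"
proof (induction cs qs arbitrary: p rule: list_induct2)
  case (Cons c cs q qs)
  then show ?case by (cases p) (auto simp: peval_padd peval_pmul algebra_simps)
qed simp

lemma pdot_add_columns:
  "length cs = 4 \<Longrightarrow> proper e \<Longrightarrow> pdot (add_columns cs m e) \<theta> p = pdot cs \<theta> p + peval m \<theta> * edge_at e p \<theta>"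
  by (simp add: add_columns_def pdot_map2_padd length_edge_polys pdot_edge_polys)

lemma length_add_columns: "length cs = 4 \<Longrightarrow> proper e \<Longrightarrow> length (add_columns cs m e) = 4"
  by (simp add: add_columns_def length_edge_polys)

fun shift :: "bool list \<Rightarrow> int list list \<Rightarrow> int list" where
  "shift (c # cs) (m # ms) = (if c then padd m (shift cs ms) else shift cs ms)"
| "shift _ _ = []"

text \<open>The numerators of Banker's drawing probabilities over the common denominator \<open>D\<close>. The list \<open>cs\<close> holds the
  decisions at all flips, and \<open>fs\<close> those at the flips not yet reached.\<close>

fun weights :: "int list \<Rightarrow> bool list \<Rightarrow> bool list \<Rightarrow> role list \<Rightarrow> int list list" where
  "weights D cs fs [] = []"
| "weights D cs fs (Tie (l # ms) # rs) = padd l (shift cs ms) # weights D cs fs rs"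
| "weights D cs fs (Tie [] # rs) = [] # weights D cs fs rs"
| "weights D cs (f # fs) (Flip # rs) = (if f then D else []) # weights D cs fs rs"
| "weights D cs [] (Flip # rs) = [] # weights D cs [] rs"
| "weights D cs fs (Stand # rs) = [] # weights D cs fs rs"
| "weights D cs fs (Draw # rs) = D # weights D cs fs rs"

text \<open>The payoffs, times \<open>D\<close>, of the four pure strategy pairs against Banker's mixture.\<close>

fun columns :: "int list list \<Rightarrow> edge list \<Rightarrow> int list list \<Rightarrow> int list list" where
  "columns cols (e # es) (m # ms) = columns (add_columns cols m e) es ms"
| "columns cols _ _ = cols"

lemma pdot_columns:
  assumes "list_all proper es" "length cols = 4"
  shows "pdot (columns cols es ms) \<theta> p = pdot cols \<theta> p + (\<Sum>(e, m)\<leftarrow>zip es ms. peval m \<theta> * edge_at e p \<theta>)"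
    and "length (columns cols es ms) = 4"
  using assms
  by (induction cols es ms rule: columns.induct) (auto simp: pdot_add_columns length_add_columns)

fun mix_poly :: "int list list \<Rightarrow> int list list \<Rightarrow> int list" where
  "mix_poly (p # ps) (q # qs) = padd (pmul p q) (mix_poly ps qs)"
| "mix_poly _ _ = []"

lemma peval_mix_poly: "peval (mix_poly ps qs) \<theta> = pdot qs \<theta> (mixed ps \<theta>)"
  by (induction ps qs rule: mix_poly.induct) (auto simp: mixed_def peval_padd peval_pmul)

definition pneg :: "int list \<Rightarrow> int list" where
  "pneg q = map uminus q"

lemma peval_pneg: "peval (pneg q) x = - peval q x"
  by (induction q) (auto simp: pneg_def)

fun role_ok :: "int list list \<Rightarrow> window \<Rightarrow> int list list \<Rightarrow> edge \<Rightarrow> role \<Rightarrow> bool" where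
  "role_ok gs w P e (Tie ms) = list_all ((=) 0) (mix_poly P (edge_polys e))"
| "role_ok gs w P e Flip = True"
| "role_ok gs w P e Stand = guarded_nonneg gs w (mix_poly P (edge_polys e))"
| "role_ok gs w P e Draw = guarded_nonneg gs w (pneg (mix_poly P (edge_polys e)))"

fun weight_ok :: "int list list \<Rightarrow> window \<Rightarrow> int list \<Rightarrow> role \<Rightarrow> int list \<Rightarrow> bool" where
  "weight_ok gs w D (Tie ms) m = (guarded_nonneg gs w m \<and> guarded_nonneg gs w (padd D (pneg m)))"
| "weight_ok gs w D _ m = True"

text \<open>Complementary slackness: a strategy pair with weight zero may earn less than the value \<open>v\<close>, the others
  must earn exactly \<open>v\<close>.\<close>

definition column_ok :: "int list list \<Rightarrow> window \<Rightarrow> int list \<Rightarrow> int list \<Rightarrow> int list \<Rightarrow> bool" where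
  "column_ok gs w v p c =
    (if list_all ((=) 0) p then guarded_nonneg gs w (padd v (pneg c)) else list_all ((=) 0) (padd v (pneg c)))"

definition choice_columns :: "int list \<Rightarrow> edge \<Rightarrow> edge list \<Rightarrow> role list \<Rightarrow> bool list \<Rightarrow> int list list" where
  "choice_columns D g X rs cs = columns (map (pmul D) (edge_polys g)) X (weights D cs cs rs)"

text \<open>The fourth strategy pair, both Players drawing, is used by every mixture, so its column is the value.\<close>

definition choice_ok where
  "choice_ok gs w P D g X rs cs =
    (list_all2 (weight_ok gs w D) rs (weights D cs cs rs) \<and>
     (case choice_columns D g X rs cs of cols \<Rightarrow> list_all2 (column_ok gs w (last cols)) P cols))"

definition flip_count :: "role list \<Rightarrow> nat" where
  "flip_count rs = length (filter ((=) Flip) rs)"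

definition certified :: "int list list \<Rightarrow> window \<Rightarrow> int list list \<Rightarrow> int list \<Rightarrow> role list \<Rightarrow> edge \<Rightarrow> edge list \<Rightarrow> bool" where
  "certified gs w P D rs g X =
    (window_ok w \<and> uniform_length P \<and> list_all (guarded_nonneg gs w) P \<and> pos_on w (last P) \<and> pos_on w D \<and>
     list_all2 (role_ok gs w P) X rs \<and>
     list_all (choice_ok gs w P D g X rs) (List.n_lists (flip_count rs) [False, True]))"

fun flips :: "edge list \<Rightarrow> role list \<Rightarrow> edge list" where
  "flips (e # es) (Flip # rs) = e # flips es rs"
| "flips (e # es) (r # rs) = flips es rs"
| "flips _ _ = []"

lemma length_flips: "length es = length rs \<Longrightarrow> length (flips es rs) = flip_count rs"
  unfolding flip_count_def by (induction es rs rule: flips.induct) auto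

lemma edge_poly_eval: "proper e \<Longrightarrow> peval (mix_poly P (edge_polys e)) \<theta> = edge_at e (mixed P \<theta>) \<theta>"
  by (simp add: peval_mix_poly pdot_edge_polys)

lemma weights_correct:
  assumes "list_all2 (role_ok gs w P) X rs" "list_all2 (weight_ok gs w D) rs (weights D cs fs rs)"
    and "list_all proper X" "fs = map (\<lambda>e. edge_at e (mixed P \<theta>) \<theta> < 0) (flips X rs)"
    and "window_ok w" "in_window w \<theta>" "list_all (\<lambda>g. 0 \<le> peval g \<theta>) gs" "0 < peval D \<theta>"
  shows "list_all2 (\<lambda>e m. 0 \<le> peval m \<theta> \<and> peval m \<theta> \<le> peval D \<theta> \<and>
     peval m \<theta> * edge_at e (mixed P \<theta>) \<theta> = peval D \<theta> * min 0 (edge_at e (mixed P \<theta>) \<theta>)) X (weights D cs fs rs)"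
  using assms(1-4)
proof (induction X rs arbitrary: fs rule: list_all2_induct)
  case (Cons e X r rs)
  note nonneg = guarded_nonnegD[OF _ assms(5-7)]
  have e: "proper e" using Cons.prems by simp
  show ?case
  proof (cases r)
    case (Tie ms)
    have zero: "edge_at e (mixed P \<theta>) \<theta> = 0"
      using Cons.hyps(1) Tie edge_poly_eval[OF e, of P \<theta>] peval_zero by simp
    obtain m where m: "weights D cs fs (r # rs) = m # weights D cs fs rs" "weight_ok gs w D (Tie ms) m"
      using Cons.prems(1) Tie by (cases ms) auto
    have "0 \<le> peval m \<theta>" "0 \<le> peval (padd D (pneg m)) \<theta>"
      using m(2) nonneg by auto
    then show ?thesis
      using Cons.IH[of fs] Cons.prems Tie zero m by (cases ms) (auto simp: peval_padd peval_pneg)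
  next
    case Flip
    then obtain fs' where fs: "fs = (edge_at e (mixed P \<theta>) \<theta> < 0) # fs'" "fs' = map (\<lambda>e. edge_at e (mixed P \<theta>) \<theta> < 0) (flips X rs)"
      using Cons.prems(3) by simp
    then show ?thesis
      using Cons.IH[of fs'] Cons.prems Flip assms(8) by auto
  next
    case Stand
    then have "0 \<le> edge_at e (mixed P \<theta>) \<theta>"
      using Cons.hyps(1) nonneg edge_poly_eval[OF e, of P \<theta>] by fastforce
    then show ?thesis
      using Cons.IH[of fs] Cons.prems Stand assms(8) by auto
  next
    case Draw
    then have "0 \<le> - edge_at e (mixed P \<theta>) \<theta>"
      using Cons.hyps(1) nonneg edge_poly_eval[OF e, of P \<theta>] by (metis peval_pneg role_ok.simps(4))
    then show ?thesis
      using Cons.IH[of fs] Cons.prems Draw assms(8) by auto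
  qed
qed simp

lemma columns_le:
  assumes "list_all2 (column_ok gs w v) P cols" "length p = length P" "list_all ((\<le>) 0) p"
    and "window_ok w" "in_window w \<theta>" "list_all (\<lambda>g. 0 \<le> peval g \<theta>) gs"
  shows "pdot cols \<theta> p \<le> peval v \<theta> * sum_list p" "pdot cols \<theta> (mixed P \<theta>) = peval v \<theta> * sum_list (mixed P \<theta>)"
proof -
  note nonneg = guarded_nonnegD[OF _ assms(4-6)]
  show "pdot cols \<theta> p \<le> peval v \<theta> * sum_list p"
    using assms(1-3)
  proof (induction P cols arbitrary: p rule: list_all2_induct)
    case (Cons q P c cols)
    then obtain x p' where p: "p = x # p'" "0 \<le> x" "list_all ((\<le>) 0) p'" "length p' = length P"
      by (cases p) auto
    have "0 \<le> peval (padd v (pneg c)) \<theta>"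
      using Cons.hyps(1) nonneg peval_zero[of "padd v (pneg c)" \<theta>] by (fastforce simp: column_ok_def split: if_splits)
    then have "peval c \<theta> * x \<le> peval v \<theta> * x"
      using p(2) by (simp add: peval_padd peval_pneg mult_right_mono)
    then show ?case using Cons.IH[of p'] p by (simp add: algebra_simps)
  qed simp
  show "pdot cols \<theta> (mixed P \<theta>) = peval v \<theta> * sum_list (mixed P \<theta>)"
    using assms(1)
  proof (induction P cols rule: list_all2_induct)
    case (Cons q P c cols)
    have "peval c \<theta> * peval q \<theta> = peval v \<theta> * peval q \<theta>"
    proof (cases "list_all ((=) 0) q")
      case True
      then show ?thesis by (simp add: peval_zero)
    next
      case False
      then show ?thesis
        using Cons.hyps(1) peval_zero[of "padd v (pneg c)" \<theta>] by (simp add: column_ok_def peval_padd peval_pneg)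
    qed
    then show ?case using Cons.IH by (simp add: mixed_def algebra_simps)
  qed (simp add: mixed_def)
qed

lemma sum_list_weighted_le:
  assumes "list_all2 (\<lambda>e m. 0 \<le> peval m \<theta> \<and> peval m \<theta> \<le> D \<and> R e m) X ms"
  shows "D * (\<Sum>e\<leftarrow>X. min 0 (edge_at e p \<theta>)) \<le> (\<Sum>(e, m)\<leftarrow>zip X ms. peval m \<theta> * edge_at e p \<theta>)"
  using assms
proof (induction X ms rule: list_all2_induct)
  case (Cons e X m ms)
  have "D * min 0 (edge_at e p \<theta>) \<le> peval m \<theta> * edge_at e p \<theta>"
  proof (cases "edge_at e p \<theta> \<le> 0")
    case True
    then show ?thesis using Cons.hyps(1) by (simp add: min_def mult_right_mono_neg)
  next
    case False
    then show ?thesis using Cons.hyps(1) by (simp add: min_def)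
  qed
  then show ?case using Cons.IH by (simp add: algebra_simps)
qed simp

lemma sum_list_weighted_eq:
  assumes "list_all2 (\<lambda>e m. A e m \<and> B e m \<and> peval m \<theta> * edge_at e p \<theta> = D * min 0 (edge_at e p \<theta>)) X ms"
  shows "D * (\<Sum>e\<leftarrow>X. min 0 (edge_at e p \<theta>)) = (\<Sum>(e, m)\<leftarrow>zip X ms. peval m \<theta> * edge_at e p \<theta>)"
  using assms by (induction X ms rule: list_all2_induct) (auto simp: algebra_simps)

lemma sum_list_pos_last:
  fixes xs :: "real list"
  assumes "0 < last xs" "xs \<noteq> []" "list_all ((\<le>) 0) xs"
  shows "0 < sum_list xs"
  using assms
proof (induction xs)
  case (Cons x xs)
  then show ?case by (cases "xs = []") (auto intro: add_nonneg_pos)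
qed simp

text \<open>Duality: the drawing probabilities bound the payoff of every mixture by the largest column, and the
  proposed mixture attains this bound because at each open edge the weighted edge equals its negative part.
  The mixtures are not normalized, hence the factors \<open>sum_list\<close>.\<close>

theorem certified_optimal:
  fixes \<theta> :: real
  assumes cert: "settled w P = (g, X)" "certified gs w P D rs g X"
    and win: "in_window w \<theta>" and guards: "list_all (\<lambda>q. 0 \<le> peval q \<theta>) gs"
  defines "cs \<equiv> map (\<lambda>e. edge_at e (mixed P \<theta>) \<theta> < 0) (flips X rs)"
  defines "v \<equiv> peval (last (choice_columns D g X rs cs)) \<theta>"
  shows "0 < peval D \<theta>" "list_all ((\<le>) 0) (mixed P \<theta>)" "0 < sum_list (mixed P \<theta>)" "length (mixed P \<theta>) = 4"
    and "peval D \<theta> * core (mixed P \<theta>) \<theta> = v * sum_list (mixed P \<theta>)"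
    and "\<And>p. length p = 4 \<Longrightarrow> list_all ((\<le>) 0) p \<Longrightarrow> peval D \<theta> * core p \<theta> \<le> v * sum_list p"
proof -
  have w: "window_ok w" and P: "uniform_length P" "list_all (guarded_nonneg gs w) P" "pos_on w (last P)"
    and D: "pos_on w D" and roles: "list_all2 (role_ok gs w P) X rs"
    and choices: "list_all (choice_ok gs w P D g X rs) (List.n_lists (flip_count rs) [False, True])"
    using cert(2) by (auto simp: certified_def)
  note proper = settled_proper[OF cert(1)]
  show D0: "0 < peval D \<theta>"
    by (rule pos_onD[OF D w win])
  show len: "length (mixed P \<theta>) = 4"
    using P(1) by (simp add: mixed_def uniform_length_def)
  show nonneg: "list_all ((\<le>) 0) (mixed P \<theta>)"
    using P(2) guarded_nonnegD[OF _ w win guards] by (auto simp: mixed_def list_all_iff)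
  have "P \<noteq> []" using P(1) by (auto simp: uniform_length_def)
  then have "0 < last (mixed P \<theta>)" "mixed P \<theta> \<noteq> []"
    using pos_onD[OF P(3) w win] len by (auto simp: mixed_def last_map)
  then show "0 < sum_list (mixed P \<theta>)"
    using nonneg by (intro sum_list_pos_last) auto
  have "cs \<in> set (List.n_lists (flip_count rs) [False, True])"
    using length_flips[OF list_all2_lengthD[OF roles]] by (auto simp: cs_def set_n_lists)
  then have choice: "choice_ok gs w P D g X rs cs"
    using choices by (simp add: list_all_iff)
  define ms where "ms = weights D cs cs rs"
  define cols where "cols = columns (map (pmul D) (edge_polys g)) X ms"
  have v: "v = peval (last cols) \<theta>"
    by (simp add: v_def cols_def ms_def choice_columns_def)
  have ok: "list_all2 (weight_ok gs w D) rs ms" "list_all2 (column_ok gs w (last cols)) P cols"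
    using choice by (auto simp: choice_ok_def choice_columns_def cols_def ms_def)
  have correct: "list_all2 (\<lambda>e m. 0 \<le> peval m \<theta> \<and> peval m \<theta> \<le> peval D \<theta> \<and>
     peval m \<theta> * edge_at e (mixed P \<theta>) \<theta> = peval D \<theta> * min 0 (edge_at e (mixed P \<theta>) \<theta>)) X ms"
    unfolding ms_def
    by (rule weights_correct[OF roles]) (use ok(1) proper w win guards D0 in \<open>auto simp: ms_def cs_def\<close>)
  have "pdot (map (pmul D) qs) \<theta> p = peval D \<theta> * pdot qs \<theta> p" for qs p
    by (induction qs \<theta> p rule: pdot.induct) (auto simp: peval_pmul algebra_simps)
  then have cols: "pdot cols \<theta> p = peval D \<theta> * edge_at g p \<theta> + (\<Sum>(e, m)\<leftarrow>zip X ms. peval m \<theta> * edge_at e p \<theta>)" for p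
    using proper by (simp add: cols_def pdot_columns length_edge_polys pdot_edge_polys)
  show "peval D \<theta> * core (mixed P \<theta>) \<theta> = v * sum_list (mixed P \<theta>)"
  proof -
    have "peval D \<theta> * core (mixed P \<theta>) \<theta> = pdot cols \<theta> (mixed P \<theta>)"
      unfolding core_eq_settled[OF cert(1) w P(1) win win] unfolding bank_value_def distrib_left cols
      by (simp only: sum_list_weighted_eq[OF correct])
    also have "\<dots> = v * sum_list (mixed P \<theta>)"
      unfolding v by (rule columns_le(2)[OF ok(2) _ _ w win guards, of "mixed P \<theta>"]) (use nonneg in \<open>auto simp: mixed_def\<close>)
    finally show ?thesis .
  qed
  show "peval D \<theta> * core p \<theta> \<le> v * sum_list p" if "length p = 4" "list_all ((\<le>) 0) p" for p
  proof -
    have "peval D \<theta> * core p \<theta> \<le> peval D \<theta> * bank_value g X p \<theta>"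
      using core_le_settled[OF cert(1)] D0 by simp
    also have "\<dots> \<le> pdot cols \<theta> p"
      unfolding bank_value_def distrib_left cols using sum_list_weighted_le[OF correct] by simp
    also have "\<dots> \<le> v * sum_list p"
      unfolding v by (rule columns_le(1)[OF ok(2) _ _ w win guards]) (use that P(1) in \<open>auto simp: uniform_length_def\<close>)
    finally show ?thesis .
  qed
qed

section \<open>From mixtures to the value\<close>

definition checks :: "int list list \<Rightarrow> window \<Rightarrow> int list list \<Rightarrow> int list \<Rightarrow> role list \<Rightarrow> bool" where
  "checks gs w P D rs = (case settled w P of (g, X) \<Rightarrow> certified gs w P D rs g X \<and> rising w P g X)"

lemma edge_at_scale: "edge_at e (map ((*) c) p) \<theta> = c * edge_at e p \<theta>"
  by (simp add: edge_at_def dot_scale algebra_simps)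

lemma bank_value_scale:
  assumes "0 \<le> c"
  shows "bank_value b es (map ((*) c) p) \<theta> = c * bank_value b es p \<theta>"
proof -
  have "min 0 (c * x) = c * min 0 x" for x
    using assms by (auto simp: min_def mult_le_0_iff zero_le_mult_iff)
  then show ?thesis
    by (simp add: bank_value_def edge_at_scale distrib_left sum_list_const_mult)
qed

definition mixture :: "real list \<Rightarrow> bool" where
  "mixture p \<longleftrightarrow> length p = 4 \<and> list_all ((\<le>) 0) p \<and> sum_list p = 1"

lemma mixture_prob_vectors:
  "mixture [p00, p01, p10, p11] \<longleftrightarrow> (p00, p01, p10, p11) \<in> prob_vectors"
  by (auto simp: mixture_def prob_vectors_def)

definition game_value_scaled :: "real \<Rightarrow> real" where
  "game_value_scaled \<theta> = 13^9 * game_value \<theta>"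

lemma mixture_cases:
  assumes "mixture p"
  obtains p00 p01 p10 p11 where "p = [p00, p01, p10, p11]" "(p00, p01, p10, p11) \<in> prob_vectors"
proof -
  obtain p00 p01 p10 p11 where "p = [p00, p01, p10, p11]"
    using assms by (auto simp: mixture_def numeral_eq_Suc length_Suc_conv)
  then show thesis using that assms mixture_prob_vectors by metis
qed

lemma value_attained:
  obtains p where "mixture p" "game_value_scaled \<theta> = bank_value stand_edge all_edges p \<theta>"
proof -
  obtain p where "p \<in> prob_vectors" "game_value \<theta> = guaranteed_payoff p \<theta>"
    using game_value_is_max(1) by blast
  then show thesis
    using that guaranteed_payoff_eq_bank_value mixture_prob_vectors
    by (cases p) (metis game_value_scaled_def)
qed

lemma value_ge:
  assumes "mixture p"
  shows "bank_value stand_edge all_edges p \<theta> \<le> game_value_scaled \<theta>"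
proof -
  obtain p00 p01 p10 p11 where p: "p = [p00, p01, p10, p11]" "(p00, p01, p10, p11) \<in> prob_vectors"
    by (rule mixture_cases[OF assms])
  then show ?thesis
    using game_value_is_max(2)[OF p(2), of \<theta>] guaranteed_payoff_eq_bank_value[of p00 p01 p10 p11 \<theta>]
    by (simp add: game_value_scaled_def)
qed

lemma core_eq:
  assumes "mixture p" "2/5 \<le> \<theta>" "\<theta> \<le> 1/2"
  shows "bank_value stand_edge all_edges p \<theta> = core p \<theta>"
proof -
  obtain p00 p01 p10 p11 where p: "p = [p00, p01, p10, p11]" "(p00, p01, p10, p11) \<in> prob_vectors"
    by (rule mixture_cases[OF assms(1)])
  then show ?thesis
    using guaranteed_payoff_eq_core[of p00 p01 p10 p11 \<theta>] guaranteed_payoff_eq_bank_value[of p00 p01 p10 p11 \<theta>] assms(2,3)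
    by (simp add: prob_vectors_def)
qed

lemma core_le_value:
  assumes "length p = 4" "list_all ((\<le>) 0) p" "2/5 \<le> \<theta>" "\<theta> \<le> 1/2" "0 < sum_list p"
  shows "core p \<theta> \<le> sum_list p * game_value_scaled \<theta>"
proof -
  define q where "q = map ((*) (inverse (sum_list p))) p"
  have "mixture q"
    using assms by (auto simp: mixture_def q_def sum_list_const_mult list_all_iff)
  then have "core q \<theta> \<le> game_value_scaled \<theta>"
    using value_ge[of q \<theta>] core_eq assms by simp
  then show ?thesis
    using assms(5) by (simp add: q_def bank_value_scale field_simps)
qed

lemma certified_value:
  assumes "settled w P = (g, X)" "certified gs w P D rs g X" "in_window w \<theta>" "list_all (\<lambda>q. 0 \<le> peval q \<theta>) gs"
    and "2/5 \<le> \<theta>" "\<theta> \<le> 1/2"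
  defines "cs \<equiv> map (\<lambda>e. edge_at e (mixed P \<theta>) \<theta> < 0) (flips X rs)"
  shows "peval D \<theta> * game_value_scaled \<theta> = peval (last (choice_columns D g X rs cs)) \<theta>"
    and "core (mixed P \<theta>) \<theta> = sum_list (mixed P \<theta>) * game_value_scaled \<theta>"
proof -
  let ?v = "peval (last (choice_columns D g X rs cs)) \<theta>"
  note opt = certified_optimal[OF assms(1-4), folded cs_def]
  obtain p where p: "mixture p" "game_value_scaled \<theta> = core p \<theta>"
    using value_attained[of \<theta>] core_eq assms(5,6) by metis
  have le: "peval D \<theta> * game_value_scaled \<theta> \<le> ?v"
    using opt(6)[of p] p by (simp add: mixture_def)
  have "peval D \<theta> * core (mixed P \<theta>) \<theta> \<le> peval D \<theta> * (sum_list (mixed P \<theta>) * game_value_scaled \<theta>)"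
    using core_le_value[OF opt(4,2) assms(5,6) opt(3)] opt(1) by simp
  then have "sum_list (mixed P \<theta>) * ?v \<le> sum_list (mixed P \<theta>) * (peval D \<theta> * game_value_scaled \<theta>)"
    using opt(5) by (simp add: mult_ac)
  then show v: "peval D \<theta> * game_value_scaled \<theta> = ?v"
    using le opt(3) by simp
  show "core (mixed P \<theta>) \<theta> = sum_list (mixed P \<theta>) * game_value_scaled \<theta>"
    using opt(1,5) v[symmetric] by simp
qed

text \<open>An optimal mixture whose guarantee grows forces the value to grow; nothing need be known about the
  optimal mixture at the later parameter.\<close>

lemma certified_rises:
  assumes "settled w P = (g, X)" "certified gs w P D rs g X" "in_window w \<theta>" "list_all (\<lambda>q. 0 \<le> peval q \<theta>) gs"
    and "2/5 \<le> \<theta>" "\<theta> < \<tau>" "\<tau> \<le> 1/2" and rise: "core (mixed P \<theta>) \<theta> < core (mixed P \<theta>) \<tau>"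
  shows "game_value_scaled \<theta> < game_value_scaled \<tau>"
proof -
  note opt = certified_optimal[OF assms(1-4)]
  have "sum_list (mixed P \<theta>) * game_value_scaled \<theta> < sum_list (mixed P \<theta>) * game_value_scaled \<tau>"
    using certified_value(2)[OF assms(1-5)] rise core_le_value[OF opt(4,2) _ assms(7) opt(3)] assms(5-7) by simp
  then show ?thesis
    using opt(3) by simp
qed

lemma checks_rises:
  assumes "checks gs w P D rs" "in_window w \<theta>" "in_window w \<tau>" "list_all (\<lambda>q. 0 \<le> peval q \<theta>) gs"
    and "2/5 \<le> \<theta>" "\<theta> < \<tau>" "\<tau> \<le> 1/2"
  shows "game_value_scaled \<theta> < game_value_scaled \<tau>"
proof -
  obtain g X where X: "settled w P = (g, X)" by fastforce
  then have cert: "certified gs w P D rs g X" and rise: "rising w P g X"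
    using assms(1) by (auto simp: checks_def)
  then have w: "window_ok w" and P: "uniform_length P" by (auto simp: certified_def)
  note proper = settled_proper[OF X]
  have "0 < worst_slope g X (mixed P \<theta>)"
    by (rule risingD[OF rise P _ _ w assms(2)]) (use proper in auto)
  then have "0 < (\<tau> - \<theta>) * worst_slope g X (mixed P \<theta>)"
    using assms(6) by simp
  then have "bank_value g X (mixed P \<theta>) \<theta> < bank_value g X (mixed P \<theta>) \<tau>"
    using bank_value_slope[of g X \<theta> \<tau> "mixed P \<theta>"] proper assms(6) by linarith
  then have "core (mixed P \<theta>) \<theta> < core (mixed P \<theta>) \<tau>"
    using core_eq_settled[OF X w P assms(2)] assms(2,3) by simp
  then show ?thesis
    using certified_rises[OF X cert assms(2,4-7)] by simp
qed

lemma abs_dot_le: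
  "length as = length p \<Longrightarrow> list_all ((\<le>) 0) p \<Longrightarrow> sum_list p \<le> 1 \<Longrightarrow> \<bar>dot as p\<bar> \<le> of_int (\<Sum>a\<leftarrow>as. \<bar>a\<bar>)" for p :: "real list"
proof (induction as p rule: list_induct2)
  case (Cons a as x p)
  then have p: "0 \<le> sum_list p" "0 \<le> x"
    by (auto simp: list_all_iff intro!: sum_list_nonneg)
  then have "\<bar>of_int a * x\<bar> \<le> \<bar>real_of_int a\<bar>"
    using Cons.prems mult_left_le[of x "\<bar>real_of_int a\<bar>"] by (simp add: abs_mult)
  then show ?case using Cons p by simp
qed simp

text \<open>The Lipschitz constant does not depend on the mixture, so the maximum over all mixtures inherits it.\<close>

lemma bank_value_lipschitz:
  assumes "proper b" "list_all proper es"
  obtains K where "0 \<le> K" "\<And>p \<theta> \<tau>. mixture p \<Longrightarrow> \<bar>bank_value b es p \<theta> - bank_value b es p \<tau>\<bar> \<le> K * \<bar>\<theta> - \<tau>\<bar>"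
proof -
  define k :: "edge \<Rightarrow> real" where "k e = of_int (\<Sum>a\<leftarrow>slope e. \<bar>a\<bar>)" for e
  have k: "0 \<le> k e" for e
    by (auto simp: k_def intro!: sum_list_nonneg)
  have edge: "\<bar>edge_at e p \<theta> - edge_at e p \<tau>\<bar> \<le> k e * \<bar>\<theta> - \<tau>\<bar>" if "proper e" "mixture p" for e p \<theta> \<tau>
  proof -
    have "\<bar>dot (slope e) p\<bar> \<le> k e"
      unfolding k_def by (rule abs_dot_le) (use that in \<open>auto simp: mixture_def slope_def proper_def\<close>)
    then show ?thesis
      using edge_at_diff[OF that(1), of p \<theta> \<tau>] mult_right_mono[of "\<bar>dot (slope e) p\<bar>" "k e" "\<bar>\<theta> - \<tau>\<bar>"]
      by (simp add: abs_mult mult.commute)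
  qed
  have sums: "\<bar>(\<Sum>e\<leftarrow>es. min 0 (edge_at e p \<theta>)) - (\<Sum>e\<leftarrow>es. min 0 (edge_at e p \<tau>))\<bar> \<le> (\<Sum>e\<leftarrow>es. k e) * \<bar>\<theta> - \<tau>\<bar>"
    if "mixture p" for p \<theta> \<tau>
    using assms(2)
  proof (induction es)
    case (Cons e es)
    have "\<bar>min 0 (edge_at e p \<theta>) - min 0 (edge_at e p \<tau>)\<bar> \<le> k e * \<bar>\<theta> - \<tau>\<bar>"
      using edge[of e p \<theta> \<tau>] Cons.prems that by (simp add: min_def) linarith
    then show ?case using Cons by (simp add: distrib_right) linarith
  qed simp
  show thesis
  proof (rule that[of "k b + (\<Sum>e\<leftarrow>es. k e)"])
    show "0 \<le> k b + (\<Sum>e\<leftarrow>es. k e)"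
      using k by (intro add_nonneg_nonneg sum_list_nonneg) auto
    fix p \<theta> \<tau> assume p: "mixture p"
    show "\<bar>bank_value b es p \<theta> - bank_value b es p \<tau>\<bar> \<le> (k b + (\<Sum>e\<leftarrow>es. k e)) * \<bar>\<theta> - \<tau>\<bar>"
      using edge[OF assms(1) p, of \<theta> \<tau>] sums[OF p, of \<theta> \<tau>] by (simp add: bank_value_def distrib_right)
  qed
qed

lemma proper_all_edges: "list_all proper all_edges" "proper stand_edge"
  by (auto simp: all_edges_def list_all_iff proper_def info_edge_def strategies_def stand_edge_def)

lemma continuous_game_value_scaled: "continuous_on A game_value_scaled"
proof -
  obtain K where K: "0 \<le> K"
      "\<And>p \<theta> \<tau>. mixture p \<Longrightarrow> \<bar>bank_value stand_edge all_edges p \<theta> - bank_value stand_edge all_edges p \<tau>\<bar> \<le> K * \<bar>\<theta> - \<tau>\<bar>"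
    using bank_value_lipschitz[OF proper_all_edges(2,1)] by blast
  have "game_value_scaled \<theta> - game_value_scaled \<tau> \<le> K * \<bar>\<theta> - \<tau>\<bar>" for \<theta> \<tau>
  proof -
    obtain p where p: "mixture p" "game_value_scaled \<theta> = bank_value stand_edge all_edges p \<theta>"
      by (rule value_attained)
    show ?thesis
      using K(2)[OF p(1), of \<theta> \<tau>] value_ge[OF p(1), of \<tau>] p(2) by linarith
  qed
  then have "\<bar>game_value_scaled \<theta> - game_value_scaled \<tau>\<bar> \<le> K * \<bar>\<theta> - \<tau>\<bar>" for \<theta> \<tau>
    by (smt (verit) abs_minus_commute)
  then have "K-lipschitz_on A game_value_scaled"
    using K(1) by (intro lipschitz_onI) (auto simp: dist_real_def)
  then show ?thesis
    by (rule lipschitz_on_continuous_on)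
qed

section \<open>Growth of the value\<close>

text \<open>The maximum of \<open>f\<close> on \<open>[a, b]\<close> can only be attained at \<open>b\<close>.\<close>

lemma strict_mono_on_locally:
  fixes f :: "real \<Rightarrow> real"
  assumes cont: "continuous_on {a..b} f"
    and local: "\<And>x c. a \<le> x \<Longrightarrow> x < c \<Longrightarrow> c \<le> b \<Longrightarrow> \<exists>y. x < y \<and> y \<le> c \<and> f x < f y"
    and ab: "a < b"
  shows "f a < f b"
proof -
  obtain m where m: "m \<in> {a..b}" "\<And>x. x \<in> {a..b} \<Longrightarrow> f x \<le> f m"
    using continuous_attains_sup[OF compact_Icc _ cont] ab by auto
  have top: "x = b" if x: "x \<in> {a..b}" "\<And>y. y \<in> {a..b} \<Longrightarrow> f y \<le> f x" for x
  proof (rule ccontr)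
    assume "x \<noteq> b"
    then obtain y where "x < y" "y \<le> b" "f x < f y"
      using local[of x b] x(1) by auto
    then show False using x(1) x(2)[of y] by simp
  qed
  then have "m = b" using m by blast
  moreover have "f a \<noteq> f b"
    using top[of a] m ab \<open>m = b\<close> by auto
  ultimately show ?thesis
    using m(2)[of a] ab by auto
qed

lemma bank_value_concave:
  assumes "0 \<le> u" "0 \<le> v" "u + v = 1"
  shows "u * bank_value b es p x + v * bank_value b es p y \<le> bank_value b es p (u * x + v * y)"
proof -
  have affine: "edge_at e p (u * x + v * y) = u * edge_at e p x + v * edge_at e p y" for e
  proof -
    have "1 - (u * x + v * y) = u * (1 - x) + v * (1 - y)"
      using assms(3) by (simp add: algebra_simps)
    then show ?thesis unfolding edge_at_def by (simp only: distrib_right distrib_left mult.assoc)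
  qed
  have "u * (\<Sum>e\<leftarrow>es. min 0 (edge_at e p x)) + v * (\<Sum>e\<leftarrow>es. min 0 (edge_at e p y)) \<le> (\<Sum>e\<leftarrow>es. min 0 (edge_at e p (u * x + v * y)))"
  proof (induction es)
    case (Cons e es)
    have "u * min 0 (edge_at e p x) \<le> u * edge_at e p x" "v * min 0 (edge_at e p y) \<le> v * edge_at e p y"
      "u * min 0 (edge_at e p x) \<le> 0" "v * min 0 (edge_at e p y) \<le> 0"
      using assms by (auto intro: mult_left_mono mult_nonneg_nonpos)
    then have "u * min 0 (edge_at e p x) + v * min 0 (edge_at e p y) \<le> min 0 (edge_at e p (u * x + v * y))"
      unfolding affine by simp
    then show ?case using Cons by (simp add: distrib_left del: min.bounded_iff)
  qed simp
  then show ?thesis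
    by (simp add: bank_value_def affine distrib_left)
qed

text \<open>A concave function that gains between \<open>s\<close> and \<open>t\<close> is increasing before \<open>s\<close>.\<close>

lemma bank_value_increasing_before:
  assumes rise: "bank_value b es p s < bank_value b es p t" and "x < y" "y \<le> s" "s < t"
  shows "bank_value b es p x < bank_value b es p y"
proof (rule ccontr)
  let ?f = "bank_value b es p"
  assume "\<not> ?f x < ?f y"
  have conv: "(r - q) * ?f x' + (q - x') * ?f r \<le> (r - x') * ?f q" if "x' < q" "q < r" for x' q r
  proof -
    have "(r - q) / (r - x') * ?f x' + (q - x') / (r - x') * ?f r \<le> ?f ((r - q) / (r - x') * x' + (q - x') / (r - x') * r)"
      by (rule bank_value_concave) (use that in \<open>auto simp: add_divide_distrib[symmetric]\<close>)
    also have "(r - q) / (r - x') * x' + (q - x') / (r - x') * r = q"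
    proof -
      have "(r - q) / (r - x') * x' + (q - x') / (r - x') * r = ((r - q) * x' + (q - x') * r) / (r - x')"
        by (simp add: add_divide_distrib)
      also have "(r - q) * x' + (q - x') * r = q * (r - x')"
        by (simp add: algebra_simps)
      finally show ?thesis using that by simp
    qed
    finally have "((r - q) * ?f x' + (q - x') * ?f r) / (r - x') \<le> ?f q"
      by (simp add: add_divide_distrib)
    then show ?thesis
      using that by (simp add: pos_divide_le_eq mult.commute)
  qed
  have "(t - y) * ?f x + (y - x) * ?f t \<le> (t - x) * ?f y"
    using conv[of x y t] assms by simp
  moreover have "(t - y) * ?f y \<le> (t - y) * ?f x"
    using \<open>\<not> ?f x < ?f y\<close> assms by (intro mult_left_mono) auto
  ultimately have "(y - x) * ?f t \<le> (y - x) * ?f y"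
    by (simp add: algebra_simps)
  then have ty: "?f t \<le> ?f y" using assms by simp
  show False
  proof (cases "y = s")
    case True
    then show False using ty rise by simp
  next
    case False
    then have "(t - s) * ?f y + (s - y) * ?f t \<le> (t - y) * ?f s"
      using conv[of y s t] assms by simp
    moreover have "(t - s) * ?f t \<le> (t - s) * ?f y"
      using ty assms by (intro mult_left_mono) auto
    ultimately have "(t - y) * ?f t \<le> (t - y) * ?f s"
      by (simp add: algebra_simps)
    then show False using rise assms False by simp
  qed
qed


text \<open>The slopes are bounded here for all mixtures at once, by their values at the four vertices.\<close>

fun vertex_slopes :: "edge \<Rightarrow> edge list \<Rightarrow> int list" where
  "vertex_slopes g [] = slope g"
| "vertex_slopes g (e # X) = map2 (+) (map (min 0) (slope e)) (vertex_slopes g X)"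

definition vertex_rising :: "window \<Rightarrow> bool" where
  "vertex_rising w =
    (case settle (always_stand w) (always_draw w) open_edges (base_edge, []) of
       (g, X) \<Rightarrow> list_all ((<) 0) (vertex_slopes g X))"

lemma dot_map_min: "list_all ((\<le>) 0) p \<Longrightarrow> dot (map (min 0) as) p \<le> min 0 (dot as p)" for p :: "real list"
proof (induction as p rule: dot.induct)
  case (1 a as x xs)
  have "of_int (min 0 a) * x \<le> min 0 (of_int a * x)"
    using 1(2) by (auto simp: min_def mult_le_0_iff)
  then show ?case using 1 by simp
qed auto

lemma dot_pos:
  assumes "list_all ((<) 0) as" "list_all ((\<le>) 0) p" "length p = length as" "0 < sum_list p"
  shows "0 < dot as (p :: real list)"
proof -
  have "sum_list p \<le> dot as p"
    using assms(3,1,2)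
  proof (induction p as rule: list_induct2)
    case (Cons x p a as)
    have "1 * x \<le> of_int a * x"
      using Cons.prems by (intro mult_right_mono) auto
    then show ?case using Cons by simp
  qed simp
  then show ?thesis using assms(4) by simp
qed

lemma vertex_slopes_le:
  assumes "proper g" "list_all proper X" "list_all ((\<le>) 0) p"
  shows "dot (vertex_slopes g X) p \<le> worst_slope g X p" "length (vertex_slopes g X) = 4"
proof -
  have "dot (vertex_slopes g X) p \<le> worst_slope g X p \<and> length (vertex_slopes g X) = 4"
    using assms(2)
  proof (induction X)
    case Nil
    then show ?case using assms(1) by (simp add: worst_slope_def slope_def proper_def)
  next
    case (Cons e X)
    then have "length (slope e) = 4" by (simp add: slope_def proper_def)
    then show ?case
      using Cons dot_map_min[OF assms(3), of "slope e"]
      by (simp add: worst_slope_def dot_map2_add del: min.bounded_iff)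
  qed
  then show "dot (vertex_slopes g X) p \<le> worst_slope g X p" "length (vertex_slopes g X) = 4"
    by auto
qed

lemma vertex_risingD:
  assumes "vertex_rising w" "window_ok w" "mixture p" "\<theta> \<in> closed_window w" "\<tau> \<in> closed_window w" "\<theta> < \<tau>"
  shows "core p \<theta> < core p \<tau>"
proof -
  obtain g X where X: "settle (always_stand w) (always_draw w) open_edges (base_edge, []) = (g, X)"
    by fastforce
  note proper = settle_proper[OF X proper_base_edge proper_open_edges]
  have p: "list_all ((\<le>) 0) p" "length p = 4" "0 < sum_list p"
    using assms(3) by (auto simp: mixture_def)
  have eq: "core p \<rho> = bank_value g X p \<rho>" if "\<rho> \<in> closed_window w" for \<rho>
    by (rule bank_value_settle[OF X proper_base_edge proper_open_edges])
       (auto intro: always_stand_nonneg always_draw_nonpos assms(2) p that)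
  have "0 < dot (vertex_slopes g X) p"
    using assms(1) X p vertex_slopes_le(2)[of g X p] proper by (intro dot_pos) (auto simp: vertex_rising_def)
  then have "0 < worst_slope g X p"
    using vertex_slopes_le(1)[of g X p] proper p by auto
  then have "0 < (\<tau> - \<theta>) * worst_slope g X p"
    using assms(6) by simp
  then show ?thesis
    using bank_value_slope[of g X \<theta> \<tau> p] proper assms(6) by (simp add: eq assms(4,5))
qed

lemma vertex_rising_at_two_fifths: "vertex_rising (400, 401, 1000)"
  by code_simp

lemma game_value_increasing_small:
  assumes "x < y" "y \<le> 2/5"
  shows "game_value_scaled x < game_value_scaled y"
proof -
  obtain p where p: "mixture p" "game_value_scaled x = bank_value stand_edge all_edges p x"
    by (rule value_attained)
  have "core p (2/5) < core p (401/1000)"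
    by (rule vertex_risingD[OF vertex_rising_at_two_fifths _ p(1)]) (auto simp: window_ok_def closed_window_def)
  moreover have "bank_value stand_edge all_edges p (2/5) = core p (2/5)"
    by (rule core_eq[OF p(1)]) simp_all
  moreover have "bank_value stand_edge all_edges p (401/1000) = core p (401/1000)"
    by (rule core_eq[OF p(1)]) simp_all
  ultimately have rise: "bank_value stand_edge all_edges p (2/5) < bank_value stand_edge all_edges p (401/1000)"
    by (simp only:)
  have "bank_value stand_edge all_edges p x < bank_value stand_edge all_edges p y"
    by (rule bank_value_increasing_before[OF rise assms]) simp
  then show ?thesis
    using p(2) value_ge[OF p(1), of y] by simp
qed

text \<open>The switching polynomials. The root of each in \<open>(2/5, 1/2)\<close> is the parameter at which the optimal
  basis of the linear program changes. Where one basis ceases to be optimal a sign condition of the next begins to hold,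
  and both conditions are multiples of the same polynomial.\<close>

definition switch1 :: "int list" where "switch1 = [55716, -128711]"
definition switch2 :: "int list" where "switch2 = [-4643, 72197, -140412]"
definition switch3 :: "int list" where "switch3 = [643552, -2109767, 1466215]"
definition switch4 :: "int list" where "switch4 = [-16779, 231714, -433000]"
definition switch5 :: "int list" where "switch5 = [-16528913, 1144331362, -2213155728, -551159808]"
definition switch6 :: "int list" where "switch6 = [-77107697, 9071939465, -19222966632, 53280768]"
definition switch7 :: "int list" where "switch7 = [-64032147, 900502651, -1573877560]"

text \<open>Each certificate lists the window, the unnormalized mixture (coefficients of the four weights), the common denominator
  and the roles of the open edges. The mixture solves the indifference equations of the ties, after the first weight is set
  to zero if so listed; Banker's probabilities solve the equations that make the columns equal.
  In the first window Banker is indifferent at \<open>(10, 10, 6)\<close>, \<open>(10, 11, 6)\<close> and \<open>(11, 10, 6)\<close>, and the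
  mixture \<open>4 : 18 : 18 : 81\<close> is that of two independent Players who draw on 5 with probability \<open>9/11\<close>.\<close>

lemma optimum_window_1:
  "checks [switch1] (4000, 4330, 10000)
    [[4],
     [18],
     [18],
     [81]]
    [0, 10469888, -10469888]
    [Flip,
     Flip,
     Flip,
     Stand,
     Tie [[0, 782848, -602624, -180224], [0, -39424, 95744, -56320], [0, 28160, -95744, 67584], [0, -16896, -16896, 33792]],
     Tie [[-3261744, 12385437, -9320301, 196608], [25456, -61808, -25088, 61440], [-17680, 130416, -39008, -73728], [-46416, 272976, -189696, -36864]],
     Tie [[0, 5183101, -10118605, 196608], [0, 168784, -268288, 61440], [0, -120560, 219744, -73728], [0, 72336, 25920, -36864]]]"
  by code_simp

lemma optimum_window_2:
  "checks [pneg switch1, switch2] (4328, 4389, 10000)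
    [[-18572, 288788, -561648],
     [-83574, -37638, 561648],
     [27858, -295060, 561648],
     [125361, 9414, -561648]]
    [4419244544, -7404114432, 2984869888]
    [Flip,
     Flip,
     Flip,
     Tie [[-3604240640, 18118998040, -13896228632, -618528768], [-80903680, -718761472, 687205376, 112459776], [-53099904, -16601728, -585728, 70287360], [-53099904, 312284544, -217012224, -42172416], [35930752, -3285403264, 2518483968, 730988544]],
     Flip,
     Tie [[79850496, -5066336, 83812960, -158597120], [45281280, -61726720, -12390400, 28835840], [-8616960, 35256320, -44661760, 18022400], [-8616960, 6420480, 13009920, -10813440], [93716480, 0, -281149440, 187432960]],
     Stand,
     Tie [[2431998757, -5330883253, 266170592, 51904512], [-203549120, 351891584, 37883904, -9437184], [30532368, -43397632, 58765312, -5898240], [30532368, -904896, -65789952, 3538944], [0, -275644928, 988975104, -61341696]]]"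
  by code_simp

lemma optimum_window_3:
  "checks [pneg switch2, switch3] (4388, 4390, 10000)
    [[0, 0],
     [-9286, 22762],
     [850, -640],
     [13111, -25642]]
    [404518400, -709096960, 304578560]
    [Tie [[-331705088, 1704476488, -1372771400]],
     Stand,
     Tie [[229873711, -506046847, 54464160]]]"
  by code_simp

lemma optimum_window_4:
  "checks [pneg switch3, switch4] (4389, 4490, 10000)
    [[0, 0],
     [0, 24],
     [-2, 24],
     [-9, 84]]
    [-951808, 12373504, -11421696]
    [Stand,
     Tie [[-7079072, 23207437, -16128365]],
     Tie [[6489737, -15582418, 3235968]]]"
  by code_simp

lemma optimum_window_5:
  "checks [pneg switch4, switch5] (4487, 4501, 10000)
    [[167790, -2317140, 4330000],
     [755055, 340194, -4313616],
     [-142222, 2323412, -4313616],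
     [-639999, -311970, 4387344]]
    [2281483776, -1721820672, 902313984, -1461977088]
    [Tie [[417221229568, -1327201848544, 877817123040, 32163495936]],
     Stand,
     Tie [[381522944, -1838219680, 3471565856, -2014869120]],
     Tie [[294691771, -94558498, -1051044150, 441237504]]]"
  by code_simp

lemma optimum_window_6a:
  "checks [pneg switch5] (4500, 4560, 10000)
    [[604, -3600, 9024],
     [2718, 27288, -2880],
     [-906, 30912, -2880],
     [-4077, 95616, 30528]]
    [-143723008, 13141613056, -10073935872, -2923954176]
    [Flip,
     Draw,
     Tie [[-31918441984, 101960002144, -67454985312, -2586574848], [176816640, -247543296, 295646208, -224919552]],
     Tie [[-679590912, 1272411360, 2939499552, -3532320000], [3322880, 40663040, -91294720, 47308800]],
     Tie [[-78762657, 9234092841, -19358146152, 97910784], [1654960, -162153376, 135179520, -44630016]]]"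
  by code_simp

lemma optimum_window_6b:
  "checks [switch6] (4550, 4639, 10000)
    [[604, -3600, 9024],
     [2718, 27288, -2880],
     [-906, 30912, -2880],
     [-4077, 95616, 30528]]
    [-143723008, 13141613056, -10073935872, -2923954176]
    [Tie [[-31741625344, 101712458848, -67159339104, -2811494400]],
     Tie [[-676268032, 1313074400, 2848204832, -3485011200]],
     Tie [[-77107697, 9071939465, -19222966632, 53280768]]]"
  by code_simp

lemma optimum_window_7:
  "checks [pneg switch6, switch7] (4638, 4890, 10000)
    [[0, 0, 0],
     [302, 1824, -2400],
     [0, 2400, -2400],
     [-453, 9876, -10656]]
    [-13065728, 1220044800, -1337376768]
    [Tie [[-2673173152, 6515233088, -1372520448]],
     Tie [[-64032147, 900502651, -1573877560]]]"
  by code_simp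

lemma optimum_window_8a:
  "checks [pneg switch7] (4889, 4955, 10000)
    [[0, 0, 0],
     [31710, 173320, -206400],
     [-1370, 239480, -206400],
     [-33043, 916416, -916416]]
    [-562224, 276476928, -276476928]
    [Tie [[-64594371, 1176979579, -1850354488]],
     Tie [[-754077120, 2548457077, -1857619768]]]"
  by code_simp


definition locally_rising :: "real \<Rightarrow> bool" where
  "locally_rising \<theta> \<longleftrightarrow> (\<exists>t>\<theta>. \<forall>\<tau>. \<theta> < \<tau> \<and> \<tau> < t \<and> \<tau> \<le> 1/2 \<longrightarrow> game_value_scaled \<theta> < game_value_scaled \<tau>)"

lemma checks_locally_rising:
  assumes "checks gs (a, b, d) P D rs" "in_window (a, b, d) \<theta>" "list_all (\<lambda>q. 0 \<le> peval q \<theta>) gs" "2/5 \<le> \<theta>"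
  shows "locally_rising \<theta>"
  unfolding locally_rising_def
proof (intro exI conjI allI impI)
  show "\<theta> < of_int b / of_int d"
    using assms(2) by (simp add: in_window_def)
  fix \<tau> assume "\<theta> < \<tau> \<and> \<tau> < of_int b / of_int d \<and> \<tau> \<le> 1/2"
  then show "game_value_scaled \<theta> < game_value_scaled \<tau>"
    using assms by (intro checks_rises[OF assms(1,2) _ assms(3,4)]) (auto simp: in_window_def)
qed

text \<open>The windows overlap around each root; away from the overlap the sign of the switching polynomial is fixed.\<close>

lemma switch_signs:
  "nonneg_on (4000, 4328, 10000) switch1" "nonneg_on (4330, 4389, 10000) (pneg switch1)"
  "nonneg_on (4328, 4388, 10000) switch2" "nonneg_on (4389, 4390, 10000) (pneg switch2)"
  "nonneg_on (4388, 4389, 10000) switch3" "nonneg_on (4390, 4490, 10000) (pneg switch3)"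
  "nonneg_on (4389, 4487, 10000) switch4" "nonneg_on (4490, 4501, 10000) (pneg switch4)"
  "nonneg_on (4487, 4500, 10000) switch5" "nonneg_on (4501, 4560, 10000) (pneg switch5)"
  "nonneg_on (4550, 4638, 10000) switch6" "nonneg_on (4639, 4890, 10000) (pneg switch6)"
  "nonneg_on (4638, 4889, 10000) switch7" "nonneg_on (4890, 4955, 10000) (pneg switch7)"
  by code_simp+

lemma switch_nonneg:
  assumes "nonneg_on (a, b, d) q" "0 \<le> a" "a < b" "0 < d" "of_int a / of_int d \<le> \<theta>" "\<theta> < of_int b / of_int d"
  shows "0 \<le> peval q \<theta>"
  by (rule nonneg_onD[OF assms(1)]) (use assms in \<open>auto simp: window_ok_def in_window_def\<close>)

lemma locally_rising_middle:
  assumes "2/5 \<le> \<theta>" "\<theta> < 4955/10000"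
  shows "locally_rising \<theta>"
proof -
  let ?s = "\<lambda>q. peval q \<theta>"
  note rise = checks_locally_rising[where \<theta> = \<theta>]
  note sign = switch_signs[THEN switch_nonneg, where \<theta> = \<theta>]
  have w1: "locally_rising \<theta>" if "\<theta> < 4330/10000" "0 \<le> ?s switch1"
    by (rule rise[OF optimum_window_1]) (use assms that in \<open>auto simp: in_window_def\<close>)
  have w2: "locally_rising \<theta>" if "4328/10000 \<le> \<theta>" "\<theta> < 4389/10000" "?s switch1 \<le> 0" "0 \<le> ?s switch2"
    by (rule rise[OF optimum_window_2]) (use assms that in \<open>auto simp: in_window_def peval_pneg\<close>)
  have w3: "locally_rising \<theta>" if "4388/10000 \<le> \<theta>" "\<theta> < 4390/10000" "?s switch2 \<le> 0" "0 \<le> ?s switch3"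
    by (rule rise[OF optimum_window_3]) (use assms that in \<open>auto simp: in_window_def peval_pneg\<close>)
  have w4: "locally_rising \<theta>" if "4389/10000 \<le> \<theta>" "\<theta> < 4490/10000" "?s switch3 \<le> 0" "0 \<le> ?s switch4"
    by (rule rise[OF optimum_window_4]) (use assms that in \<open>auto simp: in_window_def peval_pneg\<close>)
  have w5: "locally_rising \<theta>" if "4487/10000 \<le> \<theta>" "\<theta> < 4501/10000" "?s switch4 \<le> 0" "0 \<le> ?s switch5"
    by (rule rise[OF optimum_window_5]) (use assms that in \<open>auto simp: in_window_def peval_pneg\<close>)
  have w6a: "locally_rising \<theta>" if "4500/10000 \<le> \<theta>" "\<theta> < 4560/10000" "?s switch5 \<le> 0"
    by (rule rise[OF optimum_window_6a]) (use assms that in \<open>auto simp: in_window_def peval_pneg\<close>)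
  have w6b: "locally_rising \<theta>" if "4550/10000 \<le> \<theta>" "\<theta> < 4639/10000" "0 \<le> ?s switch6"
    by (rule rise[OF optimum_window_6b]) (use assms that in \<open>auto simp: in_window_def peval_pneg\<close>)
  have w7: "locally_rising \<theta>" if "4638/10000 \<le> \<theta>" "\<theta> < 4890/10000" "?s switch6 \<le> 0" "0 \<le> ?s switch7"
    by (rule rise[OF optimum_window_7]) (use assms that in \<open>auto simp: in_window_def peval_pneg\<close>)
  have w8: "locally_rising \<theta>" if "4889/10000 \<le> \<theta>" "\<theta> < 4955/10000" "?s switch7 \<le> 0"
    by (rule rise[OF optimum_window_8a]) (use assms that in \<open>auto simp: in_window_def peval_pneg\<close>)
  have s: "\<theta> < 4328/10000 \<Longrightarrow> 0 \<le> ?s switch1" "4330/10000 \<le> \<theta> \<Longrightarrow> \<theta> < 4389/10000 \<Longrightarrow> ?s switch1 \<le> 0"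
    "4328/10000 \<le> \<theta> \<Longrightarrow> \<theta> < 4388/10000 \<Longrightarrow> 0 \<le> ?s switch2" "4389/10000 \<le> \<theta> \<Longrightarrow> \<theta> < 4390/10000 \<Longrightarrow> ?s switch2 \<le> 0"
    "4388/10000 \<le> \<theta> \<Longrightarrow> \<theta> < 4389/10000 \<Longrightarrow> 0 \<le> ?s switch3" "4390/10000 \<le> \<theta> \<Longrightarrow> \<theta> < 4490/10000 \<Longrightarrow> ?s switch3 \<le> 0"
    "4389/10000 \<le> \<theta> \<Longrightarrow> \<theta> < 4487/10000 \<Longrightarrow> 0 \<le> ?s switch4" "4490/10000 \<le> \<theta> \<Longrightarrow> \<theta> < 4501/10000 \<Longrightarrow> ?s switch4 \<le> 0"
    "4487/10000 \<le> \<theta> \<Longrightarrow> \<theta> < 4500/10000 \<Longrightarrow> 0 \<le> ?s switch5" "4501/10000 \<le> \<theta> \<Longrightarrow> \<theta> < 4560/10000 \<Longrightarrow> ?s switch5 \<le> 0"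
    "4550/10000 \<le> \<theta> \<Longrightarrow> \<theta> < 4638/10000 \<Longrightarrow> 0 \<le> ?s switch6" "4639/10000 \<le> \<theta> \<Longrightarrow> \<theta> < 4890/10000 \<Longrightarrow> ?s switch6 \<le> 0"
    "4638/10000 \<le> \<theta> \<Longrightarrow> \<theta> < 4889/10000 \<Longrightarrow> 0 \<le> ?s switch7" "4890/10000 \<le> \<theta> \<Longrightarrow> \<theta> < 4955/10000 \<Longrightarrow> ?s switch7 \<le> 0"
    using sign assms by (simp_all add: peval_pneg)
  consider "\<theta> < 4330/10000" | "4330/10000 \<le> \<theta>" "\<theta> < 4389/10000" | "4389/10000 \<le> \<theta>" "\<theta> < 4390/10000"
    | "4390/10000 \<le> \<theta>" "\<theta> < 4490/10000" | "4490/10000 \<le> \<theta>" "\<theta> < 4501/10000" | "4501/10000 \<le> \<theta>" "\<theta> < 4555/10000"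
    | "4555/10000 \<le> \<theta>" "\<theta> < 4639/10000" | "4639/10000 \<le> \<theta>" "\<theta> < 4890/10000" | "4890/10000 \<le> \<theta>"
    by linarith
  then show ?thesis
  proof cases
    case 1 then show ?thesis using w1 w2 s(1,3) by linarith
  next
    case 2 then show ?thesis using w2 w3 s(2,3,5) by linarith
  next
    case 3 then show ?thesis using w3 w4 s(4,7) by linarith
  next
    case 4 then show ?thesis using w4 w5 s(6,7,9) by linarith
  next
    case 5 then show ?thesis using w5 w6a s(8,9) by linarith
  next
    case 6 then show ?thesis using w6a s(10) by linarith
  next
    case 7 then show ?thesis using w6b w7 s(11,13) by linarith
  next
    case 8 then show ?thesis using w7 w8 s(12,13) by linarith
  next
    case 9 then show ?thesis using w8 s(14) assms by linarith
  qed
qed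

section \<open>The last window\<close>

text \<open>Here the edges at \<open>(2, 5, 5)\<close> and \<open>(9, 3, 4)\<close> flip, and the bound that leaves both open is too weak to give a sign for the slope.
  The window extends beyond \<open>1/2\<close>, because windows exclude their right end.\<close>

definition last_window :: window where "last_window = (4950, 5010, 10000)"
definition last_mix :: "int list list" where "last_mix = [[0, 0, 0], [31710, 173320, -206400], [-1370, 239480, -206400], [-33043, 916416, -916416]]"
definition last_denom :: "int list" where "last_denom = [-562224, 276476928, -276476928]"
definition last_roles :: "role list" where "last_roles = [Flip, Tie [[-63935331, 1180318299, -1862436408], [-338640, 1904960, 2490880], [-320400, -5243680, 9591040]], Flip, Tie [[-746053440, 2544554517, -1862436408], [-4026960, -1574560, 5958400], [-3996720, 5477120, -1141760]]]"
definition last_base :: edge where "last_base = ([-94522528, -104537760, -81401904, -91372080], [-94522528, -81401904, -104537760, -91372080])"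
definition edge_2_5_5 :: edge where "edge_2_5_5 = ([405840, 478800, 291920, 344400], [-328944, -306160, -388080, -361200])"
definition edge_9_3_4 :: edge where "edge_9_3_4 = ([328944, 388080, 306160, 361200], [-252048, -320400, -297360, -378000])"
definition edge_6_10_6 :: edge where "edge_6_10_6 = ([-529152, -352768, -49920, -33280], [2665728, -592384, 3144960, -698880])"
definition edge_10_6_6 :: edge where "edge_10_6_6 = ([2665728, 3144960, -592384, -698880], [-529152, -49920, -352768, -33280])"

lemma last_settled: "settled last_window last_mix = (last_base, [edge_2_5_5, edge_6_10_6, edge_9_3_4, edge_10_6_6])"
  by code_simp
lemma last_certified: "certified [] last_window last_mix last_denom last_roles last_base [edge_2_5_5, edge_6_10_6, edge_9_3_4, edge_10_6_6]"
  by code_simp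
lemma last_rising: "rising last_window last_mix (add_edge last_base edge_2_5_5) [edge_6_10_6, edge_9_3_4, edge_10_6_6]"
  by code_simp
lemma last_column: "last (choice_columns last_denom last_base [edge_2_5_5, edge_6_10_6, edge_9_3_4, edge_10_6_6] last_roles [False, False]) =
    [120883358918400, -25717837797150720, 25717837797150720, 0]"
  by code_simp
lemma mix_2_5_5: "mix_poly last_mix (edge_polys edge_2_5_5) = [2758467600, -476366168000, 1419819392000, -948990873600]"
  by code_simp
lemma mix_9_3_4: "mix_poly last_mix (edge_polys edge_9_3_4) = [2737753200, -475935056000, 1418650342400, -948211507200]"
  by code_simp

lemma proper_last: "proper edge_2_5_5" "proper edge_9_3_4"
  by (simp_all add: proper_def edge_2_5_5_def edge_9_3_4_def)

text \<open>At the optimal mixture Banker's indifference at \<open>(2, 5, 5)\<close> is the cubic equation that defines \<open>\<theta>\<^sub>*\<close>.\<close>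

lemma edge_at_edge_2_5_5: "edge_at edge_2_5_5 (mixed last_mix \<theta>) \<theta> = 400 * critical_poly \<theta>"
  using edge_poly_eval[OF proper_last(1), of last_mix \<theta>]
  by (simp add: mix_2_5_5 critical_poly_def power2_eq_square power3_eq_cube algebra_simps)

text \<open>Below \<open>\<theta>\<^sub>*\<close> Banker draws at \<open>(2, 5, 5)\<close>, and by continuity he still does for the same mixture at slightly
  larger parameters. With this decision fixed the slope is positive.\<close>

lemma locally_rising_last:
  assumes "4950/10000 \<le> \<theta>" "\<theta> < 1/2" "critical_poly \<theta> < 0"
  shows "locally_rising \<theta>"
proof -
  let ?p = "mixed last_mix \<theta>" and ?X = "[edge_6_10_6, edge_9_3_4, edge_10_6_6]"
  have win: "in_window last_window \<theta>" and w: "window_ok last_window"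
    using assms by (auto simp: last_window_def in_window_def window_ok_def)
  have P: "uniform_length last_mix" using last_certified by (simp add: certified_def)
  note proper = settled_proper[OF last_settled]
  define E where "E = edge_at edge_2_5_5 ?p \<theta>"
  define m where "m = \<bar>dot (slope edge_2_5_5) ?p\<bar> + 1"
  have E: "E < 0" and m: "0 < m"
    using assms(3) by (auto simp: E_def edge_at_edge_2_5_5 m_def)
  have "0 < worst_slope (add_edge last_base edge_2_5_5) ?X ?p"
    by (rule risingD[OF last_rising P _ _ w win]) (use proper in \<open>auto intro: proper_add_edge\<close>)
  note slope = this
  show ?thesis
    unfolding locally_rising_def
  proof (intro exI conjI allI impI)
    \<comment> \<open>\<open>m\<close> exceeds the slope of the edge, which therefore cannot reach zero before this point.\<close>
    show "\<theta> < \<theta> + (- E) / m"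
      using E m by (simp add: divide_neg_pos)
    fix \<tau> assume \<tau>: "\<theta> < \<tau> \<and> \<tau> < \<theta> + (- E) / m \<and> \<tau> \<le> 1/2"
    have win': "in_window last_window \<tau>"
      using \<tau> assms by (auto simp: last_window_def in_window_def)
    have "(\<tau> - \<theta>) * dot (slope edge_2_5_5) ?p \<le> (\<tau> - \<theta>) * m"
      using \<tau> by (intro mult_left_mono) (auto simp: m_def)
    also have "(\<tau> - \<theta>) * m < - E"
      using \<tau> m by (simp add: field_simps)
    finally have neg: "edge_at edge_2_5_5 ?p \<tau> < 0"
      using edge_at_diff[OF proper_last(1), of ?p \<tau> \<theta>] by (simp add: E_def)
    have eq: "core ?p \<rho> = bank_value (add_edge last_base edge_2_5_5) ?X ?p \<rho>"
      if "in_window last_window \<rho>" "edge_at edge_2_5_5 ?p \<rho> < 0" for \<rho>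
      using core_eq_settled[OF last_settled w P win that(1)] that(2) proper
      by (simp add: bank_value_def edge_at_add_edge)
    have "0 < (\<tau> - \<theta>) * worst_slope (add_edge last_base edge_2_5_5) ?X ?p"
      using slope \<tau> by simp
    then have "core ?p \<theta> < core ?p \<tau>"
      using bank_value_slope[of "add_edge last_base edge_2_5_5" ?X \<theta> \<tau> ?p] proper \<tau> E
      by (simp add: eq[OF win] eq[OF win' neg] E_def proper_add_edge)
    then show "game_value_scaled \<theta> < game_value_scaled \<tau>"
      using certified_rises[OF last_settled last_certified win] \<tau> assms by simp
  qed
qed

section \<open>The root of the cubic and the decrease beyond it\<close>

text \<open>The quotient \<open>(critical_poly y - critical_poly x) / (y - x)\<close> is positive on this interval.\<close>

lemma critical_poly_strict_mono:
  assumes "0.49 < x" "x < y" "y \<le> 0.5"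
  shows "critical_poly x < critical_poly y"
proof -
  have x: "49/100 < x" "x < y" "y \<le> 1/2"
    using assms by simp_all
  have "x * x \<le> 1/2 * (1/2)" "x * y \<le> 1/2 * (1/2)" "y * y \<le> 1/2 * (1/2)"
    using x by - (rule mult_mono; linarith)+
  then have "0 < -1190915420 + 3549548480 * (x + y) - 2372477184 * (x * x + x * y + y * y)"
    using assms by simp
  then have "0 < (y - x) * (-1190915420 + 3549548480 * (x + y) - 2372477184 * (x * x + x * y + y * y))"
    using assms by simp
  also have "\<dots> = critical_poly y - critical_poly x"
    by (simp add: critical_poly_def power2_eq_square power3_eq_cube algebra_simps)
  finally show ?thesis by simp
qed

lemma critical_root:
  "\<exists>!\<theta>. 0.49 < \<theta> \<and> \<theta> < 0.5 \<and> critical_poly \<theta> = 0"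
  "0.496088 < theta_star" "theta_star < 0.4960884" "critical_poly theta_star = 0"
proof -
  have cont: "continuous_on A critical_poly" for A
    unfolding critical_poly_def by (intro continuous_intros)
  have neg: "critical_poly 0.496088 < 0" and pos: "0 < critical_poly 0.4960884"
    by (simp_all add: critical_poly_def power2_eq_square power3_eq_cube)
  then obtain r where r: "0.496088 \<le> r" "r \<le> 0.4960884" "critical_poly r = 0"
    using IVT'[of critical_poly "0.496088" 0 "0.4960884"] cont by auto
  have strict: "0.496088 < r" "r < 0.4960884"
  proof -
    have "r \<noteq> 0.496088" "r \<noteq> 0.4960884"
      using r(3) neg pos by (metis less_irrefl)+
    then show "0.496088 < r" "r < 0.4960884"
      using r(1,2) by linarith+
  qed
  have unique: "\<theta> = r" if "0.49 < \<theta>" "\<theta> < 0.5" "critical_poly \<theta> = 0" for \<theta>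
    using that r strict critical_poly_strict_mono[of \<theta> r] critical_poly_strict_mono[of r \<theta>]
    by (cases \<theta> r rule: linorder_cases) auto
  show ex1: "\<exists>!\<theta>. 0.49 < \<theta> \<and> \<theta> < 0.5 \<and> critical_poly \<theta> = 0"
    using r(3) strict unique by (intro ex1I[of _ r]) auto
  have "theta_star = r"
    unfolding theta_star_def by (rule the1_equality[OF ex1]) (use r(3) strict in auto)
  then show "0.496088 < theta_star" "theta_star < 0.4960884" "critical_poly theta_star = 0"
    using strict r(3) by auto
qed

text \<open>From \<open>\<theta>\<^sub>*\<close> on Banker stands at both flips: at \<open>(2, 5, 5)\<close> by the sign of the cubic, and at \<open>(9, 3, 4)\<close> because
  the corresponding root, about \<open>0.4960857\<close>, is smaller than \<open>\<theta>\<^sub>*\<close>.\<close>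

lemma game_value_last:
  assumes "theta_star \<le> \<theta>" "\<theta> \<le> 1/2"
  shows "game_value_scaled \<theta> * (276476928 * (\<theta> * (1 - \<theta>)) - 562224) = 120883358918400 - 25717837797150720 * (\<theta> * (1 - \<theta>))"
    and "0 < 276476928 * (\<theta> * (1 - \<theta>)) - 562224"
proof -
  let ?X = "[edge_2_5_5, edge_6_10_6, edge_9_3_4, edge_10_6_6]"
  have lo: "4960/10000 \<le> \<theta>" using assms critical_root(2) by simp
  have win: "in_window last_window \<theta>"
    using assms lo by (auto simp: last_window_def in_window_def)
  have "0 \<le> critical_poly \<theta>"
    using critical_poly_strict_mono[of theta_star \<theta>] assms critical_root(2,4) by (cases "theta_star = \<theta>") auto
  then have 255: "\<not> edge_at edge_2_5_5 (mixed last_mix \<theta>) \<theta> < 0"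
    by (simp add: edge_at_edge_2_5_5)
  \<comment> \<open>The left end separates the root of this polynomial from \<open>\<theta>\<^sub>*\<close>.\<close>
  have "nonneg_on (496087, 501000, 1000000) [2737753200, -475935056000, 1418650342400, -948211507200]"
    by code_simp
  then have "0 \<le> peval [2737753200, -475935056000, 1418650342400, -948211507200] \<theta>"
    by (rule switch_nonneg) (use assms critical_root(2) in auto)
  then have 934: "\<not> edge_at edge_9_3_4 (mixed last_mix \<theta>) \<theta> < 0"
    using edge_poly_eval[OF proper_last(2), of last_mix \<theta>] by (simp add: mix_9_3_4)
  have flips: "flips ?X last_roles = [edge_2_5_5, edge_9_3_4]"
    by (simp add: last_roles_def)
  have "peval last_denom \<theta> * game_value_scaled \<theta> = peval [120883358918400, -25717837797150720, 25717837797150720, 0] \<theta>"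
    using certified_value(1)[OF last_settled last_certified win] assms lo 255 934
    by (simp add: flips last_column)
  moreover have D: "peval last_denom \<theta> = 276476928 * (\<theta> * (1 - \<theta>)) - 562224"
    by (simp add: last_denom_def algebra_simps)
  ultimately show "game_value_scaled \<theta> * (276476928 * (\<theta> * (1 - \<theta>)) - 562224) = 120883358918400 - 25717837797150720 * (\<theta> * (1 - \<theta>))"
    by (simp add: algebra_simps)
  show "0 < 276476928 * (\<theta> * (1 - \<theta>)) - 562224"
    using certified_optimal(1)[OF last_settled last_certified win] by (simp add: D)
qed

lemma game_value_decreasing_last:
  assumes "theta_star \<le> x" "x < y" "y \<le> 1/2"
  shows "game_value_scaled y < game_value_scaled x"
proof -
  define a b where "a = x * (1 - x)" and "b = y * (1 - y)"
  have "b - a = (y - x) * (1 - x - y)"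
    by (simp add: a_def b_def algebra_simps)
  also have "\<dots> > 0"
    using assms by simp
  finally have ab: "a < b" by simp
  note x = game_value_last[of x, folded a_def] and y = game_value_last[of y, folded b_def]
  let ?D = "\<lambda>a. 276476928 * a - 562224 :: real" and ?V = "\<lambda>a. 120883358918400 - 25717837797150720 * a :: real"
  have pos: "0 < ?D a" "0 < ?D b" and val: "game_value_scaled x = ?V a / ?D a" "game_value_scaled y = ?V b / ?D b"
    using x y assms by (simp_all add: field_simps)
  have "?V b * ?D a < ?V a * ?D b"
    using ab by (simp add: algebra_simps)
  then show ?thesis
    unfolding val using pos by (simp add: divide_less_eq less_divide_eq mult.commute)
qed

lemma game_value_scaled_less: "game_value x < game_value y \<longleftrightarrow> game_value_scaled x < game_value_scaled y"
  by (simp add: game_value_scaled_def)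

lemma locally_rising_before_theta_star:
  assumes "0 < \<theta>" "\<theta> < theta_star"
  shows "locally_rising \<theta>"
proof -
  consider "\<theta> < 2/5" | "2/5 \<le> \<theta>" "\<theta> < 4955/10000" | "4955/10000 \<le> \<theta>"
    by linarith
  then show ?thesis
  proof cases
    case 1
    then show ?thesis
      unfolding locally_rising_def using game_value_increasing_small[of \<theta>] by (intro exI[of _ "2/5"]) auto
  next
    case 2
    then show ?thesis by (rule locally_rising_middle)
  next
    case 3
    then have "critical_poly \<theta> < 0"
      using critical_poly_strict_mono[of \<theta> theta_star] assms critical_root(3,4) by simp
    then show ?thesis
      using locally_rising_last[of \<theta>] 3 assms critical_root(3) by simp
  qed
qed

lemma game_value_increasing:
  assumes "0 < x" "x < y" "y \<le> theta_star"
  shows "game_value_scaled x < game_value_scaled y"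
proof (rule strict_mono_on_locally[OF continuous_game_value_scaled _ assms(2)])
  fix z c assume z: "x \<le> z" "z < c" "c \<le> y"
  then have "locally_rising z"
    using assms by (intro locally_rising_before_theta_star) auto
  then obtain t where t: "z < t" "\<And>\<tau>. z < \<tau> \<and> \<tau> < t \<and> \<tau> \<le> 1/2 \<Longrightarrow> game_value_scaled z < game_value_scaled \<tau>"
    by (auto simp: locally_rising_def)
  define \<tau> where "\<tau> = (z + min c t) / 2"
  have "z < \<tau>" "\<tau> < c" "\<tau> < t"
    using z t(1) by (auto simp: \<tau>_def min_def)
  then show "\<exists>\<tau>. z < \<tau> \<and> \<tau> \<le> c \<and> game_value_scaled z < game_value_scaled \<tau>"
    using t(2)[of \<tau>] z assms critical_root(3) by (intro exI[of _ \<tau>]) auto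
qed

lemma game_value_theta_star: "\<bar>game_value theta_star - (-0.008677388)\<bar> < 5 / 10^10"
proof -
  define a where "a = theta_star * (1 - theta_star)"
  define c where "c = 10604499373 * (276476928 * a - 562224)"
  have half: "theta_star \<le> 1/2" using critical_root(3) by simp
  \<comment> \<open>These are \<open>0.496088\<close> and \<open>0.4960884\<close>, and the factor in \<open>c\<close> is \<open>13^9\<close>.\<close>
  have "62011/125000 < theta_star" "theta_star < 1240221/2500000"
    using critical_root(2,3) by simp_all
  then have a: "a \<le> 1240221/2500000 * (1 - 62011/125000)" "62011/125000 * (1 - 1240221/2500000) \<le> a"
    unfolding a_def by - (rule mult_mono; linarith)+
  note last = game_value_last[OF order.refl half, folded a_def]
  have gv: "game_value theta_star * c = 120883358918400 - 25717837797150720 * a"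
    unfolding last(1)[symmetric] by (simp add: c_def game_value_scaled_def)
  have c: "0 < c"
    using last(2) by (simp add: c_def)
  have "game_value theta_star * c < - (86773875 / 10000000000) * c" "- (86773885 / 10000000000) * c < game_value theta_star * c"
    unfolding gv using a by (simp_all add: c_def algebra_simps)
  then have "game_value theta_star < - (86773875 / 10000000000)" "- (86773885 / 10000000000) < game_value theta_star"
    using c by (simp_all only: mult_less_cancel_right_pos)
  then show ?thesis
    unfolding abs_less_iff by simp
qed

theorem mainTheorem4:
  shows "(\<exists>!\<theta>. 0.49 < \<theta> \<and> \<theta> < 0.5 \<and> critical_poly \<theta> = 0) \<and>
    \<bar>theta_star - 0.496088\<bar> < 5 / 10^7 \<and>
    continuous_on {0<..1/2} game_value \<and>
    strict_mono_on {0<..theta_star} game_value \<and>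
    strict_antimono_on {theta_star..1/2} game_value \<and>
    (\<forall>\<theta>\<in>{0<..1/2}. game_value \<theta> \<le> game_value theta_star) \<and>
    \<bar>game_value theta_star - (-0.008677388)\<bar> < 5 / 10^10"
proof (intro conjI)
  show "\<exists>!\<theta>. 0.49 < \<theta> \<and> \<theta> < 0.5 \<and> critical_poly \<theta> = 0"
    by (rule critical_root(1))
  show "\<bar>theta_star - 0.496088\<bar> < 5 / 10^7"
    using critical_root(2,3) by simp
  have "continuous_on {0<..1/2} (\<lambda>\<theta>. (1 / 13^9) * game_value_scaled \<theta>)"
    by (intro continuous_on_mult_left continuous_game_value_scaled)
  then show "continuous_on {0<..1/2} game_value"
    by (simp add: game_value_scaled_def)
  show inc: "strict_mono_on {0<..theta_star} game_value"
    by (auto simp: strict_mono_on_def game_value_scaled_less intro: game_value_increasing)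
  show dec: "strict_antimono_on {theta_star..1/2} game_value"
    by (auto simp: monotone_on_def game_value_scaled_less intro: game_value_decreasing_last)
  show "\<forall>\<theta>\<in>{0<..1/2}. game_value \<theta> \<le> game_value theta_star"
  proof
    fix \<theta> :: real assume "\<theta> \<in> {0<..1/2}"
    then show "game_value \<theta> \<le> game_value theta_star"
      using game_value_increasing[of \<theta> theta_star] game_value_decreasing_last[of theta_star \<theta>]
      by (cases \<theta> theta_star rule: linorder_cases) (auto simp flip: game_value_scaled_less)
  qed
  show "\<bar>game_value theta_star - (-0.008677388)\<bar> < 5 / 10^10"
    by (rule game_value_theta_star)
qed

end
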